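(* Let $(E,H,\mu)$ be an abstract Wiener space and $\mathcal W$ the Brownian motion on $E$. Let $V\subset E$ be a strongly regular open set, $\lambda$ a finite measure on $V$, $\widehat\lambda$ the measure on $\partial V$ defined by $\widehat\lambda:=\lambda\circ H^V$, and let $f\in\mathcal L^1_+(\widehat\lambda)$. Then there exist a Borel measurable function $g:\partial V\to[0,\infty]$ and a $\lambda$-zero set $M\subset V$ which is finely closed and $\lambda$-polar with respect to the Brownian motion on $V$ (killed at the hitting time of $\partial V$), such that $k:=H^Vg\in\mathcal L^1_+(\lambda)$ and $H^Vf$ converges to $f$ controlled by $k$ on $V\setminus M$.
   Context: Abstract Wiener space $(E,H,\mu)$: $H$ is a separable real Hilbert space with norm $|\cdot|$, continuously and densely embedded into a Banach space $(E,\|\cdot\|)$; identifying $H$ with its dual, $E'\subset H\subset E$; $\mu$ is a Gaussian probability measure on the Borel $\sigma$-algebra of $E$ such that every $l\in E'$ is, under $\mu$, normal with mean $0$ and variance $|l|^2$. $\mu_t$ is the image of $\mu$ under $z\mapsto\sqrt t\,z$. The Brownian motion $\mathcal W=(\Omega,\mathcal F,\mathcal F_t,W_t,\theta_t,P^x)$ on $E$ is the path-continuous Borel right process with transition function $P_tf(x)=\int_Ef(x+y)\mu_t(dy)$. For a set $A$, $T_A=\inf\{t>0:W_t\in A\}$. For $V$ open and Borel $f:\partial V\to[0,\infty]$, $H^Vf(x)=E^x(f(W_{T_{E\setminus V}});T_{E\setminus V}<\infty)$, $x\in V$ (well defined since $W_{T_{E\setminus V}}\in\partial V$ $P^x$-a.s.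 on $[T_{E\setminus V}<\infty]$). $\lambda\circ H^V$ is the measure $A\mapsto\int_VH^V1_A\,d\lambda$. $\mathcal L^1_+(\cdot)$ denotes the positive Borel measurable (numerical) integrable functions. An open set $V$ is strongly regular if for each $y\in\partial V$ there is a cone $K$ in $E$ with vertex $y$ such that $V\cap K=\emptyset$; a cone with vertex $y$ is the closed convex hull of $\{y\}\cup\bar B_r(z)$, where $\bar B_r(z)$ is a closed ball ($r>0$) with $y\notin\bar B_r(z)$. Controlled convergence: let $f:\partial V\to\overline{\mathbb R}$, $V_0\subset V$, and $h,k:V\to\overline{\mathbb R}$ with $k\ge0$ and $h|_{V_0},k|_{V_0}$ real valued. $h$ converges to $f$ controlled by $k$ on $V_0$ if for every $A\subset V_0$ and $y\in\partial V\cap\bar A$: (c1) if $\limsup_{A\ni x\to y}k(x)<\infty$, then $f(y)\in\mathbb R$ and $f(y)=\lim_{A\ni x\to y}h(x)$; (c2) if $\lim_{A\ni x\to y}k(x)=\infty$, then $\lim_{A\ni x\to y}\frac{h(x)}{1+k(x)}=0$. For the killed Brownian motion on $V$: the fine topology is the topology on $V$ generated by its excessive functions; a Borel set $M\subset V$ is $\lambda$-polar if the killed process started from $\lambda$ a.s. does not hit $M$ at strictly positive times; $\lambda$-zero means $\lambda(M)=0$. *)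

theory Defs
  imports "HOL-Probability.Probability"
begin

section \<open>Abstract Wiener spaces\<close>

text \<open>The normal law with mean \<open>m\<close> and variance \<open>v \<ge> 0\<close>; variance 0 means a Dirac measure.\<close>

definition normal_law :: "real \<Rightarrow> real \<Rightarrow> real measure" where
  "normal_law m v =
    (if v = 0 then return borel m else density lborel (\<lambda>x. ennreal (normal_density m (sqrt v) x)))"

text \<open>
  The inclusion of \<open>H\<close> in \<open>E\<close> is the map \<open>\<iota>\<close>. Under the identification of \<open>H\<close> with its dual,
  a functional \<open>l\<close> on \<open>E\<close> is the functional \<open>l \<circ> \<iota>\<close> on \<open>H\<close>, whose norm in \<open>H\<close> is its operator norm.
  Separability of \<open>E\<close> (the class \<open>polish_space\<close> on \<open>'e\<close>) is not an additional
  restriction: \<open>E\<close> contains the continuous image of the separable space \<open>H\<close> as a dense subset.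
\<close>

locale abstract_wiener_space =
  fixes \<iota> :: "'h::{real_inner, polish_space} \<Rightarrow> 'e::{banach, polish_space}"
    and \<mu> :: "'e measure"
  assumes embedding_bounded_linear: "bounded_linear \<iota>"
    and embedding_inj: "inj \<iota>"
    and embedding_dense: "closure (range \<iota>) = UNIV"
    and prob_space_wiener: "prob_space \<mu>"
    and sets_wiener: "sets \<mu> = sets borel"
    and law_functional:
      "\<And>l. bounded_linear l \<Longrightarrow> distr \<mu> borel l = normal_law 0 ((onorm (\<lambda>h. l (\<iota> h)))\<^sup>2)"

definition scaled_measure :: "'e::real_normed_vector measure \<Rightarrow> real \<Rightarrow> 'e measure" where
  "scaled_measure \<mu> t = distr \<mu> borel (\<lambda>z. sqrt t *\<^sub>R z)"

text \<open>As an operator on functions, \<open>brownian_kernel \<mu> t\<close> sends \<open>f\<close> to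
  \<open>x \<mapsto> \<integral> f (x + y) \<mu>\<^sub>t(dy)\<close>.\<close>

definition brownian_kernel :: "'e::real_normed_vector measure \<Rightarrow> real \<Rightarrow> 'e \<Rightarrow> 'e measure" where
  "brownian_kernel \<mu> t x = distr (scaled_measure \<mu> t) borel (\<lambda>y. x + y)"


section \<open>Excessive functions and fine topology\<close>

text \<open>
  \<open>Q\<close> is a semigroup of positive operators on \<open>[0, \<infinity>]\<close>-valued functions on the state space \<open>S\<close>;
  functions and operators have total types, but only their values on \<open>S\<close> matter.
\<close>

definition excessive ::
  "'e::topological_space set \<Rightarrow> (real \<Rightarrow> ('e \<Rightarrow> ennreal) \<Rightarrow> 'e \<Rightarrow> ennreal) \<Rightarrow> real \<Rightarrow> ('e \<Rightarrow> ennreal) \<Rightarrow> bool"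
where
  "excessive S Q \<alpha> u \<longleftrightarrow>
    u \<in> borel_measurable (restrict_space borel S) \<and>
    (\<forall>x\<in>S. \<forall>t\<ge>0. ennreal (exp (- \<alpha> * t)) * Q t u x \<le> u x) \<and>
    (\<forall>x\<in>S. ((\<lambda>t. ennreal (exp (- \<alpha> * t)) * Q t u x) \<longlongrightarrow> u x) (at_right 0))"

definition fine_topology ::
  "'e::topological_space set \<Rightarrow> (real \<Rightarrow> ('e \<Rightarrow> ennreal) \<Rightarrow> 'e \<Rightarrow> ennreal) \<Rightarrow> 'e topology" where
  "fine_topology S Q =
    topology_generated_by {{x \<in> S. u x \<in> G} | u G. excessive S Q 0 u \<and> open G}"


section \<open>Borel right processes\<close>

text \<open>
  The transition function \<open>N\<close> is Markovian, hence the lifetime is infinite and no cemetery state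
  is needed. Only times \<open>t \<ge> 0\<close> are relevant. The filtration is right-continuous; it is not
  required to be the augmented one, but may be.
\<close>

locale borel_right_process =
  fixes N :: "real \<Rightarrow> 'e::polish_space \<Rightarrow> 'e measure"
    and \<F> :: "'w measure" and F :: "real \<Rightarrow> 'w measure"
    and X :: "real \<Rightarrow> 'w \<Rightarrow> 'e" and \<theta> :: "real \<Rightarrow> 'w \<Rightarrow> 'w"
    and P :: "'e \<Rightarrow> 'w measure"
  assumes kernel: "\<And>t. 0 \<le> t \<Longrightarrow> N t \<in> borel \<rightarrow>\<^sub>M prob_algebra borel"
    and chapman_kolmogorov: "\<And>s t x. 0 \<le> s \<Longrightarrow> 0 \<le> t \<Longrightarrow> N (s + t) x = N s x \<bind> N t"
    and F_subalgebra: "\<And>t. 0 \<le> t \<Longrightarrow> subalgebra \<F> (F t)"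
    and F_mono: "\<And>s t. 0 \<le> s \<Longrightarrow> s \<le> t \<Longrightarrow> sets (F s) \<subseteq> sets (F t)"
    and F_right_continuous: "\<And>t. 0 \<le> t \<Longrightarrow> sets (F t) = (\<Inter>s\<in>{t<..}. sets (F s))"
    and prob_space_P: "\<And>x. prob_space (P x)"
    and sets_P: "\<And>x. sets (P x) = sets \<F>"
    and adapted: "\<And>t. 0 \<le> t \<Longrightarrow> X t \<in> F t \<rightarrow>\<^sub>M borel"
    and start: "\<And>x. AE \<omega> in P x. X 0 \<omega> = x"
    and shift_space: "\<And>t \<omega>. 0 \<le> t \<Longrightarrow> \<omega> \<in> space \<F> \<Longrightarrow> \<theta> t \<omega> \<in> space \<F>"
    and shift: "\<And>s t \<omega>. 0 \<le> s \<Longrightarrow> 0 \<le> t \<Longrightarrow> \<omega> \<in> space \<F> \<Longrightarrow> X s (\<theta> t \<omega>) = X (s + t) \<omega>"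
    and right_continuous:
      "\<And>t \<omega>. 0 \<le> t \<Longrightarrow> \<omega> \<in> space \<F> \<Longrightarrow> ((\<lambda>s. X s \<omega>) \<longlongrightarrow> X t \<omega>) (at_right t)"
    and markov:
      "\<And>s t x B. 0 \<le> s \<Longrightarrow> 0 \<le> t \<Longrightarrow> B \<in> sets borel \<Longrightarrow>
        AE \<omega> in P x. real_cond_exp (P x) (F t) (\<lambda>\<omega>. indicator B (X (t + s) \<omega>)) \<omega>
          = measure (N s (X t \<omega>)) B"
    and excessive_right_continuous:
      "\<And>\<alpha> u x. 0 < \<alpha> \<Longrightarrow> excessive UNIV (\<lambda>t v y. \<integral>\<^sup>+ z. v z \<partial>N t y) \<alpha> u \<Longrightarrow>
        AE \<omega> in P x. \<forall>t\<ge>0. ((\<lambda>s. u (X s \<omega>)) \<longlongrightarrow> u (X t \<omega>)) (at_right t)"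

locale brownian_motion =
  abstract_wiener_space \<iota> \<mu> + borel_right_process "brownian_kernel \<mu>" \<F> F W \<theta> P
  for \<iota> :: "'h::{real_inner, polish_space} \<Rightarrow> 'e::{banach, polish_space}"
    and \<mu> :: "'e measure"
    and \<F> :: "'w measure" and F :: "real \<Rightarrow> 'w measure"
    and W :: "real \<Rightarrow> 'w \<Rightarrow> 'e" and \<theta> :: "real \<Rightarrow> 'w \<Rightarrow> 'w"
    and P :: "'e \<Rightarrow> 'w measure" +
  assumes continuous_paths: "\<And>\<omega>. \<omega> \<in> space \<F> \<Longrightarrow> continuous_on {0..} (\<lambda>t. W t \<omega>)"


section \<open>Hitting times, harmonic kernel, killed process\<close>

definition hitting_time :: "(real \<Rightarrow> 'w \<Rightarrow> 'e) \<Rightarrow> 'e set \<Rightarrow> 'w \<Rightarrow> ereal" where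
  "hitting_time W A \<omega> = Inf {ereal t | t. 0 < t \<and> W t \<omega> \<in> A}"

text \<open>
  Only \<open>x \<in> V\<close> is meant. For such \<open>x\<close> the exit point lies in \<open>frontier V\<close> almost surely under \<open>P x\<close>,
  so the values of \<open>f\<close> outside \<open>frontier V\<close> do not matter.
\<close>

definition harmonic_kernel ::
  "('e \<Rightarrow> 'w measure) \<Rightarrow> (real \<Rightarrow> 'w \<Rightarrow> 'e) \<Rightarrow> 'e set \<Rightarrow> ('e \<Rightarrow> ennreal) \<Rightarrow> 'e \<Rightarrow> ennreal" where
  "harmonic_kernel P W V f x =
    (\<integral>\<^sup>+ \<omega>. f (W (real_of_ereal (hitting_time W (- V) \<omega>)) \<omega>)
        * indicator {\<omega>. hitting_time W (- V) \<omega> < \<infinity>} \<omega> \<partial>P x)"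

definition harmonic_image ::
  "('e::topological_space \<Rightarrow> 'w measure) \<Rightarrow> (real \<Rightarrow> 'w \<Rightarrow> 'e) \<Rightarrow> 'e set \<Rightarrow> 'e measure \<Rightarrow> 'e measure"
where
  "harmonic_image P W V lam =
    measure_of (frontier V) (sets (restrict_space borel (frontier V)))
      (\<lambda>A. \<integral>\<^sup>+ x. harmonic_kernel P W V (indicator A) x \<partial>lam)"

definition killed_semigroup ::
  "('e \<Rightarrow> 'w measure) \<Rightarrow> (real \<Rightarrow> 'w \<Rightarrow> 'e) \<Rightarrow> 'e set \<Rightarrow> real \<Rightarrow> ('e \<Rightarrow> ennreal) \<Rightarrow> 'e \<Rightarrow> ennreal" where
  "killed_semigroup P W V t u x =
    (\<integral>\<^sup>+ \<omega>. u (W t \<omega>) * indicator {\<omega>. ereal t < hitting_time W (- V) \<omega>} \<omega> \<partial>P x)"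

text \<open>
  The process started from \<open>lam\<close> has the law \<open>\<integral> P x lam(dx)\<close>, so "almost surely" means
  almost surely under \<open>P x\<close> for \<open>lam\<close>-almost every \<open>x\<close>.
\<close>

definition killed_polar ::
  "('e::topological_space \<Rightarrow> 'w measure) \<Rightarrow> (real \<Rightarrow> 'w \<Rightarrow> 'e) \<Rightarrow> 'e set \<Rightarrow> 'e measure \<Rightarrow> 'e set \<Rightarrow> bool"
where
  "killed_polar P W V lam M \<longleftrightarrow>
    M \<in> sets borel \<and> M \<subseteq> V \<and>
    (AE x in lam. AE \<omega> in P x. \<not> (\<exists>t>0. ereal t < hitting_time W (- V) \<omega> \<and> W t \<omega> \<in> M))"

definition L1_plus :: "'a measure \<Rightarrow> ('a \<Rightarrow> ennreal) set" where
  "L1_plus M = {f \<in> borel_measurable M. (\<integral>\<^sup>+ x. f x \<partial>M) < \<infinity>}"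


section \<open>Strong regularity and controlled convergence\<close>

definition cone_with_vertex :: "'e::real_normed_vector \<Rightarrow> 'e set \<Rightarrow> bool" where
  "cone_with_vertex y K \<longleftrightarrow>
    (\<exists>z r. 0 < r \<and> y \<notin> cball z r \<and> K = closure (convex hull ({y} \<union> cball z r)))"

definition strongly_regular :: "'e::real_normed_vector set \<Rightarrow> bool" where
  "strongly_regular V \<longleftrightarrow>
    open V \<and> (\<forall>y \<in> frontier V. \<exists>K. cone_with_vertex y K \<and> V \<inter> K = {})"

definition controlled_convergence ::
  "'e::topological_space set \<Rightarrow> ('e \<Rightarrow> ereal) \<Rightarrow> ('e \<Rightarrow> ereal) \<Rightarrow> ('e \<Rightarrow> ereal) \<Rightarrow> 'e set \<Rightarrow> bool" where
  "controlled_convergence V h f k V0 \<longleftrightarrow>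
    V0 \<subseteq> V \<and> (\<forall>x\<in>V. 0 \<le> k x) \<and> (\<forall>x\<in>V0. \<bar>h x\<bar> \<noteq> \<infinity> \<and> \<bar>k x\<bar> \<noteq> \<infinity>) \<and>
    (\<forall>A y. A \<subseteq> V0 \<longrightarrow> y \<in> frontier V \<inter> closure A \<longrightarrow>
      (Limsup (at y within A) k < \<infinity> \<longrightarrow>
        \<bar>f y\<bar> \<noteq> \<infinity> \<and> (h \<longlongrightarrow> f y) (at y within A)) \<and>
      ((k \<longlongrightarrow> \<infinity>) (at y within A) \<longrightarrow>
        ((\<lambda>x. h x / (1 + k x)) \<longlongrightarrow> 0) (at y within A)))"

end

(* The proof rests on one property of the paths: started in the closure of V, Brownian motion enters
   the interior of the complement of V immediately after leaving V. The laws of the process charge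
   every open ball that misses the origin, up to scaling, so the cone condition bounds from below the
   probability of being in the interior of the complement a short time after the exit; the strong
   Markov property turns this into an almost sure statement. Such a path is a continuity point of the
   exit time and of the exit point, so that H^V g is lower semicontinuous up to the boundary, with
   boundary values g, whenever g >= 0 is lower semicontinuous, and H^V phi is continuous at the
   boundary whenever phi is bounded and continuous.

   By regularity of the exit law there are bounded continuous phi_n and an integrable lower
   semicontinuous g with |f - phi_n| <= 2^(-n) g everywhere. Then |H^V f - H^V phi_n| <= 2^(-n) k for
   k = H^V g, and both clauses of controlled convergence follow. The exceptional set is [k = infinity];
   it is polar by the maximal inequality for the supermartingale k(W_t), where lower semicontinuity of k
   along the paths allows one to look at rational times only. *)
theory Submission
  imports Defs
begin

section \<open>The Hahn-Banach theorem for sublinear functionals\<close>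

text \<open>The Gaussian hypothesis enters through the charged balls: a convex cone of charged
  points that missed a ball would be separated from it by a functional that is nonnegative almost
  surely; being centred normal, it would vanish on \<open>range \<iota>\<close>, hence everywhere.
  The Markov property is given for one pair of times and one set only. It is lifted to whole paths
  in the form: the future after time \<open>t\<close> is \<open>W t\<close> plus a path drawn from
  \<open>P 0\<close>. All starting points then share one probability space, a change of the starting
  point is a uniform perturbation of the path, and limits in the starting point become Fatou's lemma
  or dominated convergence. The obstacle is that \<open>f\<close> is merely integrable, so the error
  of approximating it has to be measured by a function with its own boundary behaviour: a bound on
  \<open>k\<close> along points tending to \<open>y\<close> must bound \<open>g y\<close>, and with
  it the error at \<open>y\<close>. Lower semicontinuity of \<open>g\<close> gives exactly this,
  which is why \<open>g\<close> is built from indicators of open sets and from continuous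
  functions.\<close>

definition sublinear :: "('a::real_vector \<Rightarrow> real) \<Rightarrow> bool" where
  "sublinear p \<longleftrightarrow> (\<forall>x y. p (x + y) \<le> p x + p y) \<and> (\<forall>t x. 0 \<le> t \<longrightarrow> p (t *\<^sub>R x) = t * p x)"

text \<open>The reverse inequality is the assumed one for \<open>inverse t\<close>, so one direction
  of homogeneity suffices.\<close>

lemma sublinearI:
  assumes "\<And>x y. p (x + y) \<le> p x + p y" "\<And>t x. 0 < t \<Longrightarrow> p (t *\<^sub>R x) \<le> t * p x" "p 0 = 0"
  shows "sublinear p"
  unfolding sublinear_def
proof (intro conjI allI impI assms(1))
  fix t :: real and x assume t: "0 \<le> t"
  show "p (t *\<^sub>R x) = t * p x"
  proof (cases "t = 0")
    case False
    with t have "0 < t" by simp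
    have "p (inverse t *\<^sub>R (t *\<^sub>R x)) \<le> inverse t * p (t *\<^sub>R x)"
      using \<open>0 < t\<close> by (intro assms) simp
    with \<open>0 < t\<close> have "t * p x \<le> p (t *\<^sub>R x)" by (simp add: field_simps)
    with assms(2)[OF \<open>0 < t\<close>, of x] show ?thesis by simp
  qed (use assms in simp)
qed

lemma sublinearD:
  assumes "sublinear p"
  shows "p (x + y) \<le> p x + p y" "0 \<le> t \<Longrightarrow> p (t *\<^sub>R x) = t * p x" "p 0 = 0" "- p (- x) \<le> p x"
proof -
  show 1: "p (x + y) \<le> p x + p y" for x y using assms by (auto simp: sublinear_def)
  show 2: "p (t *\<^sub>R x) = t * p x" if "0 \<le> t" for t x using assms that by (auto simp: sublinear_def)
  show 3: "p 0 = 0" using 2[of 0 0] by simp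
  show "- p (- x) \<le> p x" using 1[of x "- x"] 3 by simp
qed

text \<open>Used for three infima: the directional decrease, the lower bound of a chain, and the
  distance to a cone. The witness for sums is the sum of the two parameters, the smaller functional,
  or the sum of the two cone vectors.\<close>

lemma sublinear_INF:
  fixes q :: "'i \<Rightarrow> 'a::real_vector \<Rightarrow> real"
  assumes ne: "I \<noteq> {}" and bdd: "\<And>x. bdd_below ((\<lambda>i. q i x) ` I)"
    and add: "\<And>i j a b. i \<in> I \<Longrightarrow> j \<in> I \<Longrightarrow> \<exists>k\<in>I. q k (a + b) \<le> q i a + q j b"
    and scale: "\<And>c i a. 0 < c \<Longrightarrow> i \<in> I \<Longrightarrow> \<exists>k\<in>I. q k (c *\<^sub>R a) \<le> c * q i a"
    and zero: "(INF i\<in>I. q i 0) = 0"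
  shows "sublinear (\<lambda>x. INF i\<in>I. q i x)"
proof (rule sublinearI)
  show "(INF i\<in>I. q i 0) = 0" by (rule zero)
  let ?u = "\<lambda>x. INF i\<in>I. q i x"
  have upper: "?u x \<le> q k x" if "k \<in> I" for k x using that by (intro cINF_lower bdd)
  fix a b
  have le: "?u (a + b) \<le> q i a + q j b" if "i \<in> I" "j \<in> I" for i j
    using add[OF that, of a b] upper[of _ "a + b"] by (meson order_trans)
  \<comment> \<open>The infimum is taken over \<open>i\<close> with \<open>j\<close> fixed, and then
    over \<open>j\<close>.\<close>
  have "?u (a + b) - q j b \<le> ?u a" if "j \<in> I" for j
    using le[OF _ that] by (intro cINF_greatest ne) (simp add: algebra_simps)
  then have "?u (a + b) - ?u a \<le> ?u b" by (intro cINF_greatest ne) (simp add: algebra_simps)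
  then show "?u (a + b) \<le> ?u a + ?u b" by simp
next
  let ?u = "\<lambda>x. INF i\<in>I. q i x"
  fix c :: real and a assume c: "0 < c"
  have "?u (c *\<^sub>R a) \<le> c * q i a" if i: "i \<in> I" for i
  proof -
    obtain k where "k \<in> I" "q k (c *\<^sub>R a) \<le> c * q i a" using scale[OF c i] by blast
    then show ?thesis using cINF_lower[OF bdd, of k "c *\<^sub>R a"] by simp
  qed
  then have "?u (c *\<^sub>R a) / c \<le> ?u a" using c by (intro cINF_greatest ne) (simp add: field_simps)
  then show "?u (c *\<^sub>R a) \<le> c * ?u a" using c by (simp add: field_simps)
qed

text \<open>For sublinear \<open>p\<close>, this is the greatest sublinear functional below
  \<open>p\<close> whose value at \<open>- y\<close> is at most \<open>- p y\<close>.\<close>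

definition directional_decrease :: "('a::real_vector \<Rightarrow> real) \<Rightarrow> 'a \<Rightarrow> 'a \<Rightarrow> real" where
  "directional_decrease p y x = (INF t\<in>{0..}. p (x + t *\<^sub>R y) - t * p y)"

lemma directional_decrease_bdd:
  assumes "sublinear p"
  shows "bdd_below ((\<lambda>t. p (x + t *\<^sub>R y) - t * p y) ` {0..})"
proof (rule bdd_belowI2)
  fix t :: real assume "t \<in> {0..}"
  then have "t * p y = p ((x + t *\<^sub>R y) + (- x))" using sublinearD(2)[OF assms] by simp
  also have "\<dots> \<le> p (x + t *\<^sub>R y) + p (- x)" by (rule sublinearD[OF assms])
  finally show "- p (- x) \<le> p (x + t *\<^sub>R y) - t * p y" by simp
qed

lemma directional_decrease_le:
  assumes "sublinear p" "0 \<le> t"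
  shows "directional_decrease p y x \<le> p (x + t *\<^sub>R y) - t * p y"
  unfolding directional_decrease_def using assms
  by (intro cINF_lower directional_decrease_bdd) auto

lemma sublinear_directional_decrease:
  assumes "sublinear p"
  shows "sublinear (directional_decrease p y)"
  unfolding directional_decrease_def[abs_def]
proof (rule sublinear_INF)
  show "bdd_below ((\<lambda>t. p (x + t *\<^sub>R y) - t * p y) ` {0..})" for x
    by (rule directional_decrease_bdd[OF assms])
  fix s t :: real and a b assume "s \<in> {0..}" "t \<in> {0..}"
  moreover have "(a + b) + (s + t) *\<^sub>R y = (a + s *\<^sub>R y) + (b + t *\<^sub>R y)" by (simp add: algebra_simps)
  ultimately show "\<exists>k\<in>{0..}. p (a + b + k *\<^sub>R y) - k * p y \<le> p (a + s *\<^sub>R y) - s * p y + (p (b + t *\<^sub>R y) - t * p y)"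
    using sublinearD(1)[OF assms, of "a + s *\<^sub>R y" "b + t *\<^sub>R y"]
    by (intro bexI[of _ "s + t"]) (simp_all add: algebra_simps)
next
  fix c s :: real and a assume "0 < c" "s \<in> {0..}"
  moreover have "c *\<^sub>R a + (c * s) *\<^sub>R y = c *\<^sub>R (a + s *\<^sub>R y)" by (simp add: algebra_simps)
  ultimately show "\<exists>k\<in>{0..}. p (c *\<^sub>R a + k *\<^sub>R y) - k * p y \<le> c * (p (a + s *\<^sub>R y) - s * p y)"
    using sublinearD(2)[OF assms, of c "a + s *\<^sub>R y"]
    by (intro bexI[of _ "c * s"]) (simp_all add: algebra_simps)
next
  have "(\<lambda>t. p (0 + t *\<^sub>R y) - t * p y) ` {0..} = {0}"
    using sublinearD(2)[OF assms] by (auto simp: image_iff intro: exI[of _ 0])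
  then show "(INF t\<in>{0..}. p (0 + t *\<^sub>R y) - t * p y) = 0" by simp
qed simp

text \<open>A pointwise minimal sublinear functional coincides with all its directional decreases,
  which forces it to be odd and hence linear.\<close>

lemma minimal_sublinear_imp_linear:
  assumes m: "sublinear m" and min: "\<And>q. sublinear q \<Longrightarrow> (\<And>x. q x \<le> m x) \<Longrightarrow> q = m"
  shows "linear m"
proof -
  have odd: "m (- y) = - m y" for y
  proof -
    have "directional_decrease m y = m"
      by (rule min[OF sublinear_directional_decrease[OF m]])
        (use directional_decrease_le[OF m, of 0] in simp)
    then have "m (- y) \<le> m (- y + 1 *\<^sub>R y) - 1 * m y"
      using directional_decrease_le[OF m, of 1 y "- y"] by simp
    then show ?thesis using sublinearD(3)[OF m] sublinearD(4)[OF m, of y] by simp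
  qed
  show ?thesis
  proof (rule linearI)
    show "m (x + y) = m x + m y" for x y
      using sublinearD(1)[OF m, of x y] sublinearD(1)[OF m, of "x + y" "- y"] odd[of y] by simp
    show "m (c *\<^sub>R x) = c *\<^sub>R m x" for c x
    proof (cases "0 \<le> c")
      case True
      then show ?thesis using sublinearD(2)[OF m] by simp
    next
      case False
      then show ?thesis using sublinearD(2)[OF m, of "- c" x] odd[of "c *\<^sub>R x"] by simp
    qed
  qed
qed

text \<open>Zorn's lemma is applied below \<open>directional_decrease p x0\<close> and not below
  \<open>p\<close>: a linear functional below it satisfies \<open>l (- x0) \<le> - p x0\<close>,
  which is the contact \<open>l x0 = p x0\<close>. No extension from a subspace occurs.\<close>

theorem hahn_banach_sublinear:
  fixes p :: "'a::real_vector \<Rightarrow> real"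
  assumes p: "sublinear p"
  obtains l where "linear l" "\<And>x. l x \<le> p x" "l x0 = p x0"
proof -
  define p0 where "p0 = directional_decrease p x0"
  have p0: "sublinear p0" unfolding p0_def by (rule sublinear_directional_decrease[OF p])
  have p0_le: "p0 x \<le> p x" for x
    using directional_decrease_le[OF p, of 0 x0 x] by (simp add: p0_def)
  have p0_x0: "p0 (- x0) \<le> - p x0"
    using directional_decrease_le[OF p, of 1 x0 "- x0"] sublinearD(3)[OF p] by (simp add: p0_def)
  define A where "A = {q. sublinear q \<and> (\<forall>x. q x \<le> p0 x)}"
  \<comment> \<open>The order is reversed, so that a Zorn-maximal element is a pointwise minimal
    functional.\<close>
  define R :: "('a \<Rightarrow> real) \<Rightarrow> ('a \<Rightarrow> real) \<Rightarrow> bool" where "R = (\<lambda>q q'. \<forall>x. q' x \<le> q x)"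
  have "\<exists>m\<in>A. \<forall>a\<in>A. R m a \<longrightarrow> a = m"
  proof (rule predicate_Zorn)
    show "partial_order_on A (relation_of R A)"
      by (rule partial_order_on_relation_ofI) (auto simp: R_def intro: order_trans order_antisym intro!: ext)
  next
    fix C assume "C \<in> Chains (relation_of R A)"
    then have C: "C \<subseteq> A" "\<And>q q'. q \<in> C \<Longrightarrow> q' \<in> C \<Longrightarrow> R q q' \<or> R q' q"
      by (auto simp: Chains_def relation_of_def)
    show "\<exists>u\<in>A. \<forall>a\<in>C. R a u"
    proof (cases "C = {}")
      case True
      then show ?thesis using p0 by (auto simp: A_def)
    next
      case False
      define u where "u x = (INF q\<in>C. q x)" for x
      \<comment> \<open>A bound common to the whole chain, so that its pointwise infimum is
        finite.\<close>
      have lower: "- p0 (- x) \<le> q x" if "q \<in> C" for q x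
      proof -
        have "sublinear q" "q (- x) \<le> p0 (- x)" using C that by (auto simp: A_def)
        then show ?thesis using sublinearD(4)[of q x] by linarith
      qed
      have bdd: "bdd_below ((\<lambda>q. q x) ` C)" for x
        using lower by (intro bdd_belowI2[where m="- p0 (- x)"]) auto
      have u_le: "u x \<le> q x" if "q \<in> C" for q x
        unfolding u_def using that by (intro cINF_lower bdd)
      have C_sub: "sublinear q" if "q \<in> C" for q using C that by (auto simp: A_def)
      have "sublinear u"
        unfolding u_def[abs_def]
      proof (rule sublinear_INF[OF False bdd])
        fix q q' a b assume q: "q \<in> C" "q' \<in> C"
        then obtain r where r: "r \<in> C" "r a \<le> q a" "r b \<le> q' b"
          using C(2)[OF q] by (auto simp: R_def)
        then show "\<exists>k\<in>C. k (a + b) \<le> q a + q' b"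
          using sublinearD(1)[OF C_sub[OF r(1)], of a b] by (intro bexI[of _ r]) auto
      next
        fix c :: real and q a assume "0 < c" "q \<in> C"
        then show "\<exists>k\<in>C. k (c *\<^sub>R a) \<le> c * q a"
          using sublinearD(2)[OF C_sub, of q c a] by (intro bexI[of _ q]) auto
      next
        have "(\<lambda>q. q 0) ` C = {0}" using False sublinearD(3)[OF C_sub] by (auto simp: image_iff)
        then show "(INF q\<in>C. q 0) = 0" by simp
      qed
      moreover have "u x \<le> p0 x" for x
      proof -
        obtain q where "q \<in> C" using False by auto
        with C have "q x \<le> p0 x" by (auto simp: A_def)
        with u_le[OF \<open>q \<in> C\<close>, of x] show ?thesis by linarith
      qed
      ultimately show ?thesis using u_le by (auto simp: A_def R_def)
    qed
  qed
  then obtain m where "m \<in> A" and minA: "\<And>a. a \<in> A \<Longrightarrow> R m a \<Longrightarrow> a = m" by blast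
  then have m: "sublinear m" "\<And>x. m x \<le> p0 x" by (auto simp: A_def)
  have min: "q = m" if "sublinear q" "\<And>x. q x \<le> m x" for q
    using that m(2) by (intro minA) (auto simp: A_def R_def intro: order_trans)
  have lin: "linear m" by (rule minimal_sublinear_imp_linear[OF m(1) min])
  have "m (- x0) = - m x0" using lin by (rule linear_neg)
  then have "p x0 \<le> m x0" using m(2)[of "- x0"] p0_x0 by simp
  with m(2) p0_le show ?thesis
    by (intro that[OF lin]) (auto intro: order_trans antisym)
qed

text \<open>\<open>p\<close> is the distance to the cone \<open>- D\<close>, sublinear because
  \<open>D\<close> is a convex cone. A linear \<open>l \<le> p\<close> is bounded by the norm since
  \<open>0 \<in> D\<close>, and \<open>l (- d) \<le> p (- d) \<le> 0\<close> for
  \<open>d \<in> D\<close>; touching \<open>p\<close> at \<open>- v\<close> gives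
  \<open>l (- v) \<ge> r\<close>.\<close>

theorem separate_convex_cone_from_ball:
  fixes D :: "'a::real_normed_vector set"
  assumes add: "\<And>x y. x \<in> D \<Longrightarrow> y \<in> D \<Longrightarrow> x + y \<in> D"
    and scale: "\<And>c x. 0 < c \<Longrightarrow> x \<in> D \<Longrightarrow> c *\<^sub>R x \<in> D"
    and zero: "0 \<in> D" and disj: "D \<inter> ball v r = {}" and r: "0 < r"
  obtains l :: "'a \<Rightarrow> real" where "bounded_linear l" "\<And>d. d \<in> D \<Longrightarrow> 0 \<le> l d" "l v < 0"
proof -
  define p where "p x = (INF d\<in>D. norm (x + d))" for x
  have ne: "D \<noteq> {}" using zero by auto
  have bdd: "bdd_below ((\<lambda>d. norm (x + d)) ` D)" for x by (intro bdd_belowI2[where m=0]) simp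
  have p_le: "p x \<le> norm (x + d)" if "d \<in> D" for x d
    unfolding p_def using that by (intro cINF_lower bdd)
  have sub: "sublinear p"
    unfolding p_def[abs_def]
  proof (rule sublinear_INF[OF ne bdd])
    fix d d' a b assume "d \<in> D" "d' \<in> D"
    then show "\<exists>k\<in>D. norm (a + b + k) \<le> norm (a + d) + norm (b + d')"
      using norm_triangle_ineq[of "a + d" "b + d'"] by (intro bexI[of _ "d + d'"] add) (simp add: algebra_simps)
  next
    fix c :: real and d a assume "0 < c" "d \<in> D"
    then show "\<exists>k\<in>D. norm (c *\<^sub>R a + k) \<le> c * norm (a + d)"
      by (intro bexI[of _ "c *\<^sub>R d"] scale) (simp_all flip: scaleR_add_right)
  next
    have "p 0 \<le> 0" using p_le[OF zero, of 0] by simp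
    moreover have "0 \<le> p 0" unfolding p_def by (intro cINF_greatest ne) simp
    ultimately show "(INF d\<in>D. norm (0 + d)) = 0" by (simp add: p_def)
  qed
  obtain l where l: "linear l" "\<And>x. l x \<le> p x" "l (- v) = p (- v)"
    using hahn_banach_sublinear[OF sub, of "- v"] by blast
  have le_norm: "l x \<le> norm x" for x using l(2)[of x] p_le[OF zero, of x] by simp
  have "bounded_linear l"
    using le_norm le_norm[of "- x" for x] linear_neg[OF l(1)]
    by (intro bounded_linear_intro[where K=1])
       (auto simp: linear_add[OF l(1)] linear_scale[OF l(1)] abs_le_iff)
  moreover have "0 \<le> l d" if "d \<in> D" for d
    using l(2)[of "- d"] p_le[OF that, of "- d"] linear_neg[OF l(1), of d] by simp
  moreover have "r \<le> norm (- v + d)" if "d \<in> D" for d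
    using disj that by (auto simp: dist_norm norm_minus_commute not_less[symmetric])
  then have "r \<le> p (- v)" unfolding p_def by (intro cINF_greatest ne)
  then have "l v < 0" using l(3) r linear_neg[OF l(1), of v] by simp
  ultimately show ?thesis using that by blast
qed


section \<open>Approximation by continuous functions with lower semicontinuous error\<close>

text \<open>Sequences instead of neighbourhoods, because these limits are passed under integrals by
  Fatou's lemma.\<close>

definition seq_lsc :: "('a::topological_space \<Rightarrow> ennreal) \<Rightarrow> bool" where
  "seq_lsc w \<longleftrightarrow> (\<forall>X x. X \<longlonglongrightarrow> x \<longrightarrow> w x \<le> liminf (\<lambda>n. w (X n)))"

lemma seq_lscD: "seq_lsc w \<Longrightarrow> X \<longlonglongrightarrow> x \<Longrightarrow> w x \<le> liminf (\<lambda>n. w (X n))"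
  unfolding seq_lsc_def by blast

lemma seq_lsc_continuous:
  fixes \<phi> :: "'a::topological_space \<Rightarrow> ennreal"
  assumes "continuous_on UNIV \<phi>"
  shows "seq_lsc \<phi>"
  unfolding seq_lsc_def
proof (intro allI impI)
  fix X :: "nat \<Rightarrow> 'a" and x :: 'a assume "X \<longlonglongrightarrow> x"
  then have "(\<lambda>n. \<phi> (X n)) \<longlonglongrightarrow> \<phi> x" using continuous_on_tendsto_compose[OF assms] by auto
  then show "\<phi> x \<le> liminf (\<lambda>n. \<phi> (X n))" by (simp add: lim_imp_Liminf)
qed

lemma seq_lsc_indicator:
  fixes U :: "'a::topological_space set"
  shows "open U \<Longrightarrow> seq_lsc (\<lambda>x. c * indicator U x)"
  unfolding seq_lsc_def
proof (intro allI impI)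
  fix X :: "nat \<Rightarrow> 'a" and x :: 'a assume U: "open U" and X: "X \<longlonglongrightarrow> x"
  show "c * indicator U x \<le> liminf (\<lambda>n. c * indicator U (X n))"
  proof (cases "x \<in> U")
    case True
    with topological_tendstoD[OF X U] have "eventually (\<lambda>n. X n \<in> U) sequentially" by simp
    then have "eventually (\<lambda>n. c \<le> c * indicator U (X n)) sequentially"
      by eventually_elim simp
    then show ?thesis using True by (simp add: Liminf_bounded)
  qed simp
qed

text \<open>Fatou's lemma for the counting measure.\<close>

lemma seq_lsc_suminf:
  fixes w :: "nat \<Rightarrow> 'a::topological_space \<Rightarrow> ennreal"
  assumes "\<And>i. seq_lsc (w i)"
  shows "seq_lsc (\<lambda>x. \<Sum>i::nat. w i x)"
  unfolding seq_lsc_def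
proof (intro allI impI)
  fix X :: "nat \<Rightarrow> 'a" and x :: 'a assume X: "X \<longlonglongrightarrow> x"
  have "(\<Sum>i. w i x) \<le> (\<Sum>i. liminf (\<lambda>n. w i (X n)))"
    using seq_lscD[OF assms X] by (intro suminf_le) auto
  also have "\<dots> = (\<integral>\<^sup>+i. liminf (\<lambda>n. w i (X n)) \<partial>count_space UNIV)"
    by (simp add: nn_integral_count_space_nat)
  also have "\<dots> \<le> liminf (\<lambda>n. \<integral>\<^sup>+i. w i (X n) \<partial>count_space UNIV)"
    by (rule nn_integral_liminf) simp
  finally show "(\<Sum>i. w i x) \<le> liminf (\<lambda>n. \<Sum>i. w i (X n))"
    by (simp add: nn_integral_count_space_nat)
qed

text \<open>Fatou's lemma for a single atom of mass \<open>c\<close>; infinite \<open>c\<close> is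
  covered in the same way.\<close>

lemma seq_lsc_cmult:
  fixes w :: "'a::topological_space \<Rightarrow> ennreal"
  assumes "seq_lsc w"
  shows "seq_lsc (\<lambda>x. c * w x)"
  unfolding seq_lsc_def
proof (intro allI impI)
  fix X :: "nat \<Rightarrow> 'a" and x :: 'a assume X: "X \<longlonglongrightarrow> x"
  let ?M = "scale_measure c (count_space (UNIV :: unit set))"
  have int: "(\<integral>\<^sup>+i. f i \<partial>?M) = c * f ()" for f :: "unit \<Rightarrow> ennreal"
    by (subst nn_integral_scale_measure) (auto simp: nn_integral_count_space_finite UNIV_unit)
  have "c * w x \<le> c * liminf (\<lambda>n. w (X n))" by (intro mult_left_mono seq_lscD assms X) simp
  also have "\<dots> = (\<integral>\<^sup>+i. liminf (\<lambda>n. w (X n)) \<partial>?M)" by (simp only: int)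
  also have "\<dots> \<le> liminf (\<lambda>n. \<integral>\<^sup>+i. w (X n) \<partial>?M)"
    by (rule nn_integral_liminf) (simp add: measurable_def)
  finally show "c * w x \<le> liminf (\<lambda>n. c * w (X n))" by (simp only: int)
qed

lemma seq_lsc_add:
  fixes v w :: "'a::topological_space \<Rightarrow> ennreal"
  assumes "seq_lsc v" "seq_lsc w"
  shows "seq_lsc (\<lambda>x. v x + w x)"
proof -
  define u where "u i = (if i = 0 then v else if i = Suc 0 then w else (\<lambda>_. 0))" for i
  have "seq_lsc (\<lambda>x. \<Sum>i. u i x)"
    using assms by (intro seq_lsc_suminf) (simp add: u_def seq_lsc_def)
  moreover have "(\<Sum>i. u i x) = (\<Sum>i<2. u i x)" for x by (intro suminf_finite) (auto simp: u_def)
  ultimately show ?thesis by (simp add: u_def numeral_2_eq_2)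
qed

section \<open>Bounded continuous approximants and their error functions\<close>

definition bounded_continuous :: "('a::topological_space \<Rightarrow> ennreal) \<Rightarrow> bool" where
  "bounded_continuous \<phi> \<longleftrightarrow> continuous_on UNIV \<phi> \<and> (\<exists>c. \<forall>x. \<phi> x \<le> ennreal c)"

lemma bounded_continuous_add:
  assumes "bounded_continuous \<phi>" "bounded_continuous \<psi>"
  shows "bounded_continuous (\<lambda>x. \<phi> x + \<psi> x)"
proof -
  obtain c d where cd: "\<And>x. \<phi> x \<le> ennreal c" "\<And>x. \<psi> x \<le> ennreal d"
    using assms by (auto simp: bounded_continuous_def)
  have "\<phi> x + \<psi> x \<le> ennreal (max c 0 + max d 0)" for x
    using add_mono[OF cd(1)[of x] cd(2)[of x]]
    by (subst ennreal_plus) (auto simp: ennreal_max_0)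
  then show ?thesis
    using assms continuous_on_add_ennreal unfolding bounded_continuous_def by blast
qed

lemma bounded_continuous_sum:
  "(\<And>i. i \<in> I \<Longrightarrow> bounded_continuous (\<phi> i)) \<Longrightarrow> bounded_continuous (\<lambda>x. \<Sum>i\<in>I. \<phi> i x)"
proof (induction I rule: infinite_finite_induct)
  case (insert i I)
  then show ?case by (simp add: bounded_continuous_add)
qed (auto simp: bounded_continuous_def intro!: exI[of _ 0])

lemma bounded_continuous_borel [measurable_dest]:
  "bounded_continuous \<phi> \<Longrightarrow> \<phi> \<in> borel_measurable borel"
  unfolding bounded_continuous_def by (auto intro: borel_measurable_continuous_onI)

lemma ennreal_suminf_tail:
  fixes a :: "nat \<Rightarrow> ennreal"
  assumes "(\<Sum>i. a i) < top" "0 < e"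
  obtains n where "(\<Sum>i. a (i + n)) < ennreal e"
proof -
  define r where "r i = enn2real (a i)" for i
  have "a i < top" for i
    using sum_le_suminf[of a "{i}"] assms(1) by (auto intro: le_less_trans)
  then have a: "a i = ennreal (r i)" for i by (simp add: r_def less_top)
  have r: "0 \<le> r i" for i by (simp add: r_def)
  have "summable r" using assms(1) r unfolding a by (intro summable_suminf_not_top) auto
  then obtain n where n: "norm (\<Sum>i. r (i + n)) < e"
    using suminf_exist_split[OF assms(2)] by blast
  have "(\<Sum>i. a (i + n)) = ennreal (\<Sum>i. r (i + n))"
    unfolding a using r \<open>summable r\<close> by (intro suminf_ennreal2) (auto simp: summable_iff_shift)
  then show ?thesis using n assms(2) by (intro that[of n]) (auto simp: ennreal_lessI)
qed

text \<open>Encodes \<open>|f - \<phi>| \<le> w\<close> by two sums, so that infinite values of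
  \<open>f\<close> are allowed: there the bounded \<open>\<phi>\<close> forces \<open>w\<close> to
  be infinite as well.\<close>

definition lsc_sandwich ::
  "'a::topological_space measure \<Rightarrow> ('a \<Rightarrow> ennreal) \<Rightarrow> real \<Rightarrow> ('a \<Rightarrow> ennreal) \<Rightarrow> ('a \<Rightarrow> ennreal) \<Rightarrow> bool"
where
  "lsc_sandwich \<nu> f e \<phi> w \<longleftrightarrow> bounded_continuous \<phi> \<and> seq_lsc w \<and> w \<in> borel_measurable borel
    \<and> (\<forall>x. f x \<le> \<phi> x + w x) \<and> (\<forall>x. \<phi> x \<le> f x + w x) \<and> (\<integral>\<^sup>+x. w x \<partial>\<nu>) \<le> ennreal e"

definition lsc_approximable :: "'a::topological_space measure \<Rightarrow> ('a \<Rightarrow> ennreal) \<Rightarrow> bool" where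
  "lsc_approximable \<nu> f \<longleftrightarrow> (\<forall>e>0. \<exists>\<phi> w. lsc_sandwich \<nu> f e \<phi> w)"

text \<open>Regularity gives a compact \<open>K\<close> inside \<open>A\<close> and an open
  \<open>U\<close> around \<open>A\<close>. A Urysohn function between them differs from the
  indicator only on \<open>U - K\<close>, and this set is open, so its indicator is an admissible
  error.\<close>

lemma lsc_approximable_indicator:
  fixes \<nu> :: "'a::polish_space measure"
  assumes \<nu>: "sets \<nu> = sets borel" "finite_measure \<nu>" and A: "A \<in> sets borel" and c: "c < top"
  shows "lsc_approximable \<nu> (\<lambda>x. c * indicator A x)"
  unfolding lsc_approximable_def
proof (intro allI impI)
  fix e :: real assume "0 < e"
  interpret finite_measure \<nu> by fact
  \<comment> \<open>\<open>U - K\<close> will have measure at most \<open>2 * d\<close>, so the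
    error integral is at most \<open>c * (2 * d) \<le> e\<close>; adding 1 covers
    \<open>c = 0\<close>.\<close>
  define d where "d = e / (2 * (enn2real c + 1))"
  have cpos: "enn2real c + 1 > 0" by (simp add: add_nonneg_pos)
  then have "0 < d" using \<open>0 < e\<close> by (simp add: d_def)
  have fin: "emeasure \<nu> (space \<nu>) \<noteq> \<infinity>" by simp
  have "emeasure \<nu> A \<noteq> \<infinity>" by simp
  have "{K. K \<subseteq> A \<and> compact K} \<noteq> {}" by (auto intro: exI[of _ "{}"])
  then obtain K where K: "K \<subseteq> A" "compact K" "emeasure \<nu> A \<le> emeasure \<nu> K + ennreal d"
    using SUP_approx_ennreal[OF \<open>0 < d\<close> _ inner_regular[OF \<nu>(1) fin A] \<open>emeasure \<nu> A \<noteq> \<infinity>\<close>]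
    by (auto dest: less_imp_le)
  obtain U where U: "A \<subseteq> U" "open U" "emeasure \<nu> U \<le> emeasure \<nu> A + ennreal d"
    using INF_approx_ennreal[OF _ outer_regular[OF \<nu>(1) fin A] \<open>emeasure \<nu> A \<noteq> \<infinity>\<close>, of d] \<open>0 < d\<close>
    by (auto dest: less_imp_le)
  obtain \<phi> :: "'a \<Rightarrow> real" where \<phi>: "continuous_on UNIV \<phi>" "\<And>x. 0 \<le> \<phi> x" "\<And>x. \<phi> x \<le> 1"
    "\<And>x. x \<in> K \<Longrightarrow> \<phi> x = 1" "\<And>x. x \<notin> U \<Longrightarrow> \<phi> x = 0"
  proof (cases "K = {}")
    case True
    then show ?thesis by (intro that[of "\<lambda>_. 0"]) auto
  next
    case False
    obtain r where r: "r > 0" "(\<Union>x\<in>K. ball x r) \<subseteq> U"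
      using compact_subset_open_imp_ball_epsilon_subset[OF K(2) U(2)] K(1) U(1) by auto
    have far: "infdist x K \<ge> r" if "x \<notin> U" for x
    proof (rule ccontr)
      assume "\<not> ?thesis"
      then have "\<exists>k\<in>K. dist x k < r"
        using cINF_less_iff[of K "dist x" r] False unfolding infdist_def
        by (auto intro!: bdd_belowI2[where m=0])
      with r(2) that show False by (auto simp: dist_commute subset_iff)
    qed
    show ?thesis
    proof (rule that[of "\<lambda>x. max 0 (1 - infdist x K / r)"])
      show "continuous_on UNIV (\<lambda>x. max 0 (1 - infdist x K / r))"
        using \<open>r > 0\<close> by (intro continuous_intros) auto
      show "max 0 (1 - infdist x K / r) = 0" if "x \<notin> U" for x
        using far[OF that] \<open>r > 0\<close> by (simp add: field_simps)
    qed (use \<open>r > 0\<close> in \<open>auto simp: infdist_nonneg\<close>)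
  qed
  have KU: "K \<subseteq> U" and KB: "K \<in> sets \<nu>" "U \<in> sets \<nu>"
    unfolding \<nu>(1) using K(1,2) U(1,2) by (auto intro: borel_compact borel_open)
  have "open (U - K)" using K(2) U(2) by (auto intro: compact_imp_closed open_Diff)
  define w :: "'a \<Rightarrow> ennreal" where "w = (\<lambda>x. c * indicator (U - K) x)"
  have "emeasure \<nu> U \<le> emeasure \<nu> K + ennreal (2 * d)"
    using add_right_mono[OF K(3), of "ennreal d"] U(3) \<open>0 < d\<close>
    by (simp add: add.assoc flip: ennreal_plus)
  then have UK: "emeasure \<nu> (U - K) \<le> ennreal (2 * d)"
    using KB KU by (subst emeasure_Diff) (auto simp: ennreal_minus_le_iff)
  have "(\<integral>\<^sup>+x. w x \<partial>\<nu>) = c * emeasure \<nu> (U - K)"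
    unfolding w_def using KB by (intro nn_integral_cmult_indicator) auto
  also have "\<dots> \<le> c * ennreal (2 * d)" by (intro mult_left_mono UK) simp
  also have "\<dots> = ennreal (enn2real c * (2 * d))"
    using c \<open>0 < d\<close> by (subst ennreal_mult) (auto simp: less_top)
  also have "\<dots> \<le> ennreal e"
    using cpos \<open>0 < e\<close> by (intro ennreal_leI) (auto simp: d_def field_simps)
  finally have "(\<integral>\<^sup>+x. w x \<partial>\<nu>) \<le> ennreal e" .
  moreover have "bounded_continuous (\<lambda>x. c * ennreal (\<phi> x))"
    unfolding bounded_continuous_def
  proof (intro conjI exI allI)
    show "continuous_on UNIV (\<lambda>x. c * ennreal (\<phi> x))"
      using \<phi>(1) c by (intro ennreal_continuous_on_cmult continuous_on_ennreal)
    have "c * ennreal (\<phi> x) \<le> c * 1" for x using \<phi>(3)[of x] by (intro mult_left_mono) auto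
    then show "c * ennreal (\<phi> x) \<le> ennreal (enn2real c)" for x using c by (simp add: less_top)
  qed
  moreover have "seq_lsc w" unfolding w_def by (rule seq_lsc_indicator) fact
  moreover have "w \<in> borel_measurable borel" using KB \<nu> by (auto simp: w_def)
  moreover have "c * indicator A x \<le> c * ennreal (\<phi> x) + w x" for x
    using \<phi>(4)[of x] U(1) by (cases "x \<in> K") (auto simp: w_def indicator_def)
  moreover have "c * ennreal (\<phi> x) \<le> c * indicator A x + w x" for x
  proof -
    have "c * ennreal (\<phi> x) \<le> c * 1" using \<phi>(3)[of x] by (intro mult_left_mono) auto
    then show ?thesis using \<phi>(5)[of x] K(1) by (cases "x \<in> A"; cases "x \<in> U") (auto simp: w_def indicator_def add_increasing2)
  qed
  ultimately show "\<exists>\<phi> w. lsc_sandwich \<nu> (\<lambda>x. c * indicator A x) e \<phi> w"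
    unfolding lsc_sandwich_def by blast
qed

text \<open>Truncating the series of continuous approximants keeps the approximant bounded and
  continuous. The discarded tail is again lower semicontinuous and can be added to the error; its
  integral is small because the approximants have finite total integral.\<close>

lemma lsc_approximable_suminf:
  fixes \<nu> :: "'a::topological_space measure"
  assumes \<nu>: "sets \<nu> = sets borel"
    and f: "\<And>i::nat. lsc_approximable \<nu> (f i)" and [measurable]: "\<And>i. f i \<in> borel_measurable borel"
    and fin: "(\<integral>\<^sup>+x. (\<Sum>i. f i x) \<partial>\<nu>) < \<infinity>"
  shows "lsc_approximable \<nu> (\<lambda>x. \<Sum>i. f i x)"
  unfolding lsc_approximable_def
proof (intro allI impI)
  fix e :: real assume "0 < e"
  note [measurable_cong] = \<nu>
  \<comment> \<open>Half of \<open>e\<close> is shared among the errors \<open>w i\<close>, the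
    other half is reserved for the tail of the \<open>\<phi> i\<close>.\<close>
  define d where "d i = (e / 2) * (1/2) ^ Suc i" for i :: nat
  have d: "0 < d i" for i using \<open>0 < e\<close> by (simp add: d_def)
  have "(\<lambda>i. (e / 2) * (1/2) ^ Suc i) sums ((e / 2) * 1)"
    by (intro sums_mult power_half_series)
  then have "(\<lambda>i. ennreal (d i)) sums ennreal (e / 2)"
    unfolding d_def using \<open>0 < e\<close> by (subst sums_ennreal) auto
  then have sumd: "(\<Sum>i. ennreal (d i)) = ennreal (e / 2)" by (rule sums_unique[symmetric])
  have "\<forall>i. \<exists>\<phi> w. lsc_sandwich \<nu> (f i) (d i) \<phi> w"
    using f d unfolding lsc_approximable_def by blast
  then obtain \<phi> w where "\<And>i. lsc_sandwich \<nu> (f i) (d i) (\<phi> i) (w i)" by metis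
  then have P: "\<And>i. bounded_continuous (\<phi> i)" "\<And>i. seq_lsc (w i)"
      and [measurable]: "\<And>i. w i \<in> borel_measurable borel"
      and le: "\<And>i x. f i x \<le> \<phi> i x + w i x" "\<And>i x. \<phi> i x \<le> f i x + w i x"
      and int: "\<And>i. integral\<^sup>N \<nu> (w i) \<le> ennreal (d i)"
    unfolding lsc_sandwich_def by blast+
  have [measurable]: "\<phi> i \<in> borel_measurable borel" for i by (rule bounded_continuous_borel[OF P(1)])
  have sumw: "(\<Sum>i. \<integral>\<^sup>+x. w i x \<partial>\<nu>) \<le> ennreal (e / 2)"
    unfolding sumd[symmetric] by (intro suminf_le int) auto
  have "(\<Sum>i. \<integral>\<^sup>+x. \<phi> i x \<partial>\<nu>) \<le> (\<Sum>i. integral\<^sup>N \<nu> (f i) + integral\<^sup>N \<nu> (w i))"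
  proof (intro suminf_le)
    show "(\<integral>\<^sup>+x. \<phi> i x \<partial>\<nu>) \<le> integral\<^sup>N \<nu> (f i) + integral\<^sup>N \<nu> (w i)" for i
      using le(2) by (subst nn_integral_add[symmetric]) (auto intro!: nn_integral_mono)
  qed auto
  also have "\<dots> = (\<Sum>i. integral\<^sup>N \<nu> (f i)) + (\<Sum>i. \<integral>\<^sup>+x. w i x \<partial>\<nu>)"
    by (intro suminf_add[symmetric]) auto
  also have "(\<Sum>i. integral\<^sup>N \<nu> (f i)) = (\<integral>\<^sup>+x. (\<Sum>i. f i x) \<partial>\<nu>)"
    by (intro nn_integral_suminf[symmetric]) auto
  also have "\<dots> + (\<Sum>i. \<integral>\<^sup>+x. w i x \<partial>\<nu>) < top"
    using fin sumw by (simp add: le_less_trans[OF sumw])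
  finally have fin_phi: "(\<Sum>i. \<integral>\<^sup>+x. \<phi> i x \<partial>\<nu>) < top" .
  then obtain n where n: "(\<Sum>i. \<integral>\<^sup>+x. \<phi> (i + n) x \<partial>\<nu>) < ennreal (e / 2)"
    using ennreal_suminf_tail[of "\<lambda>i. \<integral>\<^sup>+x. \<phi> i x \<partial>\<nu>" "e / 2"] \<open>0 < e\<close> by auto
  define \<Phi> where "\<Phi> x = (\<Sum>i<n. \<phi> i x)" for x
  define w' where "w' x = (\<Sum>i. w i x) + (\<Sum>i. \<phi> (i + n) x)" for x
  have split: "(\<Sum>i. \<phi> i x) = \<Phi> x + (\<Sum>i. \<phi> (i + n) x)" for x
    unfolding \<Phi>_def by (subst add.commute, rule suminf_offset) auto
  have "bounded_continuous \<Phi>" unfolding \<Phi>_def by (intro bounded_continuous_sum P)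
  moreover have "seq_lsc w'" unfolding w'_def
    using P by (intro seq_lsc_add seq_lsc_suminf) (auto intro!: seq_lsc_continuous simp: bounded_continuous_def)
  moreover have "w' \<in> borel_measurable borel" unfolding w'_def by measurable
  moreover have "(\<Sum>i. f i x) \<le> \<Phi> x + w' x" for x
  proof -
    have "(\<Sum>i. f i x) \<le> (\<Sum>i. \<phi> i x + w i x)" by (intro suminf_le le) auto
    also have "\<dots> = (\<Sum>i. \<phi> i x) + (\<Sum>i. w i x)" by (intro suminf_add[symmetric]) auto
    finally show ?thesis by (simp add: split w'_def ac_simps)
  qed
  moreover have "\<Phi> x \<le> (\<Sum>i. f i x) + w' x" for x
  proof -
    have "\<Phi> x \<le> (\<Sum>i<n. f i x) + (\<Sum>i<n. w i x)"
      unfolding \<Phi>_def sum.distrib[symmetric] by (intro sum_mono le)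
    also have "\<dots> \<le> (\<Sum>i. f i x) + (\<Sum>i. w i x)" by (intro add_mono sum_le_suminf) auto
    finally show ?thesis unfolding w'_def by (simp add: add_increasing2 flip: add.assoc)
  qed
  moreover have "integral\<^sup>N \<nu> w' \<le> ennreal e"
  proof -
    have "integral\<^sup>N \<nu> w' = (\<Sum>i. \<integral>\<^sup>+x. w i x \<partial>\<nu>) + (\<Sum>i. \<integral>\<^sup>+x. \<phi> (i + n) x \<partial>\<nu>)"
      unfolding w'_def by (subst nn_integral_add) (auto simp: nn_integral_suminf)
    also have "\<dots> \<le> ennreal (e / 2) + ennreal (e / 2)" using n sumw by (intro add_mono) auto
    also have "\<dots> = ennreal e" using \<open>0 < e\<close> by (simp flip: ennreal_plus)
    finally show ?thesis .
  qed
  ultimately show "\<exists>\<phi> w. lsc_sandwich \<nu> (\<lambda>x. \<Sum>i. f i x) e \<phi> w"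
    unfolding lsc_sandwich_def by blast
qed

text \<open>Simple functions and increasing limits of simple functions are both series of
  nonnegative terms, so closure under countable sums reduces everything to multiples of
  indicators.\<close>

lemma lsc_approximable_integrable:
  fixes \<nu> :: "'a::polish_space measure"
  assumes \<nu>: "sets \<nu> = sets borel" "finite_measure \<nu>" and f [measurable]: "f \<in> borel_measurable borel"
    and fin: "(\<integral>\<^sup>+x. f x \<partial>\<nu>) < \<infinity>"
  shows "lsc_approximable \<nu> f"
proof -
  have simple: "lsc_approximable \<nu> g"
    if g: "simple_function borel g" "\<And>x. g x < top" "(\<integral>\<^sup>+x. g x \<partial>\<nu>) < \<infinity>" for g
  proof -
    have "finite (range g)" using simple_functionD(1)[OF g(1)] by simp
    then obtain n :: nat and b where b: "bij_betw b {..<n} (range g)" 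
      using ex_bij_betw_nat_finite[of "range g"] by (auto simp: atLeast0LessThan)
    \<comment> \<open>Padding with zeros turns the finite sum over the values of \<open>g\<close>
      into a series.\<close>
    define h where "h i x = (if i < n then b i else 0) * indicator (g -` {b i}) x" for i x
    have gm: "g -` {y} \<in> sets borel" for y using simple_functionD(2)[OF g(1), of "{y}"] by simp
    have "g x = (\<Sum>i. h i x)" for x
    proof -
      have "g x = (\<Sum>y\<in>range g. y * indicator (g -` {y}) x)"
        by (rule trans[OF simple_function_indicator_representation[OF g(1)]]) simp_all
      also have "\<dots> = (\<Sum>i<n. b i * indicator (g -` {b i}) x)"
        by (rule sum.reindex_bij_betw[OF b, symmetric])
      also have "\<dots> = (\<Sum>i<n. h i x)" by (simp add: h_def)
      also have "\<dots> = (\<Sum>i. h i x)"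
        by (intro suminf_finite[symmetric]) (auto simp: h_def)
      finally show ?thesis .
    qed
    then have eq: "g = (\<lambda>x. \<Sum>i. h i x)" by auto
    have "lsc_approximable \<nu> (\<lambda>x. \<Sum>i. h i x)"
    proof (rule lsc_approximable_suminf[OF \<nu>(1)])
      fix i
      have "b i < top" if "i < n"
      proof -
        have "b i \<in> range g" using b that by (auto simp: bij_betw_def)
        then show ?thesis using g(2) by auto
      qed
      then have "(if i < n then b i else 0) < top" by auto
      then show "lsc_approximable \<nu> (h i)"
        unfolding h_def using gm by (intro lsc_approximable_indicator \<nu>) auto
      show "h i \<in> borel_measurable borel" unfolding h_def using gm by measurable
      show "(\<integral>\<^sup>+x. (\<Sum>i. h i x) \<partial>\<nu>) < \<infinity>" using g(3) by (subst (asm) eq)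
    qed
    then show ?thesis by (subst eq)
  qed
  obtain s where s: "\<And>i. simple_function borel (s i)" "incseq s" "\<And>i x. s i x < top" "\<And>x. (SUP i. s i x) = f x"
    using borel_measurable_implies_simple_function_sequence'[OF f] by metis
  \<comment> \<open>The increments of the increasing sequence; their partial sums telescope to
    \<open>s m\<close>.\<close>
  define h where "h i x = (if i = 0 then s 0 x else s i x - s (i - 1) x)" for i x
  have inc: "s i x \<le> s j x" if "i \<le> j" for i j x using s(2) that by (auto simp: incseq_def le_fun_def)
  have sum_h: "(\<Sum>i<Suc m. h i x) = s m x" for m x
  proof (induction m)
    case (Suc m)
    have "(\<Sum>i<Suc (Suc m). h i x) = s m x + (s (Suc m) x - s m x)"
      using Suc by (simp add: h_def)
    then show ?case using inc[of m "Suc m" x] by (simp add: add_diff_inverse_ennreal)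
  qed (simp add: h_def)
  have eq: "f = (\<lambda>x. \<Sum>i. h i x)"
  proof
    fix x
    have "(\<lambda>m. \<Sum>i<Suc m. h i x) \<longlonglongrightarrow> (\<Sum>i. h i x)"
      by (intro LIMSEQ_Suc summable_LIMSEQ) auto
    moreover have "(\<lambda>m. s m x) \<longlonglongrightarrow> f x"
      using s(4)[of x] LIMSEQ_SUP[of "\<lambda>m. s m x"] inc by (auto simp: incseq_def)
    ultimately show "f x = (\<Sum>i. h i x)" unfolding sum_h using LIMSEQ_unique by blast
  qed
  have hs: "simple_function borel (h i)" for i
    unfolding h_def using s(1) by (cases "i = 0") (auto intro: simple_function_diff)
  have "lsc_approximable \<nu> (\<lambda>x. \<Sum>i. h i x)"
  proof (rule lsc_approximable_suminf[OF \<nu>(1)])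
    show "(\<integral>\<^sup>+x. (\<Sum>i. h i x) \<partial>\<nu>) < \<infinity>" using fin by (subst (asm) eq)
    fix i
    have le: "h i x \<le> f x" for x unfolding eq using sum_le_suminf[of "\<lambda>i. h i x" "{i}"] by auto
    show "lsc_approximable \<nu> (h i)"
    proof (rule simple[OF hs])
      show "h i x < top" for x
        using s(3)[of i x] s(3)[of 0 x] diff_le_self_ennreal[of "s i x" "s (i - 1) x"]
        by (auto simp: h_def intro: le_less_trans[OF diff_le_self_ennreal])
      show "(\<integral>\<^sup>+x. h i x \<partial>\<nu>) < \<infinity>" using le fin nn_integral_mono[of \<nu> "h i" f] by (auto intro: le_less_trans)
    qed
    show "h i \<in> borel_measurable borel" using hs by (rule borel_measurable_simple_function)
  qed
  then show ?thesis by (subst eq)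
qed

text \<open>One \<open>g\<close> has to dominate all errors at once. Errors of integral at most
  \<open>4^-n\<close> are summed with weights \<open>2^n\<close>: the sum stays integrable, and each
  \<open>w n\<close> is at most \<open>2^-n * g\<close>.\<close>

theorem continuous_approximation_controlled_by_lsc:
  fixes \<nu> :: "'a::polish_space measure"
  assumes \<nu>: "sets \<nu> = sets borel" "finite_measure \<nu>" and f: "f \<in> borel_measurable borel"
    and fin: "(\<integral>\<^sup>+x. f x \<partial>\<nu>) < \<infinity>"
  obtains g \<phi> where "seq_lsc g" "g \<in> borel_measurable borel" "(\<integral>\<^sup>+x. g x \<partial>\<nu>) < \<infinity>"
    "\<And>n::nat. bounded_continuous (\<phi> n)"
    "\<And>n x. f x \<le> \<phi> n x + ennreal ((1/2) ^ n) * g x" "\<And>n x. \<phi> n x \<le> f x + ennreal ((1/2) ^ n) * g x"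
proof -
  note [measurable_cong] = \<nu>(1)
  have "\<forall>n. \<exists>\<phi> w. lsc_sandwich \<nu> f ((1/4)^n) \<phi> w"
    using lsc_approximable_integrable[OF assms] unfolding lsc_approximable_def by auto
  then obtain \<phi> w where "\<And>i::nat. lsc_sandwich \<nu> f ((1/4)^i) (\<phi> i) (w i)" by metis
  then have P: "\<And>i. bounded_continuous (\<phi> i)" "\<And>i. seq_lsc (w i)"
      and [measurable]: "\<And>i. w i \<in> borel_measurable borel"
      and le: "\<And>i x. f x \<le> \<phi> i x + w i x" "\<And>i x. \<phi> i x \<le> f x + w i x"
      and int: "\<And>i. integral\<^sup>N \<nu> (w i) \<le> ennreal ((1/4)^i)"
    unfolding lsc_sandwich_def by blast+
  define g where "g x = (\<Sum>i. ennreal (2 ^ i) * w i x)" for x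
  have wg: "w n x \<le> ennreal ((1/2) ^ n) * g x" for n x
  proof -
    have "ennreal (2 ^ n) * w n x \<le> g x"
      unfolding g_def using sum_le_suminf[of "\<lambda>i. ennreal (2 ^ i) * w i x" "{n}"] by auto
    then have "ennreal ((1/2) ^ n) * (ennreal (2 ^ n) * w n x) \<le> ennreal ((1/2) ^ n) * g x"
      by (intro mult_left_mono) auto
    also have "ennreal ((1/2) ^ n) * (ennreal (2 ^ n) * w n x) = w n x"
      by (simp add: power_one_over flip: mult.assoc ennreal_mult)
    finally show ?thesis .
  qed
  show ?thesis
  proof (rule that[of g \<phi>])
    show "seq_lsc g" unfolding g_def by (intro seq_lsc_suminf seq_lsc_cmult P)
    show "g \<in> borel_measurable borel" unfolding g_def by measurable
    have "(\<integral>\<^sup>+x. g x \<partial>\<nu>) = (\<Sum>i. ennreal (2 ^ i) * integral\<^sup>N \<nu> (w i))"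
      unfolding g_def by (subst nn_integral_suminf) (auto simp: nn_integral_cmult)
    also have "\<dots> \<le> (\<Sum>i. ennreal ((1/2) ^ i))"
    proof (intro suminf_le)
      fix i
      have "ennreal (2 ^ i) * integral\<^sup>N \<nu> (w i) \<le> ennreal (2 ^ i) * ennreal ((1/4)^i)"
        by (intro mult_left_mono int) auto
      also have "\<dots> = ennreal ((1/2) ^ i)"
        by (simp flip: ennreal_mult power_mult_distrib)
      finally show "ennreal (2 ^ i) * integral\<^sup>N \<nu> (w i) \<le> ennreal ((1/2) ^ i)" .
    qed auto
    also have "\<dots> = ennreal (\<Sum>i. (1/2) ^ i)"
      by (intro suminf_ennreal2) (auto intro: summable_geometric)
    also have "\<dots> < \<infinity>" by simp
    finally show "(\<integral>\<^sup>+x. g x \<partial>\<nu>) < \<infinity>" .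
    show "bounded_continuous (\<phi> n)" for n by fact
    show "f x \<le> \<phi> n x + ennreal ((1/2) ^ n) * g x" for n x
      using le(1)[of x n] add_left_mono[OF wg[of n x], of "\<phi> n x"] by (rule order_trans)
    show "\<phi> n x \<le> f x + ennreal ((1/2) ^ n) * g x" for n x
      using le(2)[of n x] add_left_mono[OF wg[of n x], of "f x"] by (rule order_trans)
  qed
qed


section \<open>Balls charged by the Brownian semigroup\<close>

text \<open>Otherwise every point of \<open>G\<close> has a null ball, and by Lindelof countably
  many of these cover \<open>G\<close>.\<close>

lemma exists_point_with_positive_balls:
  fixes M :: "'a::{metric_space, second_countable_topology} measure"
  assumes "sets M = sets borel" "open G" "emeasure M G \<noteq> 0"
  obtains z where "z \<in> G" "\<And>e. 0 < e \<Longrightarrow> 0 < emeasure M (ball z e)"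
proof -
  have "\<exists>z\<in>G. \<forall>e>0. 0 < emeasure M (ball z e)"
  proof (rule ccontr)
    assume "\<not> ?thesis"
    then have "\<forall>z\<in>G. \<exists>e>0. emeasure M (ball z e) = 0" by (simp add: zero_less_iff_neq_zero)
    then obtain e where e: "\<And>z. z \<in> G \<Longrightarrow> 0 < e z" "\<And>z. z \<in> G \<Longrightarrow> emeasure M (ball z (e z)) = 0"
      by metis
    obtain \<B> where \<B>: "\<B> \<subseteq> (\<lambda>z. ball z (e z)) ` G" "countable \<B>" "\<Union>\<B> = \<Union>((\<lambda>z. ball z (e z)) ` G)"
      by (rule Lindelof[of "(\<lambda>z. ball z (e z)) ` G"]) auto
    have "\<Union>\<B> \<in> null_sets M"
    proof -
      have "B \<in> null_sets M" if "B \<in> \<B>" for B 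
      proof -
        obtain z where "z \<in> G" "B = ball z (e z)" using \<B>(1) \<open>B \<in> \<B>\<close> by blast
        then show ?thesis using e(2) assms(1) by (intro null_setsI) auto
      qed
      then have "(\<Union>B\<in>\<B>. B) \<in> null_sets M" by (intro null_sets_UN' \<B>(2))
      then show ?thesis by simp
    qed
    moreover have "G \<subseteq> \<Union>\<B>" unfolding \<B>(3) using e(1) by (auto intro!: bexI centre_in_ball[THEN iffD2])
    ultimately show False
      using assms null_sets_subset[of "\<Union>\<B>" M G] by auto
  qed
  then show ?thesis using that by blast
qed

lemma normal_law_negative:
  assumes "\<sigma> \<noteq> 0"
  shows "emeasure (normal_law 0 (\<sigma>\<^sup>2)) {..<0} \<noteq> 0"
proof
  have "0 < sqrt (\<sigma>\<^sup>2)" using assms by simp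
  assume "emeasure (normal_law 0 (\<sigma>\<^sup>2)) {..<0} = 0"
  then have "(\<integral>\<^sup>+x. ennreal (normal_density 0 (sqrt (\<sigma>\<^sup>2)) x) * indicator {..<0} x \<partial>lborel) = 0"
    using assms by (simp add: normal_law_def emeasure_density)
  then have "AE x in lborel. ennreal (normal_density 0 (sqrt (\<sigma>\<^sup>2)) x) * indicator {..<0} x = (0::ennreal)"
    by (subst (asm) nn_integral_0_iff_AE) auto
  then have "AE x in lborel. x \<notin> {..<0::real}"
    by eventually_elim (use normal_density_pos[OF \<open>0 < sqrt (\<sigma>\<^sup>2)\<close>] in \<open>auto simp: indicator_def split: if_splits\<close>,
      smt (verit) normal_density_pos)
  then have "emeasure lborel {..<0::real} = 0"
    by (subst (asm) AE_iff_measurable[OF _ refl]) (auto simp: lessThan_def)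
  moreover have "emeasure lborel {-1<..<0::real} \<le> emeasure lborel {..<0::real}"
    by (intro emeasure_mono) auto
  ultimately show False by simp
qed

context brownian_motion
begin

abbreviation "N \<equiv> brownian_kernel \<mu>"

declare sets_wiener [measurable_cong]

lemma sets_kernel [simp, measurable_cong]: "sets (N t x) = sets borel"
  by (simp add: brownian_kernel_def)

lemma space_kernel [simp]: "space (N t x) = UNIV"
  by (simp add: brownian_kernel_def)

lemma kernel_eq_distr: "N t x = distr \<mu> borel (\<lambda>z. x + sqrt t *\<^sub>R z)"
proof -
  show ?thesis unfolding brownian_kernel_def scaled_measure_def
    by (subst distr_distr) (auto simp: comp_def)
qed

lemma emeasure_kernel:
  assumes "A \<in> sets borel"
  shows "emeasure (N t x) A = emeasure \<mu> {z. x + sqrt t *\<^sub>R z \<in> A}"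
proof -
  have "space \<mu> = UNIV" using sets_wiener sets_eq_imp_space_eq by force
  then show ?thesis unfolding kernel_eq_distr using assms
    by (subst emeasure_distr) (auto simp: vimage_def)
qed

lemma kernel_translate: "N t (x + a) = distr (N t x) borel (\<lambda>z. z + a)"
proof -
  show ?thesis unfolding kernel_eq_distr
    by (subst distr_distr) (auto simp: comp_def ac_simps)
qed

lemma prob_space_kernel: "0 \<le> t \<Longrightarrow> prob_space (N t x)"
  using measurable_space[OF kernel, of t x] by (simp add: space_prob_algebra)

lemma kernel_subprob [measurable]: "0 \<le> t \<Longrightarrow> N t \<in> borel \<rightarrow>\<^sub>M subprob_algebra borel"
  by (rule measurable_prob_algebraD[OF kernel])

text \<open>Brownian scaling; it makes the set of charged points closed under positive
  multiples.\<close>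

lemma kernel_scale_ball:
  assumes "0 < c" "0 \<le> t"
  shows "emeasure (N (c\<^sup>2 * t) 0) (ball (c *\<^sub>R z) (c * e)) = emeasure (N t 0) (ball z e)"
proof -
  have "dist (c *\<^sub>R z) (c *\<^sub>R u) = c * dist z u" for u
    using assms by (simp add: dist_norm flip: scaleR_diff_right)
  then have "(sqrt (c\<^sup>2 * t) *\<^sub>R u \<in> ball (c *\<^sub>R z) (c * e)) = (sqrt t *\<^sub>R u \<in> ball z e)" for u
    using assms by (simp add: real_sqrt_mult flip: scaleR_scaleR)
  then show ?thesis by (simp add: emeasure_kernel)
qed

text \<open>Being near \<open>x\<close> at time \<open>s\<close> and then moving by an increment
  near \<open>y\<close> is one way to be near \<open>x + y\<close> at time
  \<open>s + t\<close>.\<close>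

lemma kernel_add_ball:
  assumes "0 \<le> s" "0 \<le> t"
  shows "emeasure (N s 0) (ball x e) * emeasure (N t 0) (ball y e) \<le> emeasure (N (s + t) 0) (ball (x + y) (2 * e))"
proof -
  have "emeasure (N s 0) (ball x e) * emeasure (N t 0) (ball y e)
      = (\<integral>\<^sup>+u. indicator (ball x e) u * emeasure (N t 0) (ball y e) \<partial>N s 0)"
    by (subst nn_integral_multc) (auto intro!: borel_measurable_indicator)
  also have "\<dots> \<le> (\<integral>\<^sup>+u. emeasure (N t u) (ball (x + y) (2 * e)) \<partial>N s 0)"
  proof (intro nn_integral_mono)
    fix u
    show "indicator (ball x e) u * emeasure (N t 0) (ball y e) \<le> emeasure (N t u) (ball (x + y) (2 * e))"
    proof (cases "u \<in> ball x e")
      case True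
      have "v + u \<in> ball (x + y) (2 * e)" if "v \<in> ball y e" for v
        using True that dist_triangle_add[of x y u v] by (simp add: add.commute)
      then have "emeasure (N t 0) (ball y e) \<le> emeasure (N t 0) {v. v + u \<in> ball (x + y) (2 * e)}"
        by (intro emeasure_mono) auto
      also have "\<dots> = emeasure (N t (0 + u)) (ball (x + y) (2 * e))"
        unfolding kernel_translate[of t 0 u] by (subst emeasure_distr) (auto simp: vimage_def)
      finally show ?thesis using True by simp
    qed simp
  qed
  also have "\<dots> = emeasure (N (s + t) 0) (ball (x + y) (2 * e))"
    unfolding chapman_kolmogorov[OF assms]
    by (rule emeasure_bind[symmetric]) (auto intro: kernel_subprob assms cong: measurable_cong_sets)
  finally show ?thesis .
qed

text \<open>The points charged by the laws of the process form a convex cone. If it missed a ball, a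
  separating functional would be nonnegative almost surely although its law is centred normal.\<close>

lemma kernel_charges_ball:
  assumes "0 \<notin> ball v r" "0 < r"
  obtains t where "0 < t" "0 < emeasure (N t 0) (ball v r)"
proof -
  \<comment> \<open>The time may vary with the point: it adds up under sums and is rescaled under
    multiples.\<close>
  define D where "D = {z. \<exists>t>0. \<forall>e>0. 0 < emeasure (N t 0) (ball z e)}"
  have add: "x + y \<in> D" if xy: "x \<in> D" "y \<in> D" for x y
  proof -
    obtain s t where st: "0 < s" "\<And>e. 0 < e \<Longrightarrow> 0 < emeasure (N s 0) (ball x e)"
        "0 < t" "\<And>e. 0 < e \<Longrightarrow> 0 < emeasure (N t 0) (ball y e)"
      using xy by (auto simp: D_def)
    have "0 < emeasure (N (s + t) 0) (ball (x + y) e)" if "0 < e" for e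
    proof -
      have "0 < emeasure (N s 0) (ball x (e/2)) * emeasure (N t 0) (ball y (e/2))"
        using st(2)[of "e/2"] st(4)[of "e/2"] that by (simp add: ennreal_zero_less_mult_iff)
      also have "\<dots> \<le> emeasure (N (s + t) 0) (ball (x + y) e)"
        using kernel_add_ball[of s t x "e/2" y] st by simp
      finally show ?thesis .
    qed
    then show ?thesis using st by (auto simp: D_def intro!: exI[of _ "s + t"])
  qed
  have scale: "c *\<^sub>R x \<in> D" if "0 < c" "x \<in> D" for c x
  proof -
    obtain t where t: "0 < t" "\<And>e. 0 < e \<Longrightarrow> 0 < emeasure (N t 0) (ball x e)"
      using \<open>x \<in> D\<close> unfolding D_def by blast
    have "0 < emeasure (N (c\<^sup>2 * t) 0) (ball (c *\<^sub>R x) e)" if "0 < e" for e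
      using kernel_scale_ball[of c t x "e / c"] t(2)[of "e / c"] \<open>0 < c\<close> that t(1) by simp
    then show ?thesis using t that by (auto simp: D_def intro!: exI[of _ "c\<^sup>2 * t"])
  qed
  have "D \<inter> ball v r \<noteq> {}"
  proof
    assume "D \<inter> ball v r = {}"
    \<comment> \<open>The separation requires 0 in the cone, and the ball avoids 0 by
      assumption.\<close>
    then have disj: "insert 0 D \<inter> ball v r = {}" using assms by auto
    obtain l :: "'e \<Rightarrow> real" where l: "bounded_linear l" "\<And>d. d \<in> insert 0 D \<Longrightarrow> 0 \<le> l d" "l v < 0"
      by (rule separate_convex_cone_from_ball[OF _ _ _ disj \<open>0 < r\<close>]) (auto simp: add scale)
    interpret l: bounded_linear l by fact
    have cont: "continuous_on A l" for A by (rule l.continuous_on) (rule continuous_on_id)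
    have lm: "l \<in> borel_measurable borel" using cont by (rule borel_measurable_continuous_onI)
    have opn: "open {x. l x < 0}" using cont by (intro open_Collect_less) auto
    \<comment> \<open>Otherwise some point with \<open>l z < 0\<close> would be charged at time 1,
      although \<open>l\<close> is nonnegative on \<open>D\<close>.\<close>
    have "emeasure \<mu> {x. l x < 0} = 0"
    proof (rule ccontr)
      assume "\<not> ?thesis"
      then obtain z where z: "l z < 0" "\<And>e. 0 < e \<Longrightarrow> 0 < emeasure \<mu> (ball z e)"
        using exists_point_with_positive_balls[OF sets_wiener opn] by auto
      have "emeasure (N 1 0) (ball z e) = emeasure \<mu> (ball z e)" for e
        by (subst emeasure_kernel) (auto simp: ball_def)
      then have "z \<in> D" using z(2) by (auto simp: D_def intro!: exI[of _ 1])
      then show False using l(2)[of z] z(1) by simp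
    qed
    moreover have "emeasure \<mu> {x. l x < 0} = emeasure (distr \<mu> borel l) {..<0}"
      using lm sets_eq_imp_space_eq[OF sets_wiener] sets_wiener
      by (subst emeasure_distr) (auto simp: vimage_def cong: measurable_cong_sets)
    ultimately have "emeasure (normal_law 0 ((onorm (\<lambda>h. l (\<iota> h)))\<^sup>2)) {..<0} = 0"
      by (simp only: law_functional[OF l(1)])
    \<comment> \<open>A centred normal law without mass on the negative half-line is degenerate, so
      \<open>l\<close> vanishes on \<open>range \<iota>\<close> and, by density, everywhere,
      contrary to \<open>l v < 0\<close>.\<close>
    then have "onorm (\<lambda>h. l (\<iota> h)) = 0"
      by (metis normal_law_negative)
    moreover have bl: "bounded_linear (\<lambda>h. l (\<iota> h))"
      using bounded_linear_compose[OF l(1) embedding_bounded_linear] .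
    ultimately have "l (\<iota> h) = 0" for h using onorm[OF bl, of h] by simp
    then have "range \<iota> \<subseteq> {x. l x = 0}" by auto
    moreover have "closed {x. l x = 0}" using cont by (intro closed_Collect_eq) auto
    ultimately have "closure (range \<iota>) \<subseteq> {x. l x = 0}" by (rule closure_minimal)
    then have "v \<in> {x. l x = 0}" using embedding_dense by blast
    then show False using l(3) by simp
  qed
  then obtain z t where z: "z \<in> ball v r" "0 < t" "\<And>e. 0 < e \<Longrightarrow> 0 < emeasure (N t 0) (ball z e)"
    unfolding D_def by blast
  obtain e where e: "0 < e" "ball z e \<subseteq> ball v r" using z(1) open_ball openE by blast
  then have "emeasure (N t 0) (ball z e) \<le> emeasure (N t 0) (ball v r)" by (intro emeasure_mono) auto
  with z(3)[OF e(1)] z(2) show ?thesis by (intro that) auto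
qed

text \<open>The point is that one \<open>p\<close> serves all small times. The ball of the cone is
  charged at some time \<open>t0\<close>; for \<open>s \<le> t0\<close> the same ball contracted
  towards \<open>y\<close> by the factor \<open>sqrt (s / t0)\<close> has the same probability at
  time \<open>s\<close>, and it stays in the cone by convexity.\<close>

lemma kernel_charges_complement:
  assumes V: "strongly_regular V" and y: "y \<in> frontier V"
  obtains t0 p where "0 < t0" "0 < p" "\<And>s. 0 < s \<Longrightarrow> s \<le> t0 \<Longrightarrow> p \<le> emeasure (N s y) (interior (- V))"
proof -
  obtain z r where zr: "0 < r" "y \<notin> cball z r"
      and disj: "V \<inter> closure (convex hull ({y} \<union> cball z r)) = {}"
    using V y unfolding strongly_regular_def cone_with_vertex_def by blast
  define v where "v = z - y"
  have "0 \<notin> ball v r" using zr by (auto simp: v_def dist_norm)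
  then obtain t0 where t0: "0 < t0" "0 < emeasure (N t0 0) (ball v r)"
    using kernel_charges_ball zr(1) by blast
  show ?thesis
  proof (rule that[OF t0])
    fix s :: real assume s: "0 < s" "s \<le> t0"
    define c where "c = sqrt (s / t0)"
    have c: "0 < c" "c \<le> 1" using s t0 by (auto simp: c_def)
    \<comment> \<open>An open part of the cone, hence contained in the interior of
      \<open>- V\<close> and not merely in \<open>- V\<close>.\<close>
    define G where "G = (\<lambda>u. y + u) ` (\<lambda>u. c *\<^sub>R u) ` ball v r"
    have "open G" unfolding G_def using c by (intro open_translation open_scaling) auto
    moreover have "G \<subseteq> - V"
    proof
      fix w assume "w \<in> G"
      then obtain u where u: "u \<in> ball v r" "w = y + c *\<^sub>R u" by (auto simp: G_def)
      have "y + u \<in> cball z r" using u(1) by (simp add: v_def dist_norm algebra_simps)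
      then have "(1 - c) *\<^sub>R y + c *\<^sub>R (y + u) \<in> convex hull ({y} \<union> cball z r)"
        using c by (intro convexD[OF convex_convex_hull]) (auto intro: hull_inc)
      also have "(1 - c) *\<^sub>R y + c *\<^sub>R (y + u) = w" by (simp add: u algebra_simps)
      finally show "w \<in> - V" using disj closure_subset by blast
    qed
    ultimately have G: "G \<subseteq> interior (- V)" by (rule interior_maximal[rotated])
    have "emeasure (N t0 0) (ball v r) = emeasure \<mu> {u. sqrt t0 *\<^sub>R u \<in> ball v r}"
      by (simp add: emeasure_kernel)
    also have "\<dots> \<le> emeasure \<mu> {u. y + sqrt s *\<^sub>R u \<in> interior (- V)}"
    proof (rule emeasure_mono)
      have "y + sqrt s *\<^sub>R u \<in> interior (- V)" if "sqrt t0 *\<^sub>R u \<in> ball v r" for u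
      proof -
        have "y + c *\<^sub>R (sqrt t0 *\<^sub>R u) \<in> G" unfolding G_def using that by blast
        moreover have "c *\<^sub>R (sqrt t0 *\<^sub>R u) = sqrt s *\<^sub>R u"
          using t0 s by (simp add: c_def real_sqrt_divide)
        ultimately show ?thesis using G by auto
      qed
      then show "{u. sqrt t0 *\<^sub>R u \<in> ball v r} \<subseteq> {u. y + sqrt s *\<^sub>R u \<in> interior (- V)}" by blast
      have "open {u. y + sqrt s *\<^sub>R u \<in> interior (- V)}"
        using open_vimage[OF open_interior[of "- V"], of "\<lambda>u. y + sqrt s *\<^sub>R u"]
        by (simp add: vimage_def continuous_intros)
      then show "{u. y + sqrt s *\<^sub>R u \<in> interior (- V)} \<in> sets \<mu>" using sets_wiener by simp
    qed
    also have "\<dots> = emeasure (N s y) (interior (- V))" by (simp add: emeasure_kernel)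
    finally show "emeasure (N t0 0) (ball v r) \<le> emeasure (N s y) (interior (- V))" .
  qed
qed

end


section \<open>The Markov property on path space\<close>

text \<open>The list holds waiting times rather than absolute times, because each application of the
  Markov property restarts the clock.\<close>

primrec visits :: "(real \<Rightarrow> 'e) \<Rightarrow> real \<Rightarrow> (real \<times> 'e set) list \<Rightarrow> bool" where
  "visits w t [] \<longleftrightarrow> True"
| "visits w t (sA # l) \<longleftrightarrow> w (t + fst sA) \<in> snd sA \<and> visits w (t + fst sA) l"

primrec increments :: "(real \<Rightarrow> 'e set) \<Rightarrow> real \<Rightarrow> real list \<Rightarrow> (real \<times> 'e set) list" where
  "increments A u [] = []"
| "increments A u (j # js) = (j - u, A j) # increments A j js"

lemma visits_increments:
  "visits w (t + u) (increments A u js) \<longleftrightarrow> (\<forall>j\<in>set js. w (t + j) \<in> A j)"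
  by (induction js arbitrary: u) (simp_all add: algebra_simps)

lemma increments_nonneg:
  assumes "sorted (u # js)"
  shows "\<forall>sA\<in>set (increments A u js). 0 \<le> fst sA"
  using assms by (induction js arbitrary: u) auto

lemma snd_increments: "sA \<in> set (increments A u js) \<Longrightarrow> \<exists>j\<in>set js. snd sA = A j"
  by (induction js arbitrary: u) auto

lemma map_increments:
  "map (\<lambda>sA. (fst sA, f (snd sA))) (increments A u js) = increments (\<lambda>j. f (A j)) u js"
  by (induction js arbitrary: u) auto

section \<open>From conditional probabilities to finite-dimensional distributions and path
  laws\<close>

context brownian_motion
begin

abbreviation "R \<equiv> P 0"

lemma space_P [simp]: "space (P x) = space \<F>"
  using sets_P by (rule sets_eq_imp_space_eq)

declare sets_P [simp, measurable_cong]

sublocale P: prob_space "P x" for x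
  by (rule prob_space_P)

lemma subalg: "0 \<le> t \<Longrightarrow> subalgebra (P x) (F t)"
  using F_subalgebra[of t] by (simp add: subalgebra_def)

lemma space_F: "0 \<le> t \<Longrightarrow> space (F t) = space \<F>"
  using F_subalgebra[of t] by (simp add: subalgebra_def)

lemma sets_F_subset: "0 \<le> t \<Longrightarrow> D \<in> sets (F t) \<Longrightarrow> D \<in> sets \<F>"
  using F_subalgebra[of t] by (auto simp: subalgebra_def)

lemma adapted_le: "0 \<le> s \<Longrightarrow> s \<le> t \<Longrightarrow> W s \<in> F t \<rightarrow>\<^sub>M borel"
  using adapted[of s] F_mono[of s t] space_F[of s] space_F[of t]
  by (intro measurableI) (auto dest: measurable_sets)

lemma W_measurable [measurable]: "0 \<le> t \<Longrightarrow> W t \<in> \<F> \<rightarrow>\<^sub>M borel"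
  using measurable_from_subalg[OF F_subalgebra adapted] .

lemma kernel_emeasure_measurable [measurable]:
  "0 \<le> s \<Longrightarrow> A \<in> sets borel \<Longrightarrow> (\<lambda>y. emeasure (N s y) A) \<in> borel_measurable borel"
  using measurable_emeasure_kernel[OF kernel_subprob[of s], of A] by simp

lemma kernel_nn_integral_measurable [measurable]:
  "0 \<le> s \<Longrightarrow> f \<in> borel_measurable borel \<Longrightarrow> (\<lambda>y. \<integral>\<^sup>+z. f z \<partial>N s y) \<in> borel_measurable borel"
  using nn_integral_measurable_subprob_algebra2[of "\<lambda>_ z. f z" borel borel "N s"] by simp

text \<open>The conditional expectation integrated over \<open>D\<close>: a statement about
  measures, free of versions and exceptional sets, which can be iterated.\<close>

lemma markov_emeasure:
  assumes "0 \<le> s" "0 \<le> t" and D: "D \<in> sets (F t)" and A: "A \<in> sets borel"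
  shows "emeasure (P x) (D \<inter> {\<omega>\<in>space \<F>. W (t + s) \<omega> \<in> A})
    = (\<integral>\<^sup>+\<omega>. emeasure (N s (W t \<omega>)) A * indicator D \<omega> \<partial>P x)"
proof -
  interpret S: finite_measure_subalgebra "P x" "F t"
    by standard (rule subalg[OF assms(2)])
  interpret K: prob_space "N s y" for y by (rule prob_space_kernel[OF assms(1)])
  have [measurable]: "D \<in> sets \<F>" using sets_F_subset assms by blast
  note [measurable] = A W_measurable[OF assms(2)] W_measurable[of "t + s"]
  have "t + s \<ge> 0" using assms by simp
  have mA: "(\<lambda>\<omega>. measure (N s (W t \<omega>)) A) \<in> borel_measurable (P x)"
  proof -
    have "(\<lambda>y. measure (N s y) A) \<in> borel_measurable borel"
      unfolding measure_def using kernel_emeasure_measurable[OF assms(1) A] by measurable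
    from measurable_compose[OF W_measurable[OF assms(2)] this] show ?thesis
      by (simp cong: measurable_cong_sets)
  qed
  have int: "integrable (P x) (\<lambda>\<omega>. indicator A (W (t + s) \<omega>) :: real)"
    using \<open>t + s \<ge> 0\<close> by (intro P.integrable_const_bound[where B=1]) (auto simp: indicator_def)
  have int2: "integrable (P x) (\<lambda>\<omega>. indicator D \<omega> * measure (N s (W t \<omega>)) A)"
    using mA by (intro P.integrable_const_bound[where B=1]) (auto simp: indicator_def)
  have "measure (P x) (D \<inter> {\<omega>\<in>space \<F>. W (t + s) \<omega> \<in> A})
      = (\<integral>\<omega>. indicator D \<omega> * indicator A (W (t + s) \<omega>) \<partial>P x)"
  proof -
    have "(\<integral>\<omega>. indicator D \<omega> * indicator A (W (t + s) \<omega>) \<partial>P x :: real)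
        = (\<integral>\<omega>. indicator (D \<inter> {\<omega>\<in>space \<F>. W (t + s) \<omega> \<in> A}) \<omega> \<partial>P x)"
      by (intro Bochner_Integration.integral_cong) (auto simp: indicator_def)
    then show ?thesis using \<open>t + s \<ge> 0\<close> by simp
  qed
  also have "\<dots> = (\<integral>\<omega>\<in>D. indicator A (W (t + s) \<omega>) \<partial>P x)"
    by (simp add: set_lebesgue_integral_def)
  also have "\<dots> = (\<integral>\<omega>\<in>D. real_cond_exp (P x) (F t) (\<lambda>\<omega>. indicator A (W (t + s) \<omega>)) \<omega> \<partial>P x)"
    by (rule S.real_cond_exp_intA[OF int D])
  also have "\<dots> = (\<integral>\<omega>. indicator D \<omega> * measure (N s (W t \<omega>)) A \<partial>P x)"
    unfolding set_lebesgue_integral_def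
  proof (intro integral_cong_AE)
    show "(\<lambda>\<omega>. indicator D \<omega> *\<^sub>R real_cond_exp (P x) (F t) (\<lambda>\<omega>. indicator A (W (t + s) \<omega>)) \<omega>)
        \<in> borel_measurable (P x)"
      by measurable
    show "(\<lambda>\<omega>. indicator D \<omega> * measure (N s (W t \<omega>)) A) \<in> borel_measurable (P x)"
      using mA by measurable
    show "AE \<omega> in P x. indicator D \<omega> *\<^sub>R real_cond_exp (P x) (F t) (\<lambda>\<omega>. indicator A (W (t + s) \<omega>)) \<omega>
        = indicator D \<omega> * measure (N s (W t \<omega>)) A"
      using markov[OF assms(1,2) A, of x] by eventually_elim simp
  qed
  finally have "emeasure (P x) (D \<inter> {\<omega>\<in>space \<F>. W (t + s) \<omega> \<in> A})
      = ennreal (\<integral>\<omega>. indicator D \<omega> * measure (N s (W t \<omega>)) A \<partial>P x)"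
    by (simp add: P.emeasure_eq_measure)
  also have "\<dots> = (\<integral>\<^sup>+\<omega>. ennreal (indicator D \<omega> * measure (N s (W t \<omega>)) A) \<partial>P x)"
    by (rule nn_integral_eq_integral[symmetric, OF int2]) auto
  also have "\<dots> = (\<integral>\<^sup>+\<omega>. emeasure (N s (W t \<omega>)) A * indicator D \<omega> \<partial>P x)"
    by (intro nn_integral_cong) (auto simp: indicator_def K.emeasure_eq_measure)
  finally show ?thesis .
qed

text \<open>On \<open>D\<close>, the law of \<open>W (t + s)\<close> is the law of
  \<open>W t\<close> followed by the kernel; as an equality of measures this passes from sets to all
  nonnegative Borel functions at once.\<close>

lemma markov_nn_integral:
  assumes "0 \<le> s" "0 \<le> t" and D: "D \<in> sets (F t)" and f: "f \<in> borel_measurable borel"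
  shows "(\<integral>\<^sup>+\<omega>. f (W (t + s) \<omega>) * indicator D \<omega> \<partial>P x)
    = (\<integral>\<^sup>+\<omega>. (\<integral>\<^sup>+z. f z \<partial>N s (W t \<omega>)) * indicator D \<omega> \<partial>P x)"
proof -
  have [measurable]: "D \<in> sets \<F>" using sets_F_subset assms by blast
  define r where "r = t + s"
  have "r \<ge> 0" using assms by (simp add: r_def)
  note [measurable] = W_measurable[OF assms(2)] W_measurable[OF this] f
  let ?D = "density (P x) (indicator D)"
  have emb: "(\<lambda>\<omega>. emeasure (N s (W t \<omega>)) A) \<in> borel_measurable (P x)" if "A \<in> sets borel" for A
    using measurable_compose[OF W_measurable[OF assms(2)] kernel_emeasure_measurable[OF assms(1) that]]
    by (simp cong: measurable_cong_sets)
  have eq: "distr ?D borel (W r) = distr ?D borel (W t) \<bind> N s"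
  proof (rule measure_eqI)
    show sets: "sets (distr ?D borel (W r)) = sets (distr ?D borel (W t) \<bind> N s)"
      by (subst sets_bind[where N=borel]) auto
    fix A assume "A \<in> sets (distr ?D borel (W r))"
    then have A[measurable]: "A \<in> sets borel" by simp
    have "emeasure (distr ?D borel (W r)) A = emeasure ?D {\<omega>\<in>space \<F>. W r \<omega> \<in> A}"
      by (subst emeasure_distr) (auto intro!: arg_cong2[where f=emeasure])
    also have "\<dots> = emeasure (P x) (D \<inter> {\<omega>\<in>space \<F>. W r \<omega> \<in> A})"
      by (subst emeasure_density) (auto simp flip: nn_integral_indicator intro!: nn_integral_cong simp: indicator_def)
    also have "\<dots> = (\<integral>\<^sup>+\<omega>. emeasure (N s (W t \<omega>)) A * indicator D \<omega> \<partial>P x)"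
      unfolding r_def by (rule markov_emeasure) fact+
    also have "\<dots> = (\<integral>\<^sup>+\<omega>. emeasure (N s (W t \<omega>)) A \<partial>?D)"
      using emb[OF A] by (subst nn_integral_density) (auto simp: ac_simps)
    also have "\<dots> = (\<integral>\<^sup>+y. emeasure (N s y) A \<partial>distr ?D borel (W t))"
      using assms(1) by (subst nn_integral_distr) auto
    also have "\<dots> = emeasure (distr ?D borel (W t) \<bind> N s) A"
      using kernel_subprob[OF assms(1)]
      by (intro emeasure_bind[symmetric]) (auto cong: measurable_cong_sets)
    finally show "emeasure (distr ?D borel (W r)) A = emeasure (distr ?D borel (W t) \<bind> N s) A" .
  qed
  have "(\<lambda>\<omega>. f (W r \<omega>)) \<in> borel_measurable (P x)" by measurable
  then have "(\<integral>\<^sup>+\<omega>. f (W r \<omega>) * indicator D \<omega> \<partial>P x) = (\<integral>\<^sup>+y. f y \<partial>distr ?D borel (W r))"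
    by (subst nn_integral_distr) (auto simp: nn_integral_density mult.commute)
  also have "\<dots> = (\<integral>\<^sup>+y. (\<integral>\<^sup>+z. f z \<partial>N s y) \<partial>distr ?D borel (W t))"
    unfolding eq using kernel_subprob[OF assms(1)]
    by (subst nn_integral_bind[where B=borel]) (auto cong: measurable_cong_sets)
  also have "\<dots> = (\<integral>\<^sup>+\<omega>. (\<integral>\<^sup>+z. f z \<partial>N s (W t \<omega>)) \<partial>?D)"
    using assms(1) by (subst nn_integral_distr) auto
  also have "\<dots> = (\<integral>\<^sup>+\<omega>. (\<integral>\<^sup>+z. f z \<partial>N s (W t \<omega>)) * indicator D \<omega> \<partial>P x)"
  proof (subst nn_integral_density)
    show "(\<lambda>\<omega>. \<integral>\<^sup>+z. f z \<partial>N s (W t \<omega>)) \<in> borel_measurable (P x)"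
      using measurable_compose[OF W_measurable[OF assms(2)] kernel_nn_integral_measurable[OF assms(1) f]]
      by (simp cong: measurable_cong_sets)
  qed (auto simp: ac_simps)
  finally show ?thesis by (simp add: r_def)
qed

text \<open>The probability of the visits \<open>l\<close> for the process started at
  \<open>y\<close> (see \<open>visits_from_0\<close>), written as an iterated integral so that
  measurability in \<open>y\<close> and the effect of a translation follow by induction.\<close>

primrec fdd :: "(real \<times> 'e set) list \<Rightarrow> 'e \<Rightarrow> ennreal" where
  "fdd [] y = 1"
| "fdd (sA # l) y = (\<integral>\<^sup>+z. indicator (snd sA) z * fdd l z \<partial>N (fst sA) y)"

lemma fdd_measurable:
  "\<forall>sA\<in>set l. 0 \<le> fst sA \<and> snd sA \<in> sets borel \<Longrightarrow> fdd l \<in> borel_measurable borel"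
proof (induction l)
  case Nil
  then show ?case by (simp add: fun_eq_iff cong: measurable_cong)
next
  case (Cons sA l)
  then have "(\<lambda>z. indicator (snd sA) z * fdd l z) \<in> borel_measurable borel"
    by (intro borel_measurable_times_ennreal borel_measurable_indicator) auto
  then have "(\<lambda>y. \<integral>\<^sup>+z. indicator (snd sA) z * fdd l z \<partial>N (fst sA) y) \<in> borel_measurable borel"
    using Cons by (intro kernel_nn_integral_measurable) auto
  then show ?case by (simp add: fun_eq_iff cong: measurable_cong)
qed

lemma fdd_translate:
  "\<forall>sA\<in>set l. 0 \<le> fst sA \<and> snd sA \<in> sets borel \<Longrightarrow>
    fdd l (y + a) = fdd (map (\<lambda>sA. (fst sA, (\<lambda>z. z + a) -` snd sA)) l) y"
proof (induction l arbitrary: y)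
  case (Cons sA l)
  have [measurable]: "fdd l \<in> borel_measurable borel" "snd sA \<in> sets borel"
    using Cons.prems fdd_measurable by auto
  have "fdd (sA # l) (y + a) = (\<integral>\<^sup>+z. indicator (snd sA) (z + a) * fdd l (z + a) \<partial>N (fst sA) y)"
    unfolding fdd.simps kernel_translate[of "fst sA" y a] by (subst nn_integral_distr) auto
  also have "\<dots> = fdd (map (\<lambda>sA. (fst sA, (\<lambda>z. z + a) -` snd sA)) (sA # l)) y"
    using Cons.IH Cons.prems by (auto simp: case_prod_unfold indicator_def intro!: nn_integral_cong)
  finally show ?case .
qed simp

text \<open>Induction on the list: the first visit is absorbed into the conditioning event, which
  then belongs to the filtration at the later time.\<close>

lemma markov_visits:
  assumes "\<forall>sA\<in>set l. 0 \<le> fst sA \<and> snd sA \<in> sets borel" "0 \<le> t" "D \<in> sets (F t)"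
  shows "emeasure (P x) (D \<inter> {\<omega>\<in>space \<F>. visits (\<lambda>u. W u \<omega>) t l})
    = (\<integral>\<^sup>+\<omega>. fdd l (W t \<omega>) * indicator D \<omega> \<partial>P x)"
  using assms
proof (induction l arbitrary: t D)
  case Nil
  have D: "D \<in> sets \<F>" using sets_F_subset Nil by blast
  then have "D \<inter> space \<F> = D" using sets.sets_into_space by blast
  then show ?case using D by simp
next
  case (Cons sA l)
  obtain s A where sA: "sA = (s, A)" by (cases sA)
  have s: "0 \<le> s" "A \<in> sets borel" "0 \<le> t + s" "t \<le> t + s" using Cons.prems sA by auto
  define D' where "D' = D \<inter> {\<omega>\<in>space \<F>. W (t + s) \<omega> \<in> A}"
  have "D \<in> sets (F (t + s))" using F_mono[of t "t + s"] s Cons.prems by auto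
  moreover have "{\<omega>\<in>space \<F>. W (t + s) \<omega> \<in> A} = W (t + s) -` A \<inter> space (F (t + s))"
    using space_F[of "t + s"] s by auto
  then have "{\<omega>\<in>space \<F>. W (t + s) \<omega> \<in> A} \<in> sets (F (t + s))"
    using measurable_sets[OF adapted[of "t + s"] s(2)] s by simp
  ultimately have D': "D' \<in> sets (F (t + s))" by (auto simp: D'_def)
  have "D \<inter> {\<omega>\<in>space \<F>. visits (\<lambda>u. W u \<omega>) t (sA # l)}
      = D' \<inter> {\<omega>\<in>space \<F>. visits (\<lambda>u. W u \<omega>) (t + s) l}"
    by (auto simp: D'_def sA)
  then have "emeasure (P x) (D \<inter> {\<omega>\<in>space \<F>. visits (\<lambda>u. W u \<omega>) t (sA # l)})
      = (\<integral>\<^sup>+\<omega>. fdd l (W (t + s) \<omega>) * indicator D' \<omega> \<partial>P x)"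
    using Cons.IH[OF _ s(3) D'] Cons.prems by simp
  also have "\<dots> = (\<integral>\<^sup>+\<omega>. (indicator A (W (t + s) \<omega>) * fdd l (W (t + s) \<omega>)) * indicator D \<omega> \<partial>P x)"
    by (intro nn_integral_cong) (auto simp: D'_def indicator_def)
  also have "\<dots> = (\<integral>\<^sup>+\<omega>. (\<integral>\<^sup>+z. indicator A z * fdd l z \<partial>N s (W t \<omega>)) * indicator D \<omega> \<partial>P x)"
    using Cons.prems s
    by (intro markov_nn_integral borel_measurable_times_ennreal borel_measurable_indicator fdd_measurable) auto
  finally show ?case by (simp add: sA)
qed

lemma space_F_in: "0 \<le> t \<Longrightarrow> space \<F> \<in> sets (F t)"
  using space_F[of t] sets.top[of "F t"] by simp

lemma visits_from_0:
  assumes l: "\<forall>sA\<in>set l. 0 \<le> fst sA \<and> snd sA \<in> sets borel"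
  shows "emeasure (P x) {\<omega>\<in>space \<F>. visits (\<lambda>u. W u \<omega>) 0 l} = fdd l x"
proof -
  have "emeasure (P x) {\<omega>\<in>space \<F>. visits (\<lambda>u. W u \<omega>) 0 l}
      = (\<integral>\<^sup>+\<omega>. fdd l (W 0 \<omega>) * indicator (space \<F>) \<omega> \<partial>P x)"
    using markov_visits[OF l order_refl space_F_in[OF order_refl], of x] by (simp add: Int_def)
  also have "\<dots> = (\<integral>\<^sup>+\<omega>. fdd l x \<partial>P x)"
  proof (rule nn_integral_cong_AE)
    show "AE \<omega> in P x. fdd l (W 0 \<omega>) * indicator (space \<F>) \<omega> = fdd l x"
      using start[of x] AE_space[of "P x"] by eventually_elim simp
  qed
  finally show ?thesis using P.emeasure_space_1[of x] by simp
qed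

abbreviation path_space :: "real set \<Rightarrow> (real \<Rightarrow> 'e) measure" where
  "path_space T \<equiv> Pi\<^sub>M T (\<lambda>_. borel)"

lemma restrict_W_measurable [measurable]:
  assumes "T \<subseteq> {0..}" "0 \<le> t"
  shows "(\<lambda>\<omega>. \<lambda>u\<in>T. W (t + u) \<omega>) \<in> \<F> \<rightarrow>\<^sub>M path_space T"
  using assms by (intro measurable_restrict W_measurable) auto

lemma translated_path_measurable [measurable]:
  assumes "T \<subseteq> {0..}"
  shows "(\<lambda>(y, \<omega>). \<lambda>u\<in>T. y + W u \<omega>) \<in> borel \<Otimes>\<^sub>M \<F> \<rightarrow>\<^sub>M path_space T"
  unfolding case_prod_beta
proof (intro measurable_restrict)
  fix u assume "u \<in> T"
  then have [measurable]: "W u \<in> \<F> \<rightarrow>\<^sub>M borel" using assms by (intro W_measurable) auto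
  show "(\<lambda>p. fst p + W u (snd p)) \<in> borel \<Otimes>\<^sub>M \<F> \<rightarrow>\<^sub>M borel" by measurable
qed

text \<open>The law of the future on \<open>D\<close> and the law of \<open>W t\<close> plus an
  independent path drawn from \<open>R\<close> agree on finite cylinders, hence on path space.
  Spatial homogeneity, in the form of \<open>fdd_translate\<close>, allows the single measure
  \<open>R\<close> in place of all \<open>P y\<close>.\<close>

theorem markov_path:
  assumes T: "T \<subseteq> {0..}" and t: "0 \<le> t" and D: "D \<in> sets (F t)"
    and G: "G \<in> borel_measurable (path_space T)"
  shows "(\<integral>\<^sup>+\<omega>. G (\<lambda>u\<in>T. W (t + u) \<omega>) * indicator D \<omega> \<partial>P x)
    = (\<integral>\<^sup>+\<omega>. (\<integral>\<^sup>+\<omega>'. G (\<lambda>u\<in>T. W t \<omega> + W u \<omega>') \<partial>R) * indicator D \<omega> \<partial>P x)"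
proof -
  have [measurable]: "D \<in> sets \<F>" using sets_F_subset assms by blast
  note [measurable] = W_measurable[OF t] G
  let ?D = "density (P x) (indicator D)"
  let ?X = "\<lambda>\<omega>. \<lambda>u\<in>T. W (t + u) \<omega>"
  let ?Y = "\<lambda>(\<omega>, \<omega>'). \<lambda>u\<in>T. W t \<omega> + W u \<omega>'"
  have X [measurable]: "?X \<in> ?D \<rightarrow>\<^sub>M path_space T"
    using restrict_W_measurable[OF T t] by (simp cong: measurable_cong_sets)
  have YF: "?Y \<in> \<F> \<Otimes>\<^sub>M \<F> \<rightarrow>\<^sub>M path_space T"
  proof -
    have "(\<lambda>p. (W t (fst p), snd p)) \<in> \<F> \<Otimes>\<^sub>M \<F> \<rightarrow>\<^sub>M borel \<Otimes>\<^sub>M \<F>" by measurable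
    from measurable_compose[OF this translated_path_measurable[OF T]] show ?thesis
      by (simp add: case_prod_beta)
  qed
  then have Y [measurable]: "?Y \<in> ?D \<Otimes>\<^sub>M R \<rightarrow>\<^sub>M path_space T"
    by (simp cong: measurable_cong_sets sets_pair_measure_cong)
  have fin: "finite_measure ?D"
  proof (rule finite_measureI)
    have "emeasure ?D (space ?D) = emeasure (P x) D"
      by (subst emeasure_density) (auto simp flip: nn_integral_indicator intro!: nn_integral_cong simp: indicator_def)
    then show "emeasure ?D (space ?D) \<noteq> \<infinity>" by (simp add: P.emeasure_eq_measure)
  qed
  interpret fD: finite_measure ?D by fact
  have "distr ?D (path_space T) ?X = distr (?D \<Otimes>\<^sub>M R) (path_space T) ?Y"
  proof (rule measure_eqI_PiM_infinite)
    show "finite_measure (distr ?D (path_space T) ?X)"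
      by (rule fD.finite_measure_distr[OF X])
    fix A :: "real \<Rightarrow> 'e set" and J assume J: "finite J" "J \<subseteq> T" and A: "\<And>i. i \<in> J \<Longrightarrow> A i \<in> sets borel"
    \<comment> \<open>Sorting makes the waiting times nonnegative.\<close>
    define js where "js = sorted_list_of_set J"
    have js: "set js = J" "sorted js" using J by (auto simp: js_def)
    have sorted: "sorted (0 # js)" using js J T by auto
    define l where "l = increments A 0 js"
    have l: "\<forall>sA\<in>set l. 0 \<le> fst sA \<and> snd sA \<in> sets borel"
      using increments_nonneg[OF sorted, of A] snd_increments[of _ A 0 js] A js unfolding l_def by metis
    have visits: "visits w s l \<longleftrightarrow> (\<forall>j\<in>J. w (s + j) \<in> A j)" for w s
      using visits_increments[of w s 0 A js] js by (simp add: l_def)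
    let ?E = "prod_emb T (\<lambda>_. borel) J (Pi\<^sub>E J A)"
    have E [measurable]: "?E \<in> sets (path_space T)"
      using J A by (intro sets_PiM_I) auto
    have memE: "(\<lambda>u\<in>T. w u) \<in> ?E \<longleftrightarrow> (\<forall>j\<in>J. w j \<in> A j)" for w
      using J by (auto simp: prod_emb_def PiE_iff extensional_def restrict_def subset_iff)
    have shift: "emeasure R {\<omega>'\<in>space \<F>. \<forall>j\<in>J. y + W j \<omega>' \<in> A j} = fdd l y" for y
    proof -
      \<comment> \<open>The translation by \<open>y\<close> is moved from the path to the sets, so
        that the starting point is 0 as \<open>R\<close> demands.\<close>
      let ?l = "map (\<lambda>sA. (fst sA, (\<lambda>z. z + y) -` snd sA)) l"
      have meas: "(\<lambda>z. z + y) -` A j \<in> sets borel" if "A j \<in> sets borel" for j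
        using measurable_sets[of "\<lambda>z. z + y" borel borel "A j"] that by simp
      have l': "\<forall>sA\<in>set ?l. 0 \<le> fst sA \<and> snd sA \<in> sets borel"
        using l measurable_sets[of "\<lambda>z. z + y" borel borel] by (auto simp: case_prod_beta)
      have "visits w 0 ?l \<longleftrightarrow> (\<forall>j\<in>J. y + w j \<in> A j)" for w
        using visits_increments[of w 0 0 "\<lambda>j. (\<lambda>z. z + y) -` A j" js] js
        by (simp add: l_def map_increments add.commute)
      then have "emeasure R {\<omega>'\<in>space \<F>. \<forall>j\<in>J. y + W j \<omega>' \<in> A j} = fdd ?l 0"
        using visits_from_0[OF l', of 0] by simp
      also have "\<dots> = fdd l y" using fdd_translate[OF l, of 0 y, symmetric] by (simp only: add_0_left)
      finally show ?thesis .
    qed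
    have "emeasure (distr ?D (path_space T) ?X) ?E = emeasure ?D {\<omega>\<in>space \<F>. \<forall>j\<in>J. W (t + j) \<omega> \<in> A j}"
    proof -
      have "?X -` ?E \<inter> space ?D = {\<omega>\<in>space \<F>. \<forall>j\<in>J. W (t + j) \<omega> \<in> A j}"
        unfolding vimage_def memE by auto
      then show ?thesis by (simp only: emeasure_distr[OF X E])
    qed
    also have "\<dots> = emeasure (P x) (D \<inter> {\<omega>\<in>space \<F>. visits (\<lambda>u. W u \<omega>) t l})"
    proof -
      have "{\<omega>\<in>space \<F>. \<forall>j\<in>J. W (t + j) \<omega> \<in> A j} = ?X -` ?E \<inter> space \<F>"
        unfolding vimage_def memE by auto
      also have "\<dots> \<in> sets (P x)" using measurable_sets[OF X E] by simp
      finally have m: "{\<omega>\<in>space \<F>. \<forall>j\<in>J. W (t + j) \<omega> \<in> A j} \<in> sets (P x)" .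
      then show ?thesis unfolding visits
        by (subst emeasure_density) (auto simp flip: nn_integral_indicator intro!: nn_integral_cong simp: indicator_def)
    qed
    also have "\<dots> = (\<integral>\<^sup>+\<omega>. fdd l (W t \<omega>) * indicator D \<omega> \<partial>P x)"
      by (rule markov_visits[OF l t D])
    also have "\<dots> = (\<integral>\<^sup>+\<omega>. fdd l (W t \<omega>) \<partial>?D)"
      using measurable_compose[OF W_measurable[OF t] fdd_measurable[OF l]]
      by (subst nn_integral_density) (auto simp: mult.commute cong: measurable_cong_sets)
    also have "\<dots> = (\<integral>\<^sup>+\<omega>. emeasure R {\<omega>'\<in>space \<F>. \<forall>j\<in>J. W t \<omega> + W j \<omega>' \<in> A j} \<partial>?D)"
      by (simp add: shift)
    also have "\<dots> = emeasure (?D \<Otimes>\<^sub>M R) (?Y -` ?E \<inter> space (?D \<Otimes>\<^sub>M R))"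
    proof (subst P.emeasure_pair_measure_alt[OF measurable_sets[OF Y E]], intro nn_integral_cong)
      fix \<omega> assume "\<omega> \<in> space ?D"
      then have "Pair \<omega> -` (?Y -` ?E \<inter> space (?D \<Otimes>\<^sub>M R)) = {\<omega>'\<in>space \<F>. \<forall>j\<in>J. W t \<omega> + W j \<omega>' \<in> A j}"
        unfolding vimage_def by (auto simp: memE space_pair_measure)
      then show "emeasure R {\<omega>'\<in>space \<F>. \<forall>j\<in>J. W t \<omega> + W j \<omega>' \<in> A j}
          = emeasure R (Pair \<omega> -` (?Y -` ?E \<inter> space (?D \<Otimes>\<^sub>M R)))" by simp
    qed
    also have "\<dots> = emeasure (distr (?D \<Otimes>\<^sub>M R) (path_space T) ?Y) ?E"
      by (rule emeasure_distr[symmetric, OF Y E])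
    finally show "emeasure (distr ?D (path_space T) ?X) ?E
        = emeasure (distr (?D \<Otimes>\<^sub>M R) (path_space T) ?Y) ?E" .
  qed simp_all
  then have "(\<integral>\<^sup>+w. G w \<partial>distr ?D (path_space T) ?X) = (\<integral>\<^sup>+w. G w \<partial>distr (?D \<Otimes>\<^sub>M R) (path_space T) ?Y)"
    by simp
  also have "(\<integral>\<^sup>+w. G w \<partial>distr ?D (path_space T) ?X) = (\<integral>\<^sup>+\<omega>. G (?X \<omega>) * indicator D \<omega> \<partial>P x)"
    using measurable_compose[OF restrict_W_measurable[OF T t] G]
    by (subst nn_integral_distr[OF X]) (auto simp: nn_integral_density ac_simps cong: measurable_cong_sets)
  also have "(\<integral>\<^sup>+w. G w \<partial>distr (?D \<Otimes>\<^sub>M R) (path_space T) ?Y) = (\<integral>\<^sup>+p. G (?Y p) \<partial>(?D \<Otimes>\<^sub>M R))"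
    by (rule nn_integral_distr[OF Y]) (simp add: G)
  also have "\<dots> = (\<integral>\<^sup>+\<omega>. (\<integral>\<^sup>+\<omega>'. G (?Y (\<omega>, \<omega>')) \<partial>R) \<partial>?D)"
    by (rule P.nn_integral_fst[symmetric]) (rule measurable_compose[OF Y G])
  also have "\<dots> = (\<integral>\<^sup>+\<omega>. (\<integral>\<^sup>+\<omega>'. G (?Y (\<omega>, \<omega>')) \<partial>R) * indicator D \<omega> \<partial>P x)"
  proof (subst nn_integral_density)
    have "(\<lambda>p. G (?Y p)) \<in> borel_measurable (P x \<Otimes>\<^sub>M R)"
      using measurable_compose[OF YF G] by (simp cong: measurable_cong_sets sets_pair_measure_cong)
    from P.borel_measurable_nn_integral_fst[OF this]
    show "(\<lambda>\<omega>. \<integral>\<^sup>+\<omega>'. G (?Y (\<omega>, \<omega>')) \<partial>R) \<in> borel_measurable (P x)" .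
  qed (auto simp: ac_simps)
  finally show ?thesis by simp
qed

end


section \<open>Exit times of continuous paths\<close>

text \<open>In contrast to \<open>hitting_time\<close>, time 0 counts. On paths starting in
  \<open>V\<close> the two agree; on paths starting at the boundary the exit is immediate, which
  gives the exit kernel the boundary value \<open>g y\<close>.\<close>

definition exit_time :: "'e set \<Rightarrow> (real \<Rightarrow> 'e) \<Rightarrow> ereal" where
  "exit_time V w = Inf {ereal t | t. 0 \<le> t \<and> w t \<in> - V}"

lemma hitting_time_eq_exit_time:
  assumes "W 0 \<omega> \<in> V"
  shows "hitting_time W (- V) \<omega> = exit_time V (\<lambda>t. W t \<omega>)"
proof -
  have "0 < t \<and> W t \<omega> \<in> - V \<longleftrightarrow> 0 \<le> t \<and> W t \<omega> \<in> - V" for t :: real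
    using assms by (cases "t = 0") auto
  then show ?thesis by (simp add: hitting_time_def exit_time_def)
qed

lemma exit_time_nonneg: "0 \<le> exit_time V w"
  unfolding exit_time_def by (intro Inf_greatest) auto

lemma exit_time_le: "0 \<le> t \<Longrightarrow> w t \<notin> V \<Longrightarrow> exit_time V w \<le> ereal t"
  unfolding exit_time_def by (intro Inf_lower) auto

lemma before_exit_time: "0 \<le> t \<Longrightarrow> ereal t < exit_time V w \<Longrightarrow> w t \<in> V"
  using exit_time_le[of t w V] by (force simp: not_le[symmetric])

lemma exit_time_less: "exit_time V w < c \<Longrightarrow> \<exists>t\<ge>0. ereal t < c \<and> w t \<notin> V"
  unfolding exit_time_def by (auto simp: Inf_less_iff)

locale open_set_path =
  fixes V :: "'e::{metric_space} set" and w :: "real \<Rightarrow> 'e"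
  assumes opn: "open V" and cont: "continuous_on {0..} w"
begin

definition "\<tau> = real_of_ereal (exit_time V w)"

lemma exit_time_real: "exit_time V w < \<infinity> \<Longrightarrow> exit_time V w = ereal \<tau> \<and> 0 \<le> \<tau>"
  using exit_time_nonneg[of V w] unfolding \<tau>_def by (cases "exit_time V w") auto

text \<open>The infimum is attained because \<open>- V\<close> is closed and the path is
  continuous.\<close>

lemma exit_point_notin:
  assumes fin: "exit_time V w < \<infinity>"
  shows "w \<tau> \<notin> V"
proof
  note \<tau> = exit_time_real[OF fin]
  assume "w \<tau> \<in> V"
  have "\<tau> \<in> {0..}" using \<tau> by simp
  then have "\<forall>\<^sub>F t in at \<tau> within {0..}. w t \<in> V"
    using cont \<open>w \<tau> \<in> V\<close> opn by (auto simp: continuous_on_def intro: topological_tendstoD)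
  then obtain d where d: "0 < d" "\<And>t. 0 \<le> t \<Longrightarrow> t \<noteq> \<tau> \<Longrightarrow> dist t \<tau> < d \<Longrightarrow> w t \<in> V"
    by (auto simp: eventually_at)
  have "exit_time V w < ereal (\<tau> + d)" using \<tau> d(1) by simp
  then obtain t where t: "0 \<le> t" "t < \<tau> + d" "w t \<notin> V" using exit_time_less by force
  then have "\<tau> \<le> t" using exit_time_le[of t w V] \<tau> by simp
  then show False using d(2)[of t] t \<open>w \<tau> \<in> V\<close> by (cases "t = \<tau>") (auto simp: dist_real_def)
qed

lemma less_exit_time_iff:
  assumes "0 \<le> t"
  shows "ereal t < exit_time V w \<longleftrightarrow> (\<forall>s\<in>{0..t}. w s \<in> V)"
proof
  assume "ereal t < exit_time V w"
  then show "\<forall>s\<in>{0..t}. w s \<in> V"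
    by (auto intro!: before_exit_time intro: le_less_trans[of "ereal _" "ereal t"])
next
  assume *: "\<forall>s\<in>{0..t}. w s \<in> V"
  show "ereal t < exit_time V w"
  proof (rule ccontr)
    assume n: "\<not> ?thesis"
    then have fin: "exit_time V w < \<infinity>" by (auto simp: not_less intro: le_less_trans)
    note \<tau> = exit_time_real[OF fin]
    have "\<tau> \<le> t" using n \<tau> by (metis ereal_less_eq(3) not_less)
    then show False using * \<tau> exit_point_notin[OF fin] by auto
  qed
qed

lemma exit_point_frontier:
  assumes fin: "exit_time V w < \<infinity>" and w0: "w 0 \<in> closure V"
  shows "w \<tau> \<in> frontier V"
proof -
  note \<tau> = exit_time_real[OF fin]
  have "w \<tau> \<in> closure V"
  proof (cases "\<tau> = 0")
    case False
    then have cl: "closure {0..<\<tau>} = {0..\<tau>}" using \<tau> by (intro closure_atLeastLessThan) simp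
    have "w t \<in> V" if "t \<in> {0..<\<tau>}" for t using that \<tau> by (intro before_exit_time) auto
    then have "w ` closure {0..<\<tau>} \<subseteq> closure V" unfolding cl[symmetric]
      using cl by (intro image_closure_subset continuous_on_subset[OF cont])
        (auto intro!: subsetD[OF closure_subset, of _ V])
    then show ?thesis using \<tau> unfolding cl by auto
  qed (use w0 in simp)
  then show ?thesis using exit_point_notin[OF fin] opn
    by (simp add: frontier_def interior_open)
qed

lemma exit_time_shift:
  assumes "0 \<le> t" "ereal t < exit_time V w"
  shows "exit_time V w = ereal t + exit_time V (\<lambda>s. w (t + s))"
proof (rule antisym)
  have in_V: "w s \<in> V" if "0 \<le> s" "s \<le> t" for s
    using less_exit_time_iff[OF assms(1)] assms(2) that by auto
  show "exit_time V w \<le> ereal t + exit_time V (\<lambda>s. w (t + s))"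
  proof (rule ereal_le_epsilon2)
    fix e :: real assume e: "0 < e"
    show "exit_time V w \<le> ereal t + exit_time V (\<lambda>s. w (t + s)) + ereal e"
    proof (cases "exit_time V (\<lambda>s. w (t + s))")
      case (real r)
      then obtain s where s: "0 \<le> s" "s < r + e" "w (t + s) \<notin> V"
        using exit_time_less[of V "\<lambda>s. w (t + s)" "ereal (r + e)"] e by auto
      then have "exit_time V w \<le> ereal (t + s)" using assms(1) by (intro exit_time_le) auto
      also have "\<dots> \<le> ereal t + exit_time V (\<lambda>s. w (t + s)) + ereal e" using real s by simp
      finally show ?thesis .
    qed (use exit_time_nonneg[of V "\<lambda>s. w (t + s)"] in auto)
  qed
  show "ereal t + exit_time V (\<lambda>s. w (t + s)) \<le> exit_time V w"
    unfolding exit_time_def[of V w]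
  proof (rule Inf_greatest)
    fix z assume "z \<in> {ereal t |t. 0 \<le> t \<and> w t \<in> - V}"
    then obtain u where u: "z = ereal u" "0 \<le> u" "w u \<notin> V" by auto
    then have "t < u" using in_V[of u] by force
    then have "exit_time V (\<lambda>s. w (t + s)) \<le> ereal (u - t)" using u by (intro exit_time_le) auto
    then have "ereal t + exit_time V (\<lambda>s. w (t + s)) \<le> ereal t + ereal (u - t)" by (rule add_left_mono)
    then show "ereal t + exit_time V (\<lambda>s. w (t + s)) \<le> z" using u by simp
  qed
qed

end

definition exit_value :: "'e set \<Rightarrow> ('e \<Rightarrow> ennreal) \<Rightarrow> (real \<Rightarrow> 'e) \<Rightarrow> ennreal" where
  "exit_value V g w = (if exit_time V w < \<infinity> then g (w (real_of_ereal (exit_time V w))) else 0)"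

lemma exit_value_shift:
  assumes "open_set_path V w" "0 \<le> t" "ereal t < exit_time V w"
  shows "exit_value V g w = exit_value V g (\<lambda>s. w (t + s))"
proof -
  interpret open_set_path V w by fact
  show ?thesis
    using exit_time_shift[OF assms(2,3)] exit_time_nonneg[of V "\<lambda>s. w (t + s)"] unfolding exit_value_def
    by (cases "exit_time V (\<lambda>s. w (t + s))") auto
qed

text \<open>The exit time and exit point of a continuous path are recovered measurably from its
  restriction to the countable set of rational times.\<close>

definition rat_times :: "real set" where
  "rat_times = {q \<in> \<rat>. 0 \<le> q}"

lemma countable_rat_times: "countable rat_times"
  unfolding rat_times_def by (rule countable_subset[OF _ countable_rat]) auto

lemma rat_times_nonneg: "rat_times \<subseteq> {0..}"
  by (auto simp: rat_times_def)

text \<open>Rational times alone could miss an exit at an irrational time, so a uniform distance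
  from the complement is demanded. For a continuous path and open \<open>V\<close> this is the same
  as staying in \<open>V\<close> up to \<open>q\<close>, by compactness of the path segment.\<close>

definition inside_until :: "'e::metric_space set \<Rightarrow> real \<Rightarrow> (real \<Rightarrow> 'e) \<Rightarrow> bool" where
  "inside_until V q w \<longleftrightarrow>
    (\<exists>n::nat. \<forall>q'\<in>rat_times. q' \<le> q \<longrightarrow> ball (w q') (inverse (Suc n)) \<subseteq> V)"

definition rational_exit_time :: "'e::metric_space set \<Rightarrow> (real \<Rightarrow> 'e) \<Rightarrow> ereal" where
  "rational_exit_time V w = (SUP q\<in>rat_times. if inside_until V q w then ereal q else 0)"

text \<open>The evaluation times are dyadic, hence rational, and approach the exit time from below;
  continuity of the path makes the limit the exit point.\<close>

definition rational_exit_point :: "'e::metric_space set \<Rightarrow> (real \<Rightarrow> 'e) \<Rightarrow> 'e" where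
  "rational_exit_point V w =
    lim (\<lambda>n. w (real (nat \<lfloor>2 ^ n * real_of_ereal (rational_exit_time V w)\<rfloor>) / 2 ^ n))"

definition rational_exit_value :: "'e::metric_space set \<Rightarrow> ('e \<Rightarrow> ennreal) \<Rightarrow> (real \<Rightarrow> 'e) \<Rightarrow> ennreal" where
  "rational_exit_value V g w =
    (if rational_exit_time V w < \<infinity> then g (rational_exit_point V w) else 0)"

text \<open>Stated for an arbitrary random path, so that it applies to path space as well as to the
  filtration, where only times up to \<open>q\<close> are observed.\<close>

lemma inside_until_measurable:
  fixes V :: "'e::metric_space set"
  assumes X: "\<And>q'. q' \<in> rat_times \<Longrightarrow> q' \<le> q \<Longrightarrow> (\<lambda>\<omega>. X \<omega> q') \<in> M \<rightarrow>\<^sub>M borel"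
  shows "Measurable.pred M (\<lambda>\<omega>. inside_until V q (X \<omega>))"
proof -
  have "open (- {x. ball x e \<subseteq> V})" for e
  proof (rule openI)
    fix x assume "x \<in> - {x. ball x e \<subseteq> V}"
    then obtain y where y: "dist x y < e" "y \<notin> V" by (auto simp: subset_eq)
    show "\<exists>d>0. ball x d \<subseteq> - {x. ball x e \<subseteq> V}"
    proof (intro exI conjI subsetI)
      show "0 < e - dist x y" using y by simp
      fix z assume "z \<in> ball x (e - dist x y)"
      then have "dist z y < e" using dist_triangle[of z y x] by (simp add: dist_commute)
      then show "z \<in> - {x. ball x e \<subseteq> V}" using y by auto
    qed
  qed
  then have "closed {x. ball x e \<subseteq> V}" for e by (simp add: closed_def)
  then have B: "Measurable.pred borel (\<lambda>x. ball x e \<subseteq> V)" for e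
    by (simp add: pred_def borel_closed)
  have "Measurable.pred M (\<lambda>\<omega>. q' \<le> q \<longrightarrow> ball (X \<omega> q') e \<subseteq> V)" if "q' \<in> rat_times" for q' e
    using measurable_compose[OF X B] that by (cases "q' \<le> q") auto
  then show ?thesis
    unfolding inside_until_def pred_def
    by (intro sets.sets_Collect_countable_Ex sets.sets_Collect_countable_All' countable_rat_times)
qed

lemma rational_exit_time_measurable [measurable]:
  "rational_exit_time V \<in> borel_measurable (Pi\<^sub>M rat_times (\<lambda>_. borel))"
  unfolding rational_exit_time_def
proof (intro borel_measurable_SUP countable_rat_times)
  fix q
  have [measurable]: "Measurable.pred (Pi\<^sub>M rat_times (\<lambda>_. borel)) (inside_until V q)"
    by (rule inside_until_measurable) measurable
  show "(\<lambda>w. if inside_until V q w then ereal q else 0) \<in> borel_measurable (Pi\<^sub>M rat_times (\<lambda>_. borel))"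
    by measurable
qed

lemma rational_exit_point_measurable [measurable]:
  fixes V :: "'e::{banach, second_countable_topology} set"
  shows "rational_exit_point V \<in> Pi\<^sub>M rat_times (\<lambda>_. borel) \<rightarrow>\<^sub>M borel"
  unfolding rational_exit_point_def
proof (rule borel_measurable_lim_metric)
  fix n :: nat
  show "(\<lambda>w. w (real (nat \<lfloor>2 ^ n * real_of_ereal (rational_exit_time V w)\<rfloor>) / 2 ^ n))
      \<in> Pi\<^sub>M rat_times (\<lambda>_. borel) \<rightarrow>\<^sub>M borel"
  \<comment> \<open>The random evaluation time takes countably many values, indexed by
    \<open>k\<close>.\<close>
  proof (rule measurable_compose_countable[where f="\<lambda>k w. w (real k / 2 ^ n)"])
    fix k :: nat
    have "real k / 2 ^ n \<in> rat_times" by (auto simp: rat_times_def)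
    then show "(\<lambda>w. w (real k / 2 ^ n)) \<in> Pi\<^sub>M rat_times (\<lambda>_. borel) \<rightarrow>\<^sub>M borel"
      by measurable
  qed measurable
qed

lemma rational_exit_value_measurable [measurable]:
  fixes V :: "'e::{banach, second_countable_topology} set"
  assumes [measurable]: "g \<in> borel_measurable borel"
  shows "rational_exit_value V g \<in> borel_measurable (Pi\<^sub>M rat_times (\<lambda>_. borel))"
  unfolding rational_exit_value_def by measurable

context open_set_path
begin

lemma inside_until_iff:
  assumes q: "q \<in> rat_times"
  shows "inside_until V q w \<longleftrightarrow> ereal q < exit_time V w"
proof -
  have q0: "0 \<le> q" using q by (auto simp: rat_times_def)
  show ?thesis unfolding less_exit_time_iff[OF q0]
  proof
    assume "inside_until V q w"
    then obtain n :: nat where n: "\<And>q'. q' \<in> rat_times \<Longrightarrow> q' \<le> q \<Longrightarrow> ball (w q') (inverse (Suc n)) \<subseteq> V"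
      by (auto simp: inside_until_def)
    show "\<forall>s\<in>{0..q}. w s \<in> V"
    proof
      fix s assume s: "s \<in> {0..q}"
      show "w s \<in> V"
      proof (cases "s = q")
        case True
        then show ?thesis using n[OF q] centre_in_ball[of "w q" "inverse (real (Suc n))"] by auto
      next
        case False
        then have "s < q" using s by simp
        have "(w \<longlongrightarrow> w s) (at s within {0..})" using cont s by (auto simp: continuous_on_def)
        then have "\<forall>\<^sub>F t in at s within {0..}. dist (w t) (w s) < inverse (real (Suc n))"
          by (intro tendstoD) auto
        then obtain d where d: "0 < d" "\<And>t. 0 \<le> t \<Longrightarrow> t \<noteq> s \<Longrightarrow> dist t s < d \<Longrightarrow> dist (w t) (w s) < inverse (real (Suc n))"
          by (auto simp: eventually_at)
        \<comment> \<open>At a rational time just after \<open>s\<close> the path is within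
          \<open>inverse (Suc n)\<close> of \<open>w s\<close>, so the ball around that position
          contains \<open>w s\<close>.\<close>
        obtain r where r: "r \<in> \<rat>" "s < r" "r < min q (s + d)"
          using Rats_dense_in_real[of s "min q (s + d)"] \<open>s < q\<close> d(1) by auto
        then have "r \<in> rat_times" "r \<le> q" using s by (auto simp: rat_times_def)
        moreover have "dist (w r) (w s) < inverse (real (Suc n))"
          using d(2)[of r] r s by (auto simp: dist_real_def)
        ultimately show ?thesis using n[of r] by auto
      qed
    qed
  next
    assume *: "\<forall>s\<in>{0..q}. w s \<in> V"
    have "compact (w ` {0..q})"
      by (rule compact_continuous_image[OF continuous_on_subset[OF cont]]) auto
    then obtain e where e: "e > 0" "(\<Union>x\<in>w ` {0..q}. ball x e) \<subseteq> V"
      using compact_subset_open_imp_ball_epsilon_subset[of "w ` {0..q}" V] opn * by blast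
    obtain n where "inverse (real (Suc n)) < e" using reals_Archimedean[OF e(1)] by auto
    then show "inside_until V q w"
      unfolding inside_until_def rat_times_def using e(2) by (intro exI[of _ n]) fastforce
  qed
qed

lemma rational_exit_time_restrict: "rational_exit_time V (restrict w rat_times) = exit_time V w"
proof -
  have "inside_until V q (restrict w rat_times) = inside_until V q w" for q
    by (simp add: inside_until_def cong: ball_cong)
  then have eq: "rational_exit_time V (restrict w rat_times)
      = (SUP q\<in>rat_times. if ereal q < exit_time V w then ereal q else 0)"
    unfolding rational_exit_time_def by (intro SUP_cong refl) (simp add: inside_until_iff)
  show ?thesis unfolding eq
  proof (rule antisym)
    show "(SUP q\<in>rat_times. if ereal q < exit_time V w then ereal q else 0) \<le> exit_time V w"
      using exit_time_nonneg[of V w] by (intro SUP_least) auto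
    show "exit_time V w \<le> (SUP q\<in>rat_times. if ereal q < exit_time V w then ereal q else 0)" (is "_ \<le> ?S")
    proof (rule dense_le)
      fix c assume c: "c < exit_time V w"
      have "0 \<in> rat_times" by (auto simp: rat_times_def)
      then have "0 \<le> ?S" by (intro SUP_upper2[of 0]) (auto simp: zero_ereal_def)
      show "c \<le> ?S"
      proof (cases "c < 0")
        case False
        then obtain r where r: "c = ereal r" "0 \<le> r" using c by (cases c) auto
        obtain z where z: "c < ereal z" "ereal z < exit_time V w" using ereal_dense2[OF c] by auto
        obtain q where q: "q \<in> \<rat>" "r < q" "q < z" using Rats_dense_in_real[of r z] z r by auto
        have "ereal q < exit_time V w" using q z by (meson less_ereal.simps(1) less_trans)
        moreover have "q \<in> rat_times" using q r by (auto simp: rat_times_def)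
        ultimately have "ereal q \<le> ?S" by (intro SUP_upper2[of q]) auto
        then show ?thesis using q r by (meson ereal_less_eq(3) less_imp_le order_trans)
      qed (use \<open>0 \<le> ?S\<close> in auto)
    qed
  qed
qed

lemma rational_exit_point_restrict:
  assumes fin: "exit_time V w < \<infinity>"
  shows "rational_exit_point V (restrict w rat_times) = w \<tau>"
proof -
  note \<tau> = exit_time_real[OF fin]
  define X where "X n = real (nat \<lfloor>2 ^ n * \<tau>\<rfloor>) / 2 ^ n" for n
  have mem: "X n \<in> rat_times" for n by (auto simp: X_def rat_times_def)
  have X: "\<tau> - (1/2) ^ n \<le> X n" "X n \<le> \<tau>" for n
  proof -
    have "0 \<le> 2 ^ n * \<tau>" using \<tau> by simp
    then have "real (nat \<lfloor>2 ^ n * \<tau>\<rfloor>) = real_of_int \<lfloor>2 ^ n * \<tau>\<rfloor>" by simp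
    then have "2 ^ n * \<tau> - 1 \<le> real (nat \<lfloor>2 ^ n * \<tau>\<rfloor>)" "real (nat \<lfloor>2 ^ n * \<tau>\<rfloor>) \<le> 2 ^ n * \<tau>"
      by linarith+
    from divide_right_mono[OF this(1), of "2 ^ n"] divide_right_mono[OF this(2), of "2 ^ n"]
    show "\<tau> - (1/2) ^ n \<le> X n" "X n \<le> \<tau>"
      unfolding X_def by (simp_all add: diff_divide_distrib power_one_over)
  qed
  have "(\<lambda>n. \<tau> - (1/2) ^ n) \<longlonglongrightarrow> \<tau> - 0"
    by (intro tendsto_diff tendsto_const LIMSEQ_power_zero) auto
  then have "X \<longlonglongrightarrow> \<tau>"
    using X by (intro tendsto_sandwich[of "\<lambda>n. \<tau> - (1/2) ^ n" X sequentially "\<lambda>_. \<tau>"]) auto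
  then have "(\<lambda>n. w (X n)) \<longlonglongrightarrow> w \<tau>"
    using mem \<tau> by (intro continuous_on_tendsto_compose[OF cont]) (auto simp: rat_times_def)
  then have "lim (\<lambda>n. w (X n)) = w \<tau>" by (rule limI)
  then show ?thesis
    unfolding rational_exit_point_def rational_exit_time_restrict \<tau>_def[symmetric] X_def[symmetric] using mem by simp
qed

lemma rational_exit_value_restrict:
  "rational_exit_value V g (restrict w rat_times) = exit_value V g w"
  by (simp add: rational_exit_value_def exit_value_def rational_exit_time_restrict rational_exit_point_restrict \<tau>_def)

end

text \<open>A path that penetrates the interior of the complement immediately after leaving \<open>V\<close> is a
  continuity point of the exit time and of the exit point under uniform perturbations.\<close>

definition penetrates :: "'e::topological_space set \<Rightarrow> (real \<Rightarrow> 'e) \<Rightarrow> bool" where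
  "penetrates V w \<longleftrightarrow> (\<forall>c. exit_time V w < ereal c \<longrightarrow>
    (\<exists>t\<ge>0. t < c \<and> w t \<in> interior (- V)))"

text \<open>Openness of \<open>V\<close> and compactness of path segments before the exit keep the
  perturbed exit times from being much earlier. Penetration keeps them from being much later: just
  after the exit the path visits an open set in \<open>- V\<close>, and a small perturbation does
  not leave it. The exit points follow by continuity.\<close>

lemma penetrating_exit_continuous:
  fixes V :: "'e::real_normed_vector set"
  assumes opn: "open V" and cont: "continuous_on {0..} w" and pen: "penetrates V w"
    and fin: "exit_time V w < \<infinity>" and a: "a \<longlonglongrightarrow> 0"
  defines "v \<equiv> \<lambda>n t. w t + a n"
  shows "\<forall>\<^sub>F n in sequentially. exit_time V (v n) < \<infinity>"
    and "(\<lambda>n. v n (real_of_ereal (exit_time V (v n)))) \<longlonglongrightarrow> w (real_of_ereal (exit_time V w))"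
proof -
  interpret w: open_set_path V w by standard fact+
  have contv: "continuous_on {0..} (v n)" for n unfolding v_def by (intro continuous_intros cont)
  interpret v: open_set_path V "v n" for n by standard (fact opn, fact contv)
  note \<tau> = w.exit_time_real[OF fin]
  have upper: "\<forall>\<^sub>F n in sequentially. exit_time V (v n) < ereal c" if c: "w.\<tau> < c" for c
  proof -
    obtain t where t: "0 \<le> t" "t < c" "w t \<in> interior (- V)"
      using pen c \<tau> unfolding penetrates_def by (metis less_ereal.simps(1))
    have "(\<lambda>n. v n t) \<longlonglongrightarrow> w t + 0" unfolding v_def by (intro tendsto_intros a)
    then have "\<forall>\<^sub>F n in sequentially. v n t \<in> interior (- V)"
      using t(3) by (intro topological_tendstoD) auto
    then show ?thesis
    proof eventually_elim
      case (elim n)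
      then have "v n t \<notin> V" using interior_subset by blast
      then have "exit_time V (v n) \<le> ereal t" using t by (intro exit_time_le)
      also have "\<dots> < ereal c" using t by simp
      finally show ?case .
    qed
  qed
  have lower: "\<forall>\<^sub>F n in sequentially. ereal c < exit_time V (v n)" if c: "c < w.\<tau>" for c
  proof (cases "0 \<le> c")
    case True
    have "\<forall>s\<in>{0..c}. w s \<in> V" using w.less_exit_time_iff[OF True] c \<tau> by (metis less_ereal.simps(1))
    moreover have "compact (w ` {0..c})"
      by (rule compact_continuous_image[OF continuous_on_subset[OF cont]]) auto
    ultimately obtain e where e: "e > 0" "(\<Union>x\<in>w ` {0..c}. ball x e) \<subseteq> V"
      using compact_subset_open_imp_ball_epsilon_subset[of "w ` {0..c}" V] opn by blast
    have "\<forall>\<^sub>F n in sequentially. norm (a n) < e"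
      using tendstoD[OF a e(1)] by (simp add: dist_norm)
    then show ?thesis
    proof eventually_elim
      case (elim n)
      have "v n s \<in> V" if "s \<in> {0..c}" for s
      proof -
        have "v n s \<in> ball (w s) e" using elim by (simp add: v_def dist_norm)
        then show ?thesis using e(2) that by blast
      qed
      then show ?case using v.less_exit_time_iff[OF True] by blast
    qed
  next
    case False
    then have "ereal c < 0" by simp
    then have "ereal c < exit_time V (v n)" for n
      using exit_time_nonneg[of V "v n"] by (rule less_le_trans)
    then show ?thesis by simp
  qed
  show ev: "\<forall>\<^sub>F n in sequentially. exit_time V (v n) < \<infinity>"
    using upper[of "w.\<tau> + 1"] by (auto elim!: eventually_mono)
  define T where "T n = real_of_ereal (exit_time V (v n))" for n
  have T: "exit_time V (v n) = ereal (T n)" if "exit_time V (v n) < \<infinity>" for n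
    using v.exit_time_real[OF that] unfolding T_def v.\<tau>_def by simp
  have "T \<longlonglongrightarrow> w.\<tau>"
  proof (rule order_tendstoI)
    fix c assume "c < w.\<tau>"
    from lower[OF this] ev show "\<forall>\<^sub>F n in sequentially. c < T n"
      by eventually_elim (simp add: T)
  next
    fix c assume "w.\<tau> < c"
    from upper[OF this] ev show "\<forall>\<^sub>F n in sequentially. T n < c"
      by eventually_elim (simp add: T)
  qed
  moreover have "T n \<ge> 0" for n unfolding T_def using exit_time_nonneg[of V "v n"] by (intro real_of_ereal_pos)
  ultimately have "(\<lambda>n. w (T n)) \<longlonglongrightarrow> w w.\<tau>"
    using \<tau> by (intro continuous_on_tendsto_compose[OF cont]) auto
  then have "(\<lambda>n. w (T n) + a n) \<longlonglongrightarrow> w w.\<tau> + 0" by (intro tendsto_add a)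
  then show "(\<lambda>n. v n (real_of_ereal (exit_time V (v n)))) \<longlonglongrightarrow> w (real_of_ereal (exit_time V w))"
    by (simp add: v_def T_def w.\<tau>_def)
qed

text \<open>A path that never exits has value 0, below any liminf, so the inequality holds for it as
  well.\<close>

lemma exit_value_lsc:
  fixes V :: "'e::real_normed_vector set"
  assumes opn: "open V" and cont: "continuous_on {0..} w" and pen: "penetrates V w"
    and a: "a \<longlonglongrightarrow> 0" and g: "seq_lsc g"
  shows "exit_value V g w \<le> liminf (\<lambda>n. exit_value V g (\<lambda>t. w t + a n))"
proof (cases "exit_time V w < \<infinity>")
  case True
  note c = penetrating_exit_continuous[OF opn cont pen True a]
  have "exit_value V g w \<le> liminf (\<lambda>n. g (w (real_of_ereal (exit_time V (\<lambda>t. w t + a n))) + a n))"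
    unfolding exit_value_def using True seq_lscD[OF g c(2)] by simp
  also have "\<dots> = liminf (\<lambda>n. exit_value V g (\<lambda>t. w t + a n))"
    using c(1) by (intro Liminf_eq) (auto elim!: eventually_mono simp: exit_value_def)
  finally show ?thesis .
qed (simp add: exit_value_def)

text \<open>Continuity is claimed for paths that do exit: a path approaching the boundary without
  reaching it has value 0, while arbitrarily small perturbations of it may exit.\<close>

lemma exit_value_continuous:
  fixes V :: "'e::real_normed_vector set"
  assumes opn: "open V" and cont: "continuous_on {0..} w" and pen: "penetrates V w"
    and fin: "exit_time V w < \<infinity>" and a: "a \<longlonglongrightarrow> 0" and g: "continuous_on UNIV g"
  shows "(\<lambda>n. exit_value V g (\<lambda>t. w t + a n)) \<longlonglongrightarrow> exit_value V g w"
proof -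
  note c = penetrating_exit_continuous[OF opn cont pen fin a]
  have "(\<lambda>n. g (w (real_of_ereal (exit_time V (\<lambda>t. w t + a n))) + a n)) \<longlonglongrightarrow> exit_value V g w"
    unfolding exit_value_def using fin continuous_on_tendsto_compose[OF g c(2)] by simp
  then show ?thesis
    by (rule Lim_transform_eventually) (use c(1) in \<open>auto elim!: eventually_mono simp: exit_value_def\<close>)
qed


section \<open>Penetration of the complement\<close>

text \<open>Numbers the dyadic interval, open on the left and closed on the right, that contains
  \<open>T\<close>; the first one also takes \<open>T = 0\<close>.\<close>

definition exit_stage :: "real \<Rightarrow> nat \<Rightarrow> nat \<Rightarrow> bool" where
  "exit_stage T n j \<longleftrightarrow> (j = 0 \<or> real j / 2 ^ n < T) \<and> T \<le> real (j + 1) / 2 ^ n"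

lemma exit_stage_exists:
  assumes "0 \<le> T"
  obtains j where "exit_stage T n j"
proof
  \<comment> \<open>Subtraction on \<open>nat\<close> is truncated, so \<open>T = 0\<close> gives
    the index 0.\<close>
  let ?j = "nat \<lceil>2 ^ n * T\<rceil> - 1"
  have "0 \<le> 2 ^ n * T" using assms by simp
  then have "2 ^ n * T \<le> real (nat \<lceil>2 ^ n * T\<rceil>)" by linarith
  then have "2 ^ n * T \<le> real (?j + 1)" by linarith
  moreover have "?j = 0 \<or> real ?j < 2 ^ n * T"
  proof (rule disjCI)
    assume "\<not> real ?j < 2 ^ n * T"
    then show "?j = 0" using \<open>0 \<le> 2 ^ n * T\<close> by linarith
  qed
  ultimately show "exit_stage T n ?j" unfolding exit_stage_def by (auto simp: field_simps)
qed

lemma exit_stage_bounds: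
  assumes "0 \<le> T" "exit_stage T n j"
  shows "T < real (j + 2) / 2 ^ n" "real (j + 2) / 2 ^ n \<le> T + 2 * (1/2) ^ n"
proof -
  have "T \<le> real (j + 1) / 2 ^ n" using assms by (simp add: exit_stage_def)
  also have "\<dots> < real (j + 2) / 2 ^ n" by (intro divide_strict_right_mono) auto
  finally show "T < real (j + 2) / 2 ^ n" .
  have "real j / 2 ^ n \<le> T" using assms by (auto simp: exit_stage_def)
  then show "real (j + 2) / 2 ^ n \<le> T + 2 * (1/2) ^ n"
    by (simp add: add_divide_distrib power_one_over)
qed

context brownian_motion
begin

lemma translated_path_continuous: "\<omega> \<in> space \<F> \<Longrightarrow> continuous_on {0..} (\<lambda>t. x + W t \<omega>)"
  by (intro continuous_intros continuous_paths)

lemma inside_until_in_filtration: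
  assumes "0 \<le> t" "q \<le> t"
  shows "{\<omega>\<in>space \<F>. inside_until V q (\<lambda>u. x + W u \<omega>)} \<in> sets (F t)"
proof -
  have "Measurable.pred (F t) (\<lambda>\<omega>. inside_until V q (\<lambda>u. x + W u \<omega>))"
  proof (rule inside_until_measurable)
    fix q' assume "q' \<in> rat_times" "q' \<le> q"
    then have [measurable]: "W q' \<in> F t \<rightarrow>\<^sub>M borel"
      using assms by (intro adapted_le) (auto simp: rat_times_def)
    show "(\<lambda>\<omega>. x + W q' \<omega>) \<in> F t \<rightarrow>\<^sub>M borel" by measurable
  qed
  then show ?thesis by (simp add: pred_def space_F[OF assms(1)])
qed

abbreviation "alive V t \<equiv> {\<omega>\<in>space \<F>. ereal t < exit_time V (\<lambda>s. W s \<omega>)}"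

text \<open>Being alive at \<open>t\<close> is read off rational times \<open>q\<close> slightly
  larger than \<open>t\<close>, hence in \<open>F s\<close> for every \<open>s > t\<close>;
  right-continuity of the filtration brings it back to \<open>F t\<close>.\<close>

lemma killed_in_filtration:
  assumes V: "open V" and t: "0 \<le> t"
  shows "alive V t \<in> sets (F t)"
  unfolding F_right_continuous[OF t]
proof
  fix s assume "s \<in> {t<..}"
  then have s: "t < s" by simp
  have "ereal t < exit_time V (\<lambda>s. W s \<omega>)
      \<longleftrightarrow> (\<exists>q\<in>rat_times \<inter> {t<..s}. inside_until V q (\<lambda>u. 0 + W u \<omega>))" if \<omega>: "\<omega> \<in> space \<F>" for \<omega>
  proof -
    interpret open_set_path V "\<lambda>s. W s \<omega>" using V continuous_paths[OF \<omega>] by unfold_locales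
    show ?thesis
    proof
      assume lt: "ereal t < exit_time V (\<lambda>s. W s \<omega>)"
      then obtain z where z: "ereal t < ereal z" "ereal z < exit_time V (\<lambda>s. W s \<omega>)"
        using ereal_dense2 by blast
      obtain q where q: "q \<in> \<rat>" "t < q" "q < min z s" using Rats_dense_in_real[of t "min z s"] z(1) s by auto
      then have "ereal q < exit_time V (\<lambda>s. W s \<omega>)" using z(2) by (meson less_ereal.simps(1) less_trans min_less_iff_conj)
      moreover have "q \<in> rat_times" using q t by (simp add: rat_times_def)
      ultimately show "\<exists>q\<in>rat_times \<inter> {t<..s}. inside_until V q (\<lambda>u. 0 + W u \<omega>)"
        using q by (intro bexI[of _ q]) (auto simp: inside_until_iff)
    next
      assume "\<exists>q\<in>rat_times \<inter> {t<..s}. inside_until V q (\<lambda>u. 0 + W u \<omega>)"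
      then obtain q where "t < q" "ereal q < exit_time V (\<lambda>s. W s \<omega>)" by (auto simp: inside_until_iff)
      then show "ereal t < exit_time V (\<lambda>s. W s \<omega>)" by (metis less_ereal.simps(1) less_trans)
    qed
  qed
  then have "alive V t
      = (\<Union>q\<in>rat_times \<inter> {t<..s}. {\<omega>\<in>space \<F>. inside_until V q (\<lambda>u. 0 + W u \<omega>)})"
    by auto
  also have "\<dots> \<in> sets (F s)"
    using s t countable_rat_times
    by (intro sets.countable_UN' image_subsetI inside_until_in_filtration) auto
  finally show "alive V t \<in> sets (F s)" .
qed

text \<open>Fatou's lemma for translated indicators. It carries the cone bound at the exit point
  over to dyadic times near the exit.\<close>

lemma kernel_lsc:
  assumes "open U"
  shows "seq_lsc (\<lambda>y. emeasure (N s y) U)"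
  unfolding seq_lsc_def
proof (intro allI impI)
  fix X and y :: 'e assume X: "X \<longlonglongrightarrow> y"
  have [measurable]: "U \<in> sets borel" using assms by simp
  have eq: "emeasure (N s y) U = (\<integral>\<^sup>+z. 1 * indicator U (y + sqrt s *\<^sub>R z) \<partial>\<mu>)" for y
  proof -
    have "{z. y + sqrt s *\<^sub>R z \<in> U} \<in> sets borel" by measurable
    then have "emeasure (N s y) U = (\<integral>\<^sup>+z. indicator {z. y + sqrt s *\<^sub>R z \<in> U} z \<partial>\<mu>)"
      using sets_wiener by (subst nn_integral_indicator) (simp_all add: emeasure_kernel)
    also have "\<dots> = (\<integral>\<^sup>+z. 1 * indicator U (y + sqrt s *\<^sub>R z) \<partial>\<mu>)"
      by (intro nn_integral_cong) (simp add: indicator_def)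
    finally show ?thesis .
  qed
  have "(\<integral>\<^sup>+z. 1 * indicator U (y + sqrt s *\<^sub>R z) \<partial>\<mu>)
      \<le> (\<integral>\<^sup>+z. liminf (\<lambda>n. 1 * indicator U (X n + sqrt s *\<^sub>R z)) \<partial>\<mu>)"
    using assms by (intro nn_integral_mono seq_lscD[OF seq_lsc_indicator] tendsto_intros X)
  also have "\<dots> \<le> liminf (\<lambda>n. \<integral>\<^sup>+z. 1 * indicator U (X n + sqrt s *\<^sub>R z) \<partial>\<mu>)"
    by (intro nn_integral_liminf) measurable
  finally show "emeasure (N s y) U \<le> liminf (\<lambda>n. emeasure (N s (X n)) U)"
    unfolding eq .
qed

lemma markov_translated:
  assumes "0 \<le> s" "0 \<le> t" "D \<in> sets (F t)" "A \<in> sets borel"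
  shows "emeasure R (D \<inter> {\<omega>\<in>space \<F>. x + W (t + s) \<omega> \<in> A})
    = (\<integral>\<^sup>+\<omega>. emeasure (N s (x + W t \<omega>)) A * indicator D \<omega> \<partial>R)"
proof -
  have [measurable]: "A \<in> sets borel" by fact
  have m: "{z. x + z \<in> A} \<in> sets borel" by measurable
  have "emeasure (N s (x + y)) A = emeasure (N s y) {z. x + z \<in> A}" for y
    using kernel_translate[of s y x] by (simp add: add.commute emeasure_distr vimage_def)
  then show ?thesis using markov_emeasure[OF assms(1-3) m, of 0] by simp
qed

text \<open>Strong Markov argument along dyadic times decreasing to the exit time: the probability of
  hitting the interior of the complement shortly after leaving \<open>V\<close>, but not at once, tends to zero,
  whereas conditionally on a delay it would stay bounded below by the cone condition.\<close>

theorem AE_penetrates: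
  assumes V: "strongly_regular V" and x: "x \<in> closure V"
  shows "AE \<omega> in R. penetrates V (\<lambda>t. x + W t \<omega>)"
proof -
  have opnV: "open V" using V by (simp add: strongly_regular_def)
  define U where "U = interior (- V)"
  have opnU: "open U" by (simp add: U_def)
  then have [measurable]: "U \<in> sets borel" by simp
  define w where "w \<omega> t = x + W t \<omega>" for \<omega> t
  have contw: "continuous_on {0..} (w \<omega>)" if "\<omega> \<in> space \<F>" for \<omega>
    unfolding w_def by (rule translated_path_continuous[OF that])
  have path: "open_set_path V (w \<omega>)" if "\<omega> \<in> space \<F>" for \<omega>
    by standard (use opnV contw[OF that] in auto)
  define T where "T \<omega> = rational_exit_time V (restrict (w \<omega>) rat_times)" for \<omega>
  have T_eq: "T \<omega> = exit_time V (w \<omega>)" if "\<omega> \<in> space \<F>" for \<omega>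
    unfolding T_def by (rule open_set_path.rational_exit_time_restrict[OF path[OF that]])
  have T_nonneg: "0 \<le> T \<omega>" if "\<omega> \<in> space \<F>" for \<omega>
    by (simp add: T_eq[OF that] exit_time_nonneg)
  \<comment> \<open>The entrance time into \<open>U\<close>; rational times suffice because
    \<open>U\<close> is open and the paths are continuous.\<close>
  define T' where "T' \<omega> = (INF q\<in>rat_times. if w \<omega> q \<in> U then ereal q else \<infinity>)" for \<omega>
  have w_meas [measurable]: "(\<lambda>\<omega>. w \<omega> q) \<in> \<F> \<rightarrow>\<^sub>M borel" if "0 \<le> q" for q
    unfolding w_def using W_measurable[OF that] by measurable
  have [measurable]: "T \<in> borel_measurable \<F>"
  proof -
    have "(\<lambda>\<omega>. restrict (w \<omega>) rat_times) \<in> \<F> \<rightarrow>\<^sub>M path_space rat_times"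
      using rat_times_nonneg by (intro measurable_restrict w_meas) auto
    from measurable_compose[OF this rational_exit_time_measurable] show ?thesis unfolding T_def .
  qed
  have [measurable]: "T' \<in> borel_measurable \<F>"
    unfolding T'_def
  proof (intro borel_measurable_INF countable_rat_times)
    fix q assume "q \<in> rat_times"
    then have [measurable]: "(\<lambda>\<omega>. w \<omega> q) \<in> \<F> \<rightarrow>\<^sub>M borel" by (intro w_meas) (auto simp: rat_times_def)
    show "(\<lambda>\<omega>. if w \<omega> q \<in> U then ereal q else \<infinity>) \<in> borel_measurable \<F>" by measurable
  qed
  have T'_le: "T' \<omega> \<le> ereal t" if "\<omega> \<in> space \<F>" "0 \<le> t" "w \<omega> t \<in> U" for \<omega> t
  proof (rule ereal_le_epsilon2)
    fix e :: real assume "0 < e"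
    have "(w \<omega> \<longlongrightarrow> w \<omega> t) (at t within {0..})"
      using contw[OF that(1)] that(2) by (auto simp: continuous_on_def)
    then have "\<forall>\<^sub>F u in at t within {0..}. w \<omega> u \<in> U"
      using opnU that(3) by (intro topological_tendstoD)
    then obtain d where d: "0 < d" "\<And>u. 0 \<le> u \<Longrightarrow> u \<noteq> t \<Longrightarrow> dist u t < d \<Longrightarrow> w \<omega> u \<in> U"
      by (auto simp: eventually_at)
    obtain q where q: "q \<in> \<rat>" "t < q" "q < t + min d e"
      using Rats_dense_in_real[of t "t + min d e"] d(1) \<open>0 < e\<close> by auto
    have "w \<omega> q \<in> U" using q that(2) by (intro d) (auto simp: dist_real_def)
    moreover have "q \<in> rat_times" using q that(2) by (auto simp: rat_times_def)
    ultimately have "T' \<omega> \<le> ereal q" unfolding T'_def by (intro INF_lower2[of q]) auto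
    also have "\<dots> \<le> ereal t + ereal e" using q by simp
    finally show "T' \<omega> \<le> ereal t + ereal e" .
  qed
  have T'_ge: "ereal t \<le> T' \<omega>" if "\<forall>q\<in>rat_times. q \<le> t \<longrightarrow> w \<omega> q \<notin> U" for \<omega> t
    unfolding T'_def using that by (intro INF_greatest) (auto simp: not_le[symmetric] intro: less_imp_le)
  \<comment> \<open>Delayed entrance into \<open>U\<close>: later than the exit, but by at most
    \<open>e\<close>. The strict inequality makes these sets decrease to the empty set.\<close>
  define A where "A e = {\<omega>\<in>space \<F>. T \<omega> < T' \<omega> \<and> T' \<omega> \<le> T \<omega> + ereal e}" for e :: real
  have A_meas [measurable, simp]: "A e \<in> sets \<F>" for e
    unfolding A_def by simp
  have A_mono: "A e \<subseteq> A e'" if "e \<le> e'" for e e'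
  proof -
    have "T \<omega> + ereal e \<le> T \<omega> + ereal e'" for \<omega> using that by (intro add_left_mono) simp
    then show ?thesis unfolding A_def by (blast intro: order_trans)
  qed
  have A_lim: "(\<lambda>k. emeasure R (A (2 / real (Suc k)))) \<longlonglongrightarrow> 0"
  proof -
    have "(\<lambda>k. emeasure R (A (2 / real (Suc k)))) \<longlonglongrightarrow> emeasure R (\<Inter>k. A (2 / real (Suc k)))"
    proof (intro Lim_emeasure_decseq)
      show "decseq (\<lambda>k. A (2 / real (Suc k)))"
        unfolding decseq_def by (intro allI impI A_mono) (simp add: frac_le)
    qed auto
    also have "(\<Inter>k. A (2 / real (Suc k))) = {}"
    proof (rule ccontr)
      assume "\<not> ?thesis"
      then obtain \<omega> where "\<omega> \<in> (\<Inter>k. A (2 / real (Suc k)))" by blast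
      then have \<omega>: "\<omega> \<in> A (2 / real (Suc k))" for k by blast
      then have lt: "\<omega> \<in> space \<F>" "T \<omega> < T' \<omega>" and le: "\<And>k. T' \<omega> \<le> T \<omega> + ereal (2 / real (Suc k))"
        by (auto simp: A_def)
      obtain a where a: "T \<omega> = ereal a" using lt(2) T_nonneg[OF lt(1)] by (cases "T \<omega>") auto
      obtain b where b: "T' \<omega> = ereal b" using lt le[of 0] a by (cases "T' \<omega>") auto
      have ab: "a < b" "\<And>k. b \<le> a + 2 / real (Suc k)" using lt le a b by auto
      have "\<exists>k. inverse (real (Suc k)) < (b - a) / 2" using ab(1) by (intro reals_Archimedean) simp
      then obtain k where k: "inverse (real (Suc k)) < (b - a) / 2" ..
      define i where "i = inverse (real (Suc k))"
      have "i < (b - a) / 2" using k unfolding i_def .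
      moreover have "b \<le> a + 2 * i" using ab(2)[of k] unfolding i_def divide_inverse .
      ultimately have "2 * i < b - a" "b - a \<le> 2 * i" by (simp_all only: less_divide_eq_numeral1 mult.commute[of i 2] diff_le_eq add.commute)
      then show False by (meson not_less)
    qed
    finally show ?thesis by simp
  qed
  \<comment> \<open>Two steps ahead: the exit may happen exactly at \<open>(j + 1) / 2^n\<close>,
    and avoiding \<open>U\<close> up to \<open>t n j\<close> has to delay the entrance
    strictly.\<close>
  define t where "t n j = real (j + 2) / 2 ^ n" for n j :: nat
  have t0: "0 \<le> t n j" for n j by (simp add: t_def)
  \<comment> \<open>Exit during the dyadic interval number \<open>j\<close>, with \<open>U\<close>
    avoided up to \<open>t n j\<close>; phrased by rational times so as to lie in
    \<open>F (t n j)\<close>.\<close>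
  define Q where "Q n j = {\<omega>\<in>space \<F>. (j = 0 \<or> inside_until V (real j / 2 ^ n) (w \<omega>))
      \<and> \<not> inside_until V (real (j + 1) / 2 ^ n) (w \<omega>)
      \<and> (\<forall>q\<in>rat_times. q \<le> t n j \<longrightarrow> w \<omega> q \<notin> U)}" for n j :: nat
  have Q_F: "Q n j \<in> sets (F (t n j))" for n j
  proof -
    have 1: "{\<omega>\<in>space \<F>. inside_until V (real j / 2 ^ n) (w \<omega>)} \<in> sets (F (t n j))"
      "{\<omega>\<in>space \<F>. inside_until V (real (j + 1) / 2 ^ n) (w \<omega>)} \<in> sets (F (t n j))"
      unfolding w_def t_def by (intro inside_until_in_filtration; simp add: divide_right_mono)+
    have 2: "{\<omega>\<in>space (F (t n j)). \<forall>q\<in>rat_times. q \<le> t n j \<longrightarrow> w \<omega> q \<notin> U} \<in> sets (F (t n j))"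
    proof (rule sets.sets_Collect_countable_All'[OF _ countable_rat_times])
      fix q assume "q \<in> rat_times"
      then have "W q \<in> F (t n j) \<rightarrow>\<^sub>M borel" if "q \<le> t n j"
        using that by (intro adapted_le) (auto simp: rat_times_def)
      then show "{\<omega>\<in>space (F (t n j)). q \<le> t n j \<longrightarrow> w \<omega> q \<notin> U} \<in> sets (F (t n j))"
        unfolding w_def by (cases "q \<le> t n j") (simp_all, measurable)
    qed
    have "Q n j = (if j = 0 then space \<F> else {\<omega>\<in>space \<F>. inside_until V (real j / 2 ^ n) (w \<omega>)})
        \<inter> (space \<F> - {\<omega>\<in>space \<F>. inside_until V (real (j + 1) / 2 ^ n) (w \<omega>)})
        \<inter> {\<omega>\<in>space (F (t n j)). \<forall>q\<in>rat_times. q \<le> t n j \<longrightarrow> w \<omega> q \<notin> U}"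
      unfolding Q_def space_F[OF t0] by auto
    then show ?thesis using 1 2 space_F_in[OF t0, of n j] by auto
  qed
  have Q_meas [measurable]: "Q n j \<in> sets \<F>" for n j by (rule sets_F_subset[OF t0 Q_F])
  have Q_iff: "\<omega> \<in> Q n j \<longleftrightarrow> T \<omega> < \<infinity> \<and> exit_stage (real_of_ereal (T \<omega>)) n j
      \<and> (\<forall>q\<in>rat_times. q \<le> t n j \<longrightarrow> w \<omega> q \<notin> U)" if \<omega>: "\<omega> \<in> space \<F>" for \<omega> n j
  proof -
    interpret open_set_path V "w \<omega>" by (rule path[OF \<omega>])
    have "real i / 2 ^ n \<in> rat_times" for i by (auto simp: rat_times_def)
    note this[THEN inside_until_iff]
    from this[of j] this[of "j + 1"] show ?thesis
      using T_nonneg[OF \<omega>] \<omega> unfolding Q_def exit_stage_def T_eq[OF \<omega>, symmetric]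
      by (cases "T \<omega>") auto
  qed
  have stage_unique: "i = j" if "exit_stage r n i" "exit_stage r n j" for r n i j
  proof -
    have *: "\<not> i < j" if "exit_stage r n i" "exit_stage r n j" for i j
    proof
      assume "i < j"
      then have "r \<le> real (i + 1) / 2 ^ n" "real j / 2 ^ n < r" using that by (auto simp: exit_stage_def)
      then have "real j / 2 ^ n < real (i + 1) / 2 ^ n" by linarith
      then have "real j < real (i + 1)" by (simp add: divide_less_cancel)
      then show False using \<open>i < j\<close> by simp
    qed
    show ?thesis using *[OF that] *[OF that(2,1)] by simp
  qed
  define \<phi> where "\<phi> s y = emeasure (N s y) U" for s y
  \<comment> \<open>Conditional probability of being in \<open>U\<close> a time \<open>s\<close>
    after the dyadic time that follows the exit, on the event that \<open>U\<close> has been avoided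
    so far. At most one summand is nonzero.\<close>
  define f where "f s n \<omega> = (\<Sum>j. \<phi> s (w \<omega> (t n j)) * indicator (Q n j) \<omega>)" for s n \<omega>
  have f_term [measurable]: "(\<lambda>\<omega>. \<phi> s (w \<omega> (t n j)) * indicator (Q n j) \<omega>) \<in> borel_measurable R" if "0 \<le> s" for s n j
    using measurable_compose[OF w_meas[OF t0] kernel_emeasure_measurable[OF that, of U]]
    unfolding \<phi>_def by simp
  have f_meas [measurable]: "f s n \<in> borel_measurable R" if "0 \<le> s" for s n
    unfolding f_def using f_term[OF that] by (intro borel_measurable_suminf_order)
  have int_f: "(\<integral>\<^sup>+\<omega>. f s n \<omega> \<partial>R) \<le> emeasure R (A (2 * (1/2) ^ n + s))" if s: "0 \<le> s" for s n
  proof -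
    let ?E = "\<lambda>j. Q n j \<inter> {\<omega>\<in>space \<F>. w \<omega> (t n j + s) \<in> U}"
    have E [measurable]: "?E j \<in> sets \<F>" for j using w_meas[of "t n j + s"] t0[of n j] s by simp
    have "(\<integral>\<^sup>+\<omega>. f s n \<omega> \<partial>R) = (\<Sum>j. \<integral>\<^sup>+\<omega>. \<phi> s (w \<omega> (t n j)) * indicator (Q n j) \<omega> \<partial>R)"
      unfolding f_def using f_term[OF s] by (intro nn_integral_suminf)
    also have "\<dots> = (\<Sum>j. emeasure R (?E j))"
      unfolding \<phi>_def w_def by (intro suminf_cong markov_translated[symmetric] s t0 Q_F) simp
    also have "\<dots> = emeasure R (\<Union>j. ?E j)"
    proof (rule suminf_emeasure)
      show "disjoint_family ?E"
        unfolding disjoint_family_on_def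
      proof (intro ballI impI)
        fix i j :: nat assume "i \<noteq> j"
        then have "Q n i \<inter> Q n j = {}" using Q_iff stage_unique sets.sets_into_space[OF Q_meas] by blast
        then show "?E i \<inter> ?E j = {}" by blast
      qed
    qed (use E in auto)
    also have "\<dots> \<le> emeasure R (A (2 * (1/2) ^ n + s))"
    proof (rule emeasure_mono)
      show "(\<Union>j. ?E j) \<subseteq> A (2 * (1/2) ^ n + s)"
      proof safe
        fix \<omega> j assume \<omega>: "\<omega> \<in> Q n j" "\<omega> \<in> space \<F>" "w \<omega> (t n j + s) \<in> U"
        note q = iffD1[OF Q_iff[OF \<omega>(2)] \<omega>(1)]
        obtain r where r: "T \<omega> = ereal r" "0 \<le> r"
          using q T_nonneg[OF \<omega>(2)] by (cases "T \<omega>") auto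
        have b: "r < t n j" "t n j \<le> r + 2 * (1/2) ^ n"
          using exit_stage_bounds[of r n j] q r unfolding t_def by auto
        have "T' \<omega> \<le> ereal (t n j + s)" using t0[of n j] s \<omega> by (intro T'_le) auto
        moreover have "ereal (t n j) \<le> T' \<omega>" using q by (intro T'_ge) auto
        ultimately show "\<omega> \<in> A (2 * (1/2) ^ n + s)"
          unfolding A_def using b r \<omega>(2)
          by (cases "T' \<omega>") auto
      qed
    qed simp
    finally show ?thesis .
  qed
  \<comment> \<open>The dyadic times tend to the exit time first, with the delay \<open>s\<close>
    fixed; only afterwards does \<open>s\<close> tend to 0.\<close>
  define h where "h s \<omega> = liminf (\<lambda>n. f s n \<omega>)" for s \<omega>
  have h_meas [measurable]: "h s \<in> borel_measurable R" if "0 \<le> s" for s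
    unfolding h_def using f_meas[OF that] by measurable
  have int_h: "(\<integral>\<^sup>+\<omega>. h s \<omega> \<partial>R) \<le> emeasure R (A (2 * s))" if s: "0 < s" for s
  proof -
    have "(\<integral>\<^sup>+\<omega>. h s \<omega> \<partial>R) \<le> liminf (\<lambda>n. \<integral>\<^sup>+\<omega>. f s n \<omega> \<partial>R)"
      unfolding h_def using s by (intro nn_integral_liminf f_meas) simp
    also have "\<dots> \<le> liminf (\<lambda>n. emeasure R (A (2 * s)))"
    proof (rule Liminf_mono)
      have "(\<lambda>n. 2 * (1/2) ^ n) \<longlonglongrightarrow> 2 * (0::real)"
        by (intro tendsto_mult tendsto_const LIMSEQ_power_zero) auto
      then have "\<forall>\<^sub>F n in sequentially. 2 * (1/2) ^ n < s" using s by (intro order_tendstoD(2)) auto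
      then show "\<forall>\<^sub>F n in sequentially. (\<integral>\<^sup>+\<omega>. f s n \<omega> \<partial>R) \<le> emeasure R (A (2 * s))"
      proof eventually_elim
        case (elim n)
        then have "emeasure R (A (2 * (1/2) ^ n + s)) \<le> emeasure R (A (2 * s))"
          by (intro emeasure_mono A_mono) auto
        then show ?case using int_f[of s n] s by (auto intro: order_trans)
      qed
    qed
    finally show ?thesis by (simp add: Liminf_const)
  qed
  have "(\<integral>\<^sup>+\<omega>. liminf (\<lambda>k. h (1 / real (Suc k)) \<omega>) \<partial>R) \<le> liminf (\<lambda>k. \<integral>\<^sup>+\<omega>. h (1 / real (Suc k)) \<omega> \<partial>R)"
    by (intro nn_integral_liminf h_meas) simp
  also have "\<dots> \<le> liminf (\<lambda>k. emeasure R (A (2 / real (Suc k))))"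
    using int_h[of "1 / real (Suc k)" for k] by (intro Liminf_mono always_eventually allI) simp
  also have "\<dots> = 0" using A_lim by (intro lim_imp_Liminf) auto
  finally have int0: "(\<integral>\<^sup>+\<omega>. liminf (\<lambda>k. h (1 / real (Suc k)) \<omega>) \<partial>R) = 0" by simp
  have "(\<lambda>\<omega>. liminf (\<lambda>k. h (1 / real (Suc k)) \<omega>)) \<in> borel_measurable R"
    by (intro borel_measurable_liminf h_meas) simp
  from iffD1[OF nn_integral_0_iff_AE[OF this] int0]
  have "AE \<omega> in R. liminf (\<lambda>k. h (1 / real (Suc k)) \<omega>) = 0" .
  then show ?thesis
    using start[of 0] AE_space[of R]
  proof eventually_elim
    case (elim \<omega>)
    then have \<omega>: "\<omega> \<in> space \<F>" by simp
    interpret open_set_path V "w \<omega>" by (rule path[OF \<omega>])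
    show ?case
    proof (rule ccontr)
      assume "\<not> ?thesis"
      then obtain c where c: "exit_time V (w \<omega>) < ereal c" "\<And>u. 0 \<le> u \<Longrightarrow> u < c \<Longrightarrow> w \<omega> u \<notin> U"
        unfolding penetrates_def U_def w_def by blast
      have fin: "exit_time V (w \<omega>) < \<infinity>" using c(1) by (rule less_trans) simp
      note \<tau> = exit_time_real[OF fin]
      have "\<tau> < c" using c(1) \<tau> by (metis less_ereal.simps(1))
      have "w \<omega> 0 \<in> closure V" using elim x by (simp add: w_def)
      from exit_point_frontier[OF fin this]
      obtain t0' p where p: "0 < t0'" "0 < p" "\<And>s. 0 < s \<Longrightarrow> s \<le> t0' \<Longrightarrow> p \<le> \<phi> s (w \<omega> \<tau>)"
        using kernel_charges_complement[OF V] unfolding \<phi>_def U_def by metis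
      define J where "J n = (SOME j. exit_stage \<tau> n j)" for n
      have J: "exit_stage \<tau> n (J n)" for n
        unfolding J_def using exit_stage_exists[of \<tau> n] \<tau> by (metis someI)
      have b: "\<tau> \<le> t n (J n)" "t n (J n) \<le> \<tau> + 2 * (1/2) ^ n" for n
        using exit_stage_bounds[OF _ J, of n] \<tau> unfolding t_def by auto
      have "(\<lambda>n. \<tau> + 2 * (1/2) ^ n) \<longlonglongrightarrow> \<tau> + 2 * 0"
        by (intro tendsto_add tendsto_mult tendsto_const LIMSEQ_power_zero) auto
      then have tlim: "(\<lambda>n. t n (J n)) \<longlonglongrightarrow> \<tau>"
        using b by (intro tendsto_sandwich[of "\<lambda>_. \<tau>" "\<lambda>n. t n (J n)" sequentially "\<lambda>n. \<tau> + 2 * (1/2) ^ n"]) auto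
      then have wlim: "(\<lambda>n. w \<omega> (t n (J n))) \<longlonglongrightarrow> w \<omega> \<tau>"
        using \<tau> t0 by (intro continuous_on_tendsto_compose[OF contw[OF \<omega>]]) auto
      have h_ge: "\<phi> s (w \<omega> \<tau>) \<le> h s \<omega>" for s
      proof -
        have "\<phi> s (w \<omega> \<tau>) \<le> liminf (\<lambda>n. \<phi> s (w \<omega> (t n (J n))))"
          unfolding \<phi>_def by (rule seq_lscD[OF kernel_lsc[OF opnU] wlim])
        also have "\<dots> \<le> h s \<omega>" unfolding h_def
        proof (rule Liminf_mono)
          have "\<forall>\<^sub>F n in sequentially. t n (J n) < c" using tlim \<open>\<tau> < c\<close> by (rule order_tendstoD(2))
          then show "\<forall>\<^sub>F n in sequentially. \<phi> s (w \<omega> (t n (J n))) \<le> f s n \<omega>"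
          proof eventually_elim
            case (elim n)
            \<comment> \<open>This path avoids \<open>U\<close> up to time \<open>c\<close>, so the
              event occurs as soon as the dyadic time falls below \<open>c\<close>.\<close>
            have "\<omega> \<in> Q n (J n)"
              unfolding Q_iff[OF \<omega>] using fin J[of n] c(2) elim
              by (auto simp: T_eq[OF \<omega>] \<tau>_def rat_times_def)
            then have "\<phi> s (w \<omega> (t n (J n))) = (\<Sum>j\<in>{J n}. \<phi> s (w \<omega> (t n j)) * indicator (Q n j) \<omega>)" by simp
            also have "\<dots> \<le> f s n \<omega>" unfolding f_def by (intro sum_le_suminf) auto
            finally show ?case .
          qed
        qed
        finally show ?thesis .
      qed
      have "\<forall>\<^sub>F k in sequentially. inverse (real (Suc k)) < t0'"
        using LIMSEQ_inverse_real_of_nat p(1) by (rule order_tendstoD(2))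
      then have "\<forall>\<^sub>F k in sequentially. p \<le> h (1 / real (Suc k)) \<omega>"
      proof eventually_elim
        case (elim k)
        then have "p \<le> \<phi> (1 / real (Suc k)) (w \<omega> \<tau>)" by (intro p(3)) (auto simp: field_simps)
        then show ?case using h_ge by (rule order_trans)
      qed
      then have "p \<le> liminf (\<lambda>k. h (1 / real (Suc k)) \<omega>)" by (rule Liminf_bounded)
      then show False using elim p(2) by simp
    qed
  qed
qed

end


section \<open>The exit kernel\<close>

lemma exit_value_mono: "(\<And>y. g y \<le> g' y) \<Longrightarrow> exit_value V g w \<le> exit_value V g' w"
  by (simp add: exit_value_def)

lemma exit_value_linear:
  "exit_value V (\<lambda>y. g y + c * g' y) w = exit_value V g w + c * exit_value V g' w"
  by (simp add: exit_value_def)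

context brownian_motion
begin

text \<open>All starting points use the same measure \<open>R\<close>, so varying \<open>x\<close>
  only translates the paths. For open \<open>V\<close> and Borel \<open>g\<close> this is the
  harmonic kernel on \<open>V\<close>; on the frontier it takes the value
  \<open>g x\<close>.\<close>

definition exit_kernel :: "'e set \<Rightarrow> ('e \<Rightarrow> ennreal) \<Rightarrow> 'e \<Rightarrow> ennreal" where
  "exit_kernel V g x = (\<integral>\<^sup>+\<omega>. exit_value V g (\<lambda>t. x + W t \<omega>) \<partial>R)"

abbreviation rational_path :: "'e \<Rightarrow> 'w \<Rightarrow> real \<Rightarrow> 'e" where
  "rational_path x \<omega> \<equiv> \<lambda>u\<in>rat_times. x + W u \<omega>"

lemma open_set_path_translated: "open V \<Longrightarrow> \<omega> \<in> space \<F> \<Longrightarrow> open_set_path V (\<lambda>t. x + W t \<omega>)"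
  by unfold_locales (auto intro: translated_path_continuous)

lemma rational_exit_value_path:
  "open V \<Longrightarrow> \<omega> \<in> space \<F> \<Longrightarrow>
    rational_exit_value V g (rational_path x \<omega>) = exit_value V g (\<lambda>t. x + W t \<omega>)"
  by (rule open_set_path.rational_exit_value_restrict[OF open_set_path_translated])

lemma rational_path_measurable [measurable]:
  "(\<lambda>p. rational_path (fst p) (snd p)) \<in> borel \<Otimes>\<^sub>M \<F> \<rightarrow>\<^sub>M path_space rat_times"
  using translated_path_measurable[OF rat_times_nonneg] by (simp add: case_prod_beta)

lemma rational_exit_value_pair_measurable:
  assumes "g \<in> borel_measurable borel"
  shows "(\<lambda>p. rational_exit_value V g (rational_path (fst p) (snd p))) \<in> borel_measurable (borel \<Otimes>\<^sub>M \<F>)"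
  by (rule measurable_compose[OF rational_path_measurable rational_exit_value_measurable[OF assms]])

lemma exit_kernel_eq:
  assumes "open V"
  shows "exit_kernel V g x = (\<integral>\<^sup>+\<omega>. rational_exit_value V g (rational_path x \<omega>) \<partial>R)"
  unfolding exit_kernel_def using rational_exit_value_path[OF assms] by (intro nn_integral_cong) simp

lemma exit_value_measurable:
  assumes "open V" "g \<in> borel_measurable borel"
  shows "(\<lambda>\<omega>. exit_value V g (\<lambda>t. x + W t \<omega>)) \<in> borel_measurable \<F>"
proof -
  have "(\<lambda>\<omega>. rational_exit_value V g (rational_path x \<omega>)) \<in> borel_measurable \<F>"
    using measurable_compose[OF measurable_Pair1' rational_exit_value_pair_measurable[OF assms(2)], of x]
    by simp
  then show ?thesis by (simp add: rational_exit_value_path[OF assms(1)] cong: measurable_cong)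
qed

lemma exit_kernel_measurable [measurable]:
  assumes "open V" "g \<in> borel_measurable borel"
  shows "exit_kernel V g \<in> borel_measurable borel"
proof -
  have "(\<lambda>p. rational_exit_value V g (rational_path (fst p) (snd p))) \<in> borel_measurable (borel \<Otimes>\<^sub>M R)"
    using rational_exit_value_pair_measurable[OF assms(2)] by (simp cong: measurable_cong_sets sets_pair_measure_cong)
  from P.borel_measurable_nn_integral_fst[OF this]
  have "(\<lambda>x. \<integral>\<^sup>+\<omega>. rational_exit_value V g (rational_path x \<omega>) \<partial>R) \<in> borel_measurable borel" by simp
  then show ?thesis by (simp add: exit_kernel_eq[OF assms(1)] fun_eq_iff cong: measurable_cong)
qed

lemma exit_kernel_mono: "(\<And>y. g y \<le> g' y) \<Longrightarrow> exit_kernel V g x \<le> exit_kernel V g' x"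
  unfolding exit_kernel_def by (intro nn_integral_mono exit_value_mono)

lemma exit_kernel_linear:
  assumes V: "open V" and g: "g \<in> borel_measurable borel" "g' \<in> borel_measurable borel"
  shows "exit_kernel V (\<lambda>y. g y + c * g' y) x = exit_kernel V g x + c * exit_kernel V g' x"
proof -
  have [measurable]: "(\<lambda>\<omega>. exit_value V g (\<lambda>t. x + W t \<omega>)) \<in> borel_measurable R"
    "(\<lambda>\<omega>. exit_value V g' (\<lambda>t. x + W t \<omega>)) \<in> borel_measurable R"
    using exit_value_measurable[OF V] g by simp_all
  show ?thesis unfolding exit_kernel_def exit_value_linear
    by (simp add: nn_integral_add nn_integral_cmult)
qed

lemma exit_kernel_bounded:
  assumes "\<And>y. g y \<le> ennreal c"
  shows "exit_kernel V g x \<le> ennreal c"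
proof -
  have "exit_kernel V g x \<le> (\<integral>\<^sup>+\<omega>. ennreal c \<partial>R)"
    unfolding exit_kernel_def using assms by (intro nn_integral_mono) (simp add: exit_value_def)
  then show ?thesis using P.emeasure_space_1[of 0] by simp
qed

lemma markov_exit_value:
  assumes V: "open V" and t: "0 \<le> t" and D: "D \<in> sets (F t)" and g: "g \<in> borel_measurable borel"
  shows "(\<integral>\<^sup>+\<omega>. exit_value V g (\<lambda>s. W (t + s) \<omega>) * indicator D \<omega> \<partial>P x)
    = (\<integral>\<^sup>+\<omega>. exit_kernel V g (W t \<omega>) * indicator D \<omega> \<partial>P x)"
proof -
  have "exit_value V g (\<lambda>s. W (t + s) \<omega>) = rational_exit_value V g (\<lambda>u\<in>rat_times. W (t + u) \<omega>)"
    if "\<omega> \<in> space \<F>" for \<omega>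
  proof (rule open_set_path.rational_exit_value_restrict[symmetric])
    have "continuous_on {0..} (\<lambda>s. W (t + s) \<omega>)"
      using t by (intro continuous_on_compose2[OF continuous_paths[OF that]] continuous_intros) auto
    then show "open_set_path V (\<lambda>s. W (t + s) \<omega>)" using V by unfold_locales
  qed
  then have "(\<integral>\<^sup>+\<omega>. exit_value V g (\<lambda>s. W (t + s) \<omega>) * indicator D \<omega> \<partial>P x)
      = (\<integral>\<^sup>+\<omega>. rational_exit_value V g (\<lambda>u\<in>rat_times. W (t + u) \<omega>) * indicator D \<omega> \<partial>P x)"
    by (intro nn_integral_cong) simp
  also have "\<dots> = (\<integral>\<^sup>+\<omega>. exit_kernel V g (W t \<omega>) * indicator D \<omega> \<partial>P x)"
    unfolding exit_kernel_eq[OF V]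
    by (rule markov_path[OF rat_times_nonneg t D rational_exit_value_measurable[OF g]])
  finally show ?thesis .
qed

text \<open>The Markov property at time 0 turns translated paths under \<open>R\<close> into the
  process under \<open>P x\<close>.\<close>

lemma exit_kernel_eq_P:
  assumes V: "open V" and g: "g \<in> borel_measurable borel"
  shows "exit_kernel V g x = (\<integral>\<^sup>+\<omega>. exit_value V g (\<lambda>s. W s \<omega>) \<partial>P x)"
proof -
  have "(\<integral>\<^sup>+\<omega>. exit_value V g (\<lambda>s. W s \<omega>) \<partial>P x)
      = (\<integral>\<^sup>+\<omega>. exit_value V g (\<lambda>s. W (0 + s) \<omega>) * indicator (space \<F>) \<omega> \<partial>P x)"
    by (intro nn_integral_cong) simp
  also have "\<dots> = (\<integral>\<^sup>+\<omega>. exit_kernel V g (W 0 \<omega>) * indicator (space \<F>) \<omega> \<partial>P x)"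
    by (rule markov_exit_value[OF V order_refl space_F_in[OF order_refl] g])
  also have "\<dots> = (\<integral>\<^sup>+\<omega>. exit_kernel V g x \<partial>P x)"
  proof (rule nn_integral_cong_AE)
    show "AE \<omega> in P x. exit_kernel V g (W 0 \<omega>) * indicator (space \<F>) \<omega> = exit_kernel V g x"
      using start[of x] AE_space[of "P x"] by eventually_elim simp
  qed
  finally show ?thesis using P.emeasure_space_1[of x] by simp
qed

lemma open_set_path_W: "open V \<Longrightarrow> \<omega> \<in> space \<F> \<Longrightarrow> open_set_path V (\<lambda>t. W t \<omega>)"
  using open_set_path_translated[of V \<omega> 0] by simp

text \<open>Only boundary values count, so a function that is Borel on the frontier may be replaced
  by a Borel function on the whole space.\<close>

lemma harmonic_kernel_eq_exit_kernel:
  assumes V: "open V" and x: "x \<in> V" and g': "g' \<in> borel_measurable borel"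
    and eq: "\<And>y. y \<in> frontier V \<Longrightarrow> g y = g' y"
  shows "harmonic_kernel P W V g x = exit_kernel V g' x"
  unfolding harmonic_kernel_def exit_kernel_eq_P[OF V g']
proof (rule nn_integral_cong_AE)
  show "AE \<omega> in P x. g (W (real_of_ereal (hitting_time W (- V) \<omega>)) \<omega>)
      * indicator {\<omega>. hitting_time W (- V) \<omega> < \<infinity>} \<omega> = exit_value V g' (\<lambda>s. W s \<omega>)"
    using start[of x] AE_space[of "P x"]
  proof eventually_elim
    case (elim \<omega>)
    interpret open_set_path V "\<lambda>t. W t \<omega>" using elim by (intro open_set_path_W V) simp
    have h: "hitting_time W (- V) \<omega> = exit_time V (\<lambda>t. W t \<omega>)"
      using elim x by (intro hitting_time_eq_exit_time) simp
    have "W 0 \<omega> \<in> closure V" using elim x closure_subset by auto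
    then show ?case
      using exit_point_frontier eq unfolding exit_value_def \<tau>_def by (auto simp: indicator_def h)
  qed
qed

section \<open>Boundary values and semicontinuity of the exit kernel\<close>

lemma exit_kernel_frontier:
  assumes V: "open V" and y: "y \<in> frontier V"
  shows "exit_kernel V g y = g y"
proof -
  have "AE \<omega> in R. exit_value V g (\<lambda>t. y + W t \<omega>) = g y"
    using start[of 0]
  proof eventually_elim
    case (elim \<omega>)
    have "y \<notin> V" using V y by (simp add: frontier_def interior_open)
    then have "exit_time V (\<lambda>t. y + W t \<omega>) \<le> ereal 0" using elim by (intro exit_time_le) auto
    then have "exit_time V (\<lambda>t. y + W t \<omega>) = 0"
      using exit_time_nonneg[of V "\<lambda>t. y + W t \<omega>"] by (simp add: zero_ereal_def[symmetric])
    then show ?case using elim by (simp add: exit_value_def)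
  qed
  then have "exit_kernel V g y = (\<integral>\<^sup>+\<omega>. g y \<partial>R)" unfolding exit_kernel_def by (rule nn_integral_cong_AE)
  then show ?thesis using P.emeasure_space_1[of 0] by simp
qed

text \<open>Starting points in \<open>V\<close> and on the frontier are treated together: the former
  occur along the paths, for polarity, the latter in the boundary limits of
  \<open>k\<close>.\<close>

lemma exit_kernel_lsc:
  assumes V: "strongly_regular V" and x: "x \<in> closure V" and X: "X \<longlonglongrightarrow> x"
    and g: "seq_lsc g" "g \<in> borel_measurable borel"
  shows "exit_kernel V g x \<le> liminf (\<lambda>n. exit_kernel V g (X n))"
proof -
  have opn: "open V" using V by (simp add: strongly_regular_def)
  have lim: "(\<lambda>n. X n - x) \<longlonglongrightarrow> 0" using X by (rule LIM_zero)
  have "AE \<omega> in R. exit_value V g (\<lambda>t. x + W t \<omega>) \<le> liminf (\<lambda>n. exit_value V g (\<lambda>t. X n + W t \<omega>))"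
    using AE_penetrates[OF V x] AE_space[of R]
  proof eventually_elim
    case (elim \<omega>)
    then have "continuous_on {0..} (\<lambda>t. x + W t \<omega>)" by (intro translated_path_continuous) simp
    from exit_value_lsc[OF opn this elim(1) lim g(1)] show ?case by (simp add: algebra_simps)
  qed
  then have "exit_kernel V g x \<le> (\<integral>\<^sup>+\<omega>. liminf (\<lambda>n. exit_value V g (\<lambda>t. X n + W t \<omega>)) \<partial>R)"
    unfolding exit_kernel_def by (rule nn_integral_mono_AE)
  also have "\<dots> \<le> liminf (\<lambda>n. exit_kernel V g (X n))"
    unfolding exit_kernel_def using exit_value_measurable[OF opn g(2)] by (intro nn_integral_liminf) simp
  finally show ?thesis .
qed

text \<open>From a frontier point the exit time is almost surely 0, hence finite, so pathwise
  continuity is available; boundedness gives dominated convergence.\<close>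

lemma exit_kernel_tendsto:
  assumes V: "strongly_regular V" and y: "y \<in> frontier V" and X: "X \<longlonglongrightarrow> y" and \<phi>: "bounded_continuous \<phi>"
  shows "(\<lambda>n. exit_kernel V \<phi> (X n)) \<longlonglongrightarrow> \<phi> y"
proof -
  have opn: "open V" using V by (simp add: strongly_regular_def)
  have lim: "(\<lambda>n. X n - y) \<longlonglongrightarrow> 0" using X by (rule LIM_zero)
  have y': "y \<in> closure V" "y \<notin> V" using y opn by (auto simp: frontier_def interior_open)
  obtain c where c: "\<And>x. \<phi> x \<le> ennreal c" and cont: "continuous_on UNIV \<phi>"
    using \<phi> by (auto simp: bounded_continuous_def)
  have "(\<lambda>n. exit_kernel V \<phi> (X n)) \<longlonglongrightarrow> exit_kernel V \<phi> y"
    unfolding exit_kernel_def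
  proof (rule nn_integral_dominated_convergence[where w="\<lambda>_. ennreal c"])
    show "(\<lambda>\<omega>. exit_value V \<phi> (\<lambda>t. X n + W t \<omega>)) \<in> borel_measurable R"
      "(\<lambda>\<omega>. exit_value V \<phi> (\<lambda>t. y + W t \<omega>)) \<in> borel_measurable R" for n
      using exit_value_measurable[OF opn bounded_continuous_borel[OF \<phi>]] by simp_all
    show "AE \<omega> in R. exit_value V \<phi> (\<lambda>t. X n + W t \<omega>) \<le> ennreal c" for n
      using c by (intro AE_I2) (simp add: exit_value_def)
    show "(\<integral>\<^sup>+\<omega>. ennreal c \<partial>R) < \<infinity>" using P.emeasure_space_1[of 0] by simp
    show "AE \<omega> in R. (\<lambda>n. exit_value V \<phi> (\<lambda>t. X n + W t \<omega>)) \<longlonglongrightarrow> exit_value V \<phi> (\<lambda>t. y + W t \<omega>)"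
      using AE_penetrates[OF V y'(1)] AE_space[of R] start[of 0]
    proof eventually_elim
      case (elim \<omega>)
      then have cw: "continuous_on {0..} (\<lambda>t. y + W t \<omega>)" by (intro translated_path_continuous) simp
      have "exit_time V (\<lambda>t. y + W t \<omega>) \<le> ereal 0" using elim y'(2) by (intro exit_time_le) auto
      then have "exit_time V (\<lambda>t. y + W t \<omega>) < \<infinity>" by (rule le_less_trans) simp
      from exit_value_continuous[OF opn cw elim(1) this lim cont] show ?case by (simp add: algebra_simps)
    qed
  qed simp
  then show ?thesis using exit_kernel_frontier[OF opn y] by simp
qed

text \<open>Before the exit a time shift leaves the exit value unchanged, so the Markov property
  exhibits the exit kernel at \<open>W t\<close> as the conditional expectation of the exit value.
  Both excessiveness and the maximal inequality rest on this.\<close>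

lemma markov_killed_exit_value:
  assumes V: "open V" and t: "0 \<le> t" and g: "g \<in> borel_measurable borel"
    and D: "D \<in> sets (F t)" "\<And>\<omega>. \<omega> \<in> D \<Longrightarrow> ereal t < exit_time V (\<lambda>s. W s \<omega>)"
  shows "(\<integral>\<^sup>+\<omega>. exit_kernel V g (W t \<omega>) * indicator D \<omega> \<partial>P x)
    = (\<integral>\<^sup>+\<omega>. exit_value V g (\<lambda>s. W s \<omega>) * indicator D \<omega> \<partial>P x)"
  unfolding markov_exit_value[OF V t D(1) g, symmetric]
proof (intro nn_integral_cong)
  fix \<omega> assume "\<omega> \<in> space (P x)"
  then have "open_set_path V (\<lambda>s. W s \<omega>)" using open_set_path_W[OF V] by simp
  from exit_value_shift[OF this t D(2)]
  show "exit_value V g (\<lambda>s. W (t + s) \<omega>) * indicator D \<omega> = exit_value V g (\<lambda>s. W s \<omega>) * indicator D \<omega>"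
    by (auto simp: indicator_def)
qed

lemma killed_semigroup_exit_kernel:
  assumes V: "open V" and x: "x \<in> V" and t: "0 \<le> t" and g: "g \<in> borel_measurable borel"
    and u: "\<And>y. y \<in> V \<Longrightarrow> u y = exit_kernel V g y"
  shows "killed_semigroup P W V t u x
    = (\<integral>\<^sup>+\<omega>. exit_value V g (\<lambda>s. W s \<omega>) * indicator (alive V t) \<omega> \<partial>P x)"
proof -
  let ?D = "alive V t"
  have "killed_semigroup P W V t u x = (\<integral>\<^sup>+\<omega>. exit_kernel V g (W t \<omega>) * indicator ?D \<omega> \<partial>P x)"
    unfolding killed_semigroup_def
  proof (rule nn_integral_cong_AE)
    show "AE \<omega> in P x. u (W t \<omega>) * indicator {\<omega>. ereal t < hitting_time W (- V) \<omega>} \<omega>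
        = exit_kernel V g (W t \<omega>) * indicator ?D \<omega>"
      using start[of x] AE_space[of "P x"]
    proof eventually_elim
      case (elim \<omega>)
      have h: "hitting_time W (- V) \<omega> = exit_time V (\<lambda>t. W t \<omega>)"
        using elim x by (intro hitting_time_eq_exit_time) simp
      show ?case
        using elim(2) u before_exit_time[OF t, of V "\<lambda>t. W t \<omega>"] by (auto simp: h indicator_def)
    qed
  qed
  also have "\<dots> = (\<integral>\<^sup>+\<omega>. exit_value V g (\<lambda>s. W s \<omega>) * indicator ?D \<omega> \<partial>P x)"
    by (rule markov_killed_exit_value[OF V t g killed_in_filtration[OF V t]]) simp
  finally show ?thesis .
qed

text \<open>The killed semigroup applied to the exit kernel is the expectation of the exit value
  over paths still alive at \<open>t\<close>. This is at most the full expectation and tends to it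
  as \<open>t\<close> tends to 0, because the exit time is positive for a start in
  \<open>V\<close>.\<close>

lemma excessive_exit_kernel:
  assumes V: "open V" and g: "g \<in> borel_measurable borel"
    and u: "\<And>y. y \<in> V \<Longrightarrow> u y = exit_kernel V g y"
  shows "excessive V (killed_semigroup P W V) 0 u"
proof -
  let ?I = "\<lambda>t \<omega>. exit_value V g (\<lambda>s. W s \<omega>) * indicator (alive V t) \<omega>"
  have K: "killed_semigroup P W V t u x = (\<integral>\<^sup>+\<omega>. ?I t \<omega> \<partial>P x)" if "x \<in> V" "0 \<le> t" for x t
    by (rule killed_semigroup_exit_kernel[OF V that g]) (rule u)
  have ux: "u x = (\<integral>\<^sup>+\<omega>. exit_value V g (\<lambda>s. W s \<omega>) \<partial>P x)" if "x \<in> V" for x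
    using u[OF that] exit_kernel_eq_P[OF V g] by simp
  have le: "killed_semigroup P W V t u x \<le> u x" if "x \<in> V" "0 \<le> t" for x t
    unfolding K[OF that] ux[OF that(1)] by (intro nn_integral_mono) (auto simp: indicator_def)
  have lim: "((\<lambda>t. killed_semigroup P W V t u x) \<longlongrightarrow> u x) (at_right 0)" if x: "x \<in> V" for x
    unfolding tendsto_at_iff_sequentially comp_def
  proof (intro allI impI)
    fix X :: "nat \<Rightarrow> real" assume X: "\<forall>i. X i \<in> {0<..} - {0}" "X \<longlonglongrightarrow> 0"
    then have X0: "0 \<le> X i" for i by (simp add: less_imp_le)
    have meas: "?I (X i) \<in> borel_measurable (P x)" for i
      using exit_value_measurable[OF V g, of 0] sets_F_subset[OF X0 killed_in_filtration[OF V X0]]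
      by (intro borel_measurable_times_ennreal borel_measurable_indicator) simp_all
    have "u x \<le> (\<integral>\<^sup>+\<omega>. liminf (\<lambda>i. ?I (X i) \<omega>) \<partial>P x)"
      unfolding ux[OF x]
    proof (rule nn_integral_mono_AE)
      show "AE \<omega> in P x. exit_value V g (\<lambda>s. W s \<omega>) \<le> liminf (\<lambda>i. ?I (X i) \<omega>)"
        using start[of x] AE_space[of "P x"]
      proof eventually_elim
        case (elim \<omega>)
        interpret open_set_path V "\<lambda>s. W s \<omega>" using elim by (intro open_set_path_W V) simp
        have pos: "ereal 0 < exit_time V (\<lambda>s. W s \<omega>)"
          using less_exit_time_iff[of 0] elim x by simp
        have "(\<lambda>i. ereal (X i)) \<longlonglongrightarrow> ereal 0" using X(2) by simp
        from order_tendstoD(2)[OF this pos]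
        have "\<forall>\<^sub>F i in sequentially. exit_value V g (\<lambda>s. W s \<omega>) \<le> ?I (X i) \<omega>"
          by eventually_elim (use elim(2) in simp)
        then show ?case by (rule Liminf_bounded)
      qed
    qed
    also have "\<dots> \<le> liminf (\<lambda>i. killed_semigroup P W V (X i) u x)"
      unfolding K[OF x X0] by (rule nn_integral_liminf[OF meas])
    finally have 1: "u x \<le> liminf (\<lambda>i. killed_semigroup P W V (X i) u x)" .
    have 2: "limsup (\<lambda>i. killed_semigroup P W V (X i) u x) \<le> u x"
      using le[OF x X0] by (intro Limsup_bounded) simp
    show "(\<lambda>i. killed_semigroup P W V (X i) u x) \<longlonglongrightarrow> u x"
      using 1 2 Liminf_le_Limsup[of sequentially "\<lambda>i. killed_semigroup P W V (X i) u x"]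
      by (intro Liminf_eq_Limsup) (auto intro: antisym order_trans)
  qed
  have "exit_kernel V g \<in> borel_measurable (restrict_space borel V)"
    using exit_kernel_measurable[OF V g] by (rule measurable_restrict_space1)
  then have "u \<in> borel_measurable (restrict_space borel V)"
    by (rule measurable_cong[THEN iffD1, rotated]) (simp add: u space_restrict_space)
  then show ?thesis using le lim by (simp add: excessive_def)
qed

section \<open>A maximal inequality and finiteness along paths\<close>

abbreviation "exceeds V g c t \<equiv> {\<omega>\<in>alive V t. c < exit_kernel V g (W t \<omega>)}"

lemma exceeds_in_filtration:
  assumes V: "open V" and g: "g \<in> borel_measurable borel" and t: "0 \<le> t"
  shows "exceeds V g c t \<in> sets (F t)"
proof -
  have "{z. c < exit_kernel V g z} \<in> sets borel"
    using exit_kernel_measurable[OF V g] by measurable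
  from sets.Int[OF killed_in_filtration[OF V t] measurable_sets[OF adapted[OF t] this]]
  have "alive V t \<inter> (W t -` {z. c < exit_kernel V g z} \<inter> space (F t)) \<in> sets (F t)" .
  also have "alive V t \<inter> (W t -` {z. c < exit_kernel V g z} \<inter> space (F t)) = exceeds V g c t"
    by (auto simp: space_F[OF t])
  finally show ?thesis .
qed

text \<open>Killed at the exit time, \<open>exit_kernel V g (W t)\<close> is a supermartingale.\<close>

lemma maximal_inequality_finite:
  fixes c :: ennreal
  assumes V: "open V" and g: "g \<in> borel_measurable borel" and J: "finite J" "J \<subseteq> {0..}"
  shows "c * emeasure (P x) (\<Union>t\<in>J. exceeds V g c t) \<le> exit_kernel V g x"
proof -
  define A where "A t = exceeds V g c t" for t
  have A: "A t \<in> sets (F t)" if "0 \<le> t" for t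
    unfolding A_def by (rule exceeds_in_filtration[OF V g that])
  \<comment> \<open>The level is exceeded at \<open>t\<close> for the first time in
    \<open>J\<close>: disjoint events with the same union, each known at time
    \<open>t\<close>.\<close>
  define B where "B t = A t - (\<Union>s\<in>{s\<in>J. s < t}. A s)" for t
  have B: "B t \<in> sets (F t)" if "t \<in> J" for t
  proof -
    have "A s \<in> sets (F t)" if "s \<in> J" "s < t" for s
      using that A[of s] F_mono[of s t] J by auto
    then show ?thesis unfolding B_def using that J A by (intro sets.Diff sets.finite_UN) auto
  qed
  have BF: "B t \<in> sets \<F>" if "t \<in> J" for t using B[OF that] J that by (intro sets_F_subset[of t]) auto
  have disj: "disjoint_family_on B J"
    unfolding disjoint_family_on_def
  proof (intro ballI impI)
    fix s t assume st: "s \<in> J" "t \<in> J" "s \<noteq> t"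
    show "B s \<inter> B t = {}"
    proof (cases "s < t")
      case True
      then show ?thesis using st unfolding B_def by blast
    next
      case False
      then have "t < s" using st by simp
      then show ?thesis using st unfolding B_def by blast
    qed
  qed
  have "(\<Union>t\<in>J. A t) = (\<Union>t\<in>J. B t)"
  proof
    show "(\<Union>t\<in>J. B t) \<subseteq> (\<Union>t\<in>J. A t)" unfolding B_def by blast
    show "(\<Union>t\<in>J. A t) \<subseteq> (\<Union>t\<in>J. B t)"
    proof
      fix \<omega> assume "\<omega> \<in> (\<Union>t\<in>J. A t)"
      then have ne: "{t\<in>J. \<omega> \<in> A t} \<noteq> {}" by blast
      have fin: "finite {t\<in>J. \<omega> \<in> A t}" using J by simp
      define m where "m = Min {t\<in>J. \<omega> \<in> A t}"
      have m: "m \<in> J" "\<omega> \<in> A m" using Min_in[OF fin ne] by (simp_all add: m_def)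
      have "\<omega> \<notin> A s" if "s \<in> J" "s < m" for s
      proof
        assume "\<omega> \<in> A s"
        then have "m \<le> s" unfolding m_def using that(1) fin by (intro Min_le) auto
        then show False using that(2) by simp
      qed
      then show "\<omega> \<in> (\<Union>t\<in>J. B t)" using m unfolding B_def by blast
    qed
  qed
  then have "emeasure (P x) (\<Union>t\<in>J. A t) = (\<Sum>t\<in>J. emeasure (P x) (B t))"
    using BF J disj by (subst sum_emeasure) auto
  then have "c * emeasure (P x) (\<Union>t\<in>J. A t) = (\<Sum>t\<in>J. c * emeasure (P x) (B t))"
    by (simp add: sum_distrib_left)
  also have "\<dots> \<le> (\<Sum>t\<in>J. \<integral>\<^sup>+\<omega>. exit_value V g (\<lambda>s. W s \<omega>) * indicator (B t) \<omega> \<partial>P x)"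
  proof (rule sum_mono)
    fix t assume t: "t \<in> J"
    have "c * emeasure (P x) (B t) = (\<integral>\<^sup>+\<omega>. c * indicator (B t) \<omega> \<partial>P x)"
      using BF[OF t] by (simp add: nn_integral_cmult_indicator)
    also have "\<dots> \<le> (\<integral>\<^sup>+\<omega>. exit_kernel V g (W t \<omega>) * indicator (B t) \<omega> \<partial>P x)"
      by (intro nn_integral_mono) (auto simp: indicator_def B_def A_def)
    also have "\<dots> = (\<integral>\<^sup>+\<omega>. exit_value V g (\<lambda>s. W s \<omega>) * indicator (B t) \<omega> \<partial>P x)"
      using t J by (intro markov_killed_exit_value[OF V _ g B]) (auto simp: B_def A_def)
    finally show "c * emeasure (P x) (B t) \<le> (\<integral>\<^sup>+\<omega>. exit_value V g (\<lambda>s. W s \<omega>) * indicator (B t) \<omega> \<partial>P x)" .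
  qed
  also have "\<dots> = (\<integral>\<^sup>+\<omega>. (\<Sum>t\<in>J. exit_value V g (\<lambda>s. W s \<omega>) * indicator (B t) \<omega>) \<partial>P x)"
    using exit_value_measurable[OF V g, of 0] BF
    by (intro nn_integral_sum[symmetric] borel_measurable_times_ennreal borel_measurable_indicator) simp_all
  also have "\<dots> \<le> (\<integral>\<^sup>+\<omega>. exit_value V g (\<lambda>s. W s \<omega>) \<partial>P x)"
  proof (rule nn_integral_mono)
    fix \<omega>
    have "(\<Sum>t\<in>J. indicator (B t) \<omega>) = (indicator (\<Union>t\<in>J. B t) \<omega> :: ennreal)"
      by (rule indicator_UN_disjoint[OF J(1) disj, symmetric])
    then show "(\<Sum>t\<in>J. exit_value V g (\<lambda>s. W s \<omega>) * indicator (B t) \<omega>) \<le> exit_value V g (\<lambda>s. W s \<omega>)"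
      by (simp add: indicator_def flip: sum_distrib_left)
  qed
  also have "\<dots> = exit_kernel V g x" by (rule exit_kernel_eq_P[OF V g, symmetric])
  finally show ?thesis unfolding A_def .
qed

lemma exit_kernel_finite_along_paths:
  assumes V: "strongly_regular V" and g: "seq_lsc g" "g \<in> borel_measurable borel"
    and x: "x \<in> V" "exit_kernel V g x < \<infinity>"
  shows "AE \<omega> in P x. \<forall>t>0. ereal t < hitting_time W (- V) \<omega> \<longrightarrow> exit_kernel V g (W t \<omega>) < \<infinity>"
proof -
  have opn: "open V" using V by (simp add: strongly_regular_def)
  define A where "A c t = exceeds V g c t" for c t
  have A_meas: "A c t \<in> sets \<F>" if "0 \<le> t" for c t
    unfolding A_def by (rule sets_F_subset[OF that exceeds_in_filtration[OF opn g(2) that]])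
  define B where "B c = (\<Union>q\<in>rat_times. A c q)" for c
  have B_meas: "B c \<in> sets \<F>" for c
    unfolding B_def
  proof (rule sets.countable_UN'[OF countable_rat_times], rule image_subsetI)
    fix q assume "q \<in> rat_times"
    then show "A c q \<in> sets \<F>" by (intro A_meas) (simp add: rat_times_def)
  qed
  have B_bound: "c * emeasure (P x) (B c) \<le> exit_kernel V g x" for c
  proof -
    define e where "e = from_nat_into rat_times"
    have ne: "rat_times \<noteq> {}" by (auto simp: rat_times_def intro: exI[of _ 0])
    have range: "range e = rat_times"
      unfolding e_def by (rule range_from_nat_into[OF ne countable_rat_times])
    have e0: "0 \<le> e i" for i using range rat_times_nonneg by auto
    \<comment> \<open>Finitely many times first, then a monotone limit along an enumeration of
      \<open>rat_times\<close>.\<close>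
    have "B c = (\<Union>n. \<Union>t\<in>e ` {..<n}. A c t)"
      unfolding B_def range[symmetric] by (auto intro: lessI)
    moreover have "(SUP n. emeasure (P x) (\<Union>t\<in>e ` {..<n}. A c t)) = emeasure (P x) (\<Union>n. \<Union>t\<in>e ` {..<n}. A c t)"
      using e0 by (intro SUP_emeasure_incseq) (auto simp: incseq_def intro!: sets.finite_UN A_meas intro: less_le_trans)
    ultimately have "emeasure (P x) (B c) = (SUP n. emeasure (P x) (\<Union>t\<in>e ` {..<n}. A c t))" by simp
    then have "c * emeasure (P x) (B c) = (SUP n. c * emeasure (P x) (\<Union>t\<in>e ` {..<n}. A c t))"
      by (simp only: SUP_mult_left_ennreal)
    also have "\<dots> \<le> exit_kernel V g x"
      unfolding A_def using e0 by (intro SUP_least maximal_inequality_finite opn g(2)) auto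
    finally show ?thesis .
  qed
  \<comment> \<open>Exceeding a level \<open>n > 0\<close> has probability at most
    \<open>exit_kernel V g x / n\<close>, and the numerator is finite.\<close>
  have "emeasure (P x) (\<Inter>n. B (of_nat n)) = 0"
  proof (rule ccontr)
    define b where "b = emeasure (P x) (\<Inter>n. B (of_nat n))"
    assume "emeasure (P x) (\<Inter>n. B (of_nat n)) \<noteq> 0"
    then have b: "b \<noteq> 0" by (simp add: b_def)
    have "of_nat n * b \<le> exit_kernel V g x" for n
    proof -
      have "b \<le> emeasure (P x) (B (of_nat n))" unfolding b_def using B_meas by (intro emeasure_mono) auto
      then have "of_nat n * b \<le> of_nat n * emeasure (P x) (B (of_nat n))" by (rule mult_left_mono) simp
      then show ?thesis using B_bound[of "of_nat n"] by (rule order_trans)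
    qed
    then have "(SUP n. of_nat n * b) \<le> exit_kernel V g x" by (intro SUP_least)
    moreover have "(SUP n. of_nat n * b) = top"
      using b by (simp add: ennreal_SUP_of_nat_eq_top flip: SUP_mult_right_ennreal)
    ultimately show False using x(2) by (simp add: top_unique)
  qed
  then have "(\<Inter>n. B (of_nat n)) \<in> null_sets (P x)" using B_meas by (intro null_setsI sets.countable_INT) auto
  then have "AE \<omega> in P x. \<omega> \<notin> (\<Inter>n. B (of_nat n))" by (rule AE_not_in)
  then show ?thesis using start[of x] AE_space[of "P x"]
  proof eventually_elim
    case (elim \<omega>)
    then have \<omega>: "\<omega> \<in> space \<F>" by simp
    interpret open_set_path V "\<lambda>s. W s \<omega>" by (rule open_set_path_W[OF opn \<omega>])
    have h: "hitting_time W (- V) \<omega> = exit_time V (\<lambda>t. W t \<omega>)"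
      using elim x by (intro hitting_time_eq_exit_time) simp
    show ?case
    proof (intro allI impI, rule ccontr)
      fix t :: real assume t: "0 < t" "ereal t < hitting_time W (- V) \<omega>" "\<not> exit_kernel V g (W t \<omega>) < \<infinity>"
      have inf: "exit_kernel V g (W t \<omega>) = top" using t(3) by (simp flip: less_top)
      have lt: "ereal t < exit_time V (\<lambda>s. W s \<omega>)" using t(2) h by simp
      obtain z where z: "ereal t < ereal z" "ereal z < exit_time V (\<lambda>s. W s \<omega>)" using ereal_dense2[OF lt] by blast
      \<comment> \<open>Rational times tending to \<open>t\<close> from above and still before the
        exit, so that the path is alive at them; lower semicontinuity at \<open>W t \<omega>\<close>
        then drives the values along them to infinity.\<close>
      have "\<exists>q. q \<in> \<rat> \<and> t < q \<and> q < min z (t + inverse (real (Suc n)))" for n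
        using Rats_dense_in_real[of t "min z (t + inverse (real (Suc n)))"] z(1) by auto
      then obtain q where q: "\<And>n. q n \<in> \<rat>" "\<And>n. t < q n" "\<And>n. q n < min z (t + inverse (real (Suc n)))"
        by metis
      have "(\<lambda>n. t + inverse (real (Suc n))) \<longlonglongrightarrow> t + 0"
        by (intro tendsto_add tendsto_const LIMSEQ_inverse_real_of_nat)
      then have "q \<longlonglongrightarrow> t"
        using q(2,3) by (intro tendsto_sandwich[of "\<lambda>_. t" q sequentially "\<lambda>n. t + inverse (real (Suc n))"])
          (auto intro!: always_eventually less_imp_le)
      moreover have q0: "0 \<le> q n" for n using q(2)[of n] t(1) by simp
      ultimately have lim: "(\<lambda>n. W (q n) \<omega>) \<longlonglongrightarrow> W t \<omega>"
        using t(1) by (intro continuous_on_tendsto_compose[OF cont]) auto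
      have "W t \<omega> \<in> V" using lt t(1) by (intro before_exit_time) auto
      then have "W t \<omega> \<in> closure V" using closure_subset by blast
      from exit_kernel_lsc[OF V this lim g]
      have liminf: "liminf (\<lambda>n. exit_kernel V g (W (q n) \<omega>)) = top" by (simp add: inf top_unique)
      have "\<omega> \<in> B (of_nat m)" for m :: nat
      proof -
        have "(of_nat m :: ennreal) < top" by (simp add: of_nat_less_top)
        then have "\<forall>\<^sub>F n in sequentially. of_nat m < exit_kernel V g (W (q n) \<omega>)"
          using less_LiminfD[of "of_nat m :: ennreal" sequentially] liminf by metis
        then obtain n where n: "of_nat m < exit_kernel V g (W (q n) \<omega>)"
          by (auto simp: eventually_sequentially)
        have "ereal (q n) < exit_time V (\<lambda>s. W s \<omega>)"
          using q(3)[of n] z(2) by (meson less_ereal.simps(1) less_trans min_less_iff_conj)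
        then have "\<omega> \<in> A (of_nat m) (q n)" using n \<omega> by (simp add: A_def)
        moreover have "q n \<in> rat_times" using q q0 by (simp add: rat_times_def)
        ultimately show ?thesis unfolding B_def by blast
      qed
      then show False using elim(1) by blast
    qed
  qed
qed

end


section \<open>Controlled convergence\<close>

text \<open>For (c1), a bound \<open>c'\<close> on \<open>k\<close> along \<open>A\<close> passes to
  \<open>g y\<close> by semicontinuity; both approximation errors are then at most
  \<open>2^-n * c'\<close>, uniformly near \<open>y\<close>, so the limit can be computed through
  \<open>\<Phi> n\<close>, and \<open>f y\<close> is finite. For (c2),
  \<open>h \<le> C n + 2^-n * k\<close>, where the constant is negligible against \<open>k\<close>
  and \<open>n\<close> is free.\<close>

lemma controlled_convergence_criterion:
  fixes V :: "'e::metric_space set" and h k f g :: "'e \<Rightarrow> ennreal" and \<Phi> \<phi> :: "nat \<Rightarrow> 'e \<Rightarrow> ennreal"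
  assumes opn: "open V"
    and h: "\<And>n x. x \<in> V \<Longrightarrow> h x \<le> \<Phi> n x + ennreal ((1/2)^n) * k x"
      "\<And>n x. x \<in> V \<Longrightarrow> \<Phi> n x \<le> h x + ennreal ((1/2)^n) * k x"
    and f: "\<And>n y. y \<in> frontier V \<Longrightarrow> f y \<le> \<phi> n y + ennreal ((1/2)^n) * g y"
      "\<And>n y. y \<in> frontier V \<Longrightarrow> \<phi> n y \<le> f y + ennreal ((1/2)^n) * g y"
    and lim: "\<And>n y X. y \<in> frontier V \<Longrightarrow> (\<And>i. X i \<in> V) \<Longrightarrow> X \<longlonglongrightarrow> y \<Longrightarrow> (\<lambda>i. \<Phi> n (X i)) \<longlonglongrightarrow> \<phi> n y"
    and lsc: "\<And>y X. y \<in> frontier V \<Longrightarrow> (\<And>i. X i \<in> V) \<Longrightarrow> X \<longlonglongrightarrow> y \<Longrightarrow> g y \<le> liminf (\<lambda>i. k (X i))"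
    and bdd: "\<And>n x. x \<in> V \<Longrightarrow> \<Phi> n x \<le> ennreal (C n)" "\<And>n y. \<phi> n y \<le> ennreal (C n)"
  shows "controlled_convergence V (\<lambda>x. enn2ereal (h x)) (\<lambda>y. enn2ereal (f y)) (\<lambda>x. enn2ereal (k x))
    {x \<in> V. k x < \<infinity>}"
proof -
  have hfin: "h x < top" if "x \<in> V" "k x < \<infinity>" for x
  proof -
    have "h x \<le> ennreal (C 0) + k x"
      using h(1)[of x 0] add_right_mono[OF bdd(1)[of x 0], of "k x"] that by (auto intro: order_trans)
    also have "\<dots> < top" using that by simp
    finally show ?thesis .
  qed
  have small: "\<exists>n. (1/2)^n * c < e" if "0 < e" for c e :: real
  proof -
    have "(\<lambda>n. (1/2)^n * c) \<longlonglongrightarrow> 0 * c" by (intro tendsto_mult tendsto_const LIMSEQ_power_zero) simp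
    then have "\<forall>\<^sub>F n in sequentially. (1/2)^n * c < e" using that by (intro order_tendstoD(2)) auto
    then show ?thesis by (auto simp: eventually_sequentially)
  qed
  have c1: "\<bar>enn2ereal (f y)\<bar> \<noteq> \<infinity> \<and> ((\<lambda>x. enn2ereal (h x)) \<longlongrightarrow> enn2ereal (f y)) (at y within A)"
    if A: "A \<subseteq> {x \<in> V. k x < \<infinity>}" and y: "y \<in> frontier V \<inter> closure A"
      and sup: "Limsup (at y within A) (\<lambda>x. enn2ereal (k x)) < \<infinity>" for A y
  proof -
    have yV: "y \<notin> V" using y opn by (simp add: frontier_def interior_open)
    have yF: "y \<in> frontier V" using y by simp
    obtain c where c: "Limsup (at y within A) (\<lambda>x. enn2ereal (k x)) < ereal c" using ereal_dense2[OF sup] by blast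
    have kc: "\<forall>\<^sub>F x in at y within A. k x \<le> ennreal (max c 0)"
      using Limsup_lessD[OF c]
    proof eventually_elim
      case (elim x)
      then have "enn2ereal (k x) \<le> enn2ereal (ennreal (max c 0))"
        by (simp add: enn2ereal_ennreal max_def) (metis less_ereal.simps(1) less_imp_le less_trans not_le order_trans)
      then show ?case by (simp add: less_eq_ennreal.rep_eq)
    qed
    define c' where "c' = max c 0"
    have c': "0 \<le> c'" by (simp add: c'_def)
    have seq_k: "\<forall>\<^sub>F i in sequentially. k (X i) \<le> ennreal c'" if "\<And>i. X i \<in> A" "X \<longlonglongrightarrow> y" for X
    proof -
      have "X i \<noteq> y" for i using that(1)[of i] A yV by auto
      then have "filterlim X (at y within A) sequentially"
        using that by (auto simp: filterlim_at)
      then show ?thesis using kc unfolding filterlim_iff c'_def by blast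
    qed
    obtain X0 where X0: "\<And>i. X0 i \<in> A" "X0 \<longlonglongrightarrow> y" using y closure_sequential[of y A] by auto
    have "g y \<le> liminf (\<lambda>i. k (X0 i))" using X0 A by (intro lsc yF) auto
    also have "\<dots> \<le> liminf (\<lambda>i. ennreal c')" by (intro Liminf_mono seq_k X0)
    finally have gy: "g y \<le> ennreal c'" by (simp add: Liminf_const)
    have wg: "ennreal ((1/2)^n) * g y \<le> ennreal ((1/2)^n * c')" for n
      using mult_left_mono[OF gy, of "ennreal ((1/2)^n)"] c' by (simp add: ennreal_mult)
    have f': "f y \<le> \<phi> n y + ennreal ((1/2)^n * c')" "\<phi> n y \<le> f y + ennreal ((1/2)^n * c')" for n
      using f(1)[OF yF, of n] f(2)[OF yF, of n] add_left_mono[OF wg[of n], of "\<phi> n y"] add_left_mono[OF wg[of n], of "f y"]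
      by (auto intro: order_trans)
    have ffin: "f y < top"
    proof -
      have "f y \<le> ennreal (C 0) + ennreal ((1/2)^0 * c')"
        using f'(1)[of 0] add_right_mono[OF bdd(2)[of 0 y], of "ennreal ((1/2)^0 * c')"] by (rule order_trans)
      also have "\<dots> < top" by simp
      finally show ?thesis .
    qed
    have hlim: "(\<lambda>i. h (X i)) \<longlonglongrightarrow> f y" if X: "\<And>i. X i \<in> A" "X \<longlonglongrightarrow> y" for X
    proof -
      have XV: "X i \<in> V" for i using X(1) A by auto
      have h': "\<forall>\<^sub>F i in sequentially. h (X i) \<le> \<Phi> n (X i) + ennreal ((1/2)^n * c')
          \<and> \<Phi> n (X i) \<le> h (X i) + ennreal ((1/2)^n * c')" for n
        using seq_k[OF X]
      proof eventually_elim
        case (elim i)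
        have wk: "ennreal ((1/2)^n) * k (X i) \<le> ennreal ((1/2)^n * c')"
          using mult_left_mono[OF elim, of "ennreal ((1/2)^n)"] c' by (simp add: ennreal_mult)
        show ?case
          using h(1)[OF XV, of i n] h(2)[OF XV, of n i] add_left_mono[OF wk, of "\<Phi> n (X i)"] add_left_mono[OF wk, of "h (X i)"]
          by (auto intro: order_trans)
      qed
      have L: "(\<lambda>i. \<Phi> n (X i) + ennreal r) \<longlonglongrightarrow> \<phi> n y + ennreal r" for n r
        by (intro tendsto_add lim[OF yF XV X(2)] tendsto_const)
      have up: "limsup (\<lambda>i. h (X i)) \<le> f y + ennreal e" if e: "0 < e" for e
      proof -
        \<comment> \<open>Half of \<open>e\<close> for each of the two errors: between
          \<open>h\<close> and \<open>\<Phi> n\<close>, and between \<open>\<phi> n\<close> and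
          \<open>f\<close>.\<close>
        obtain n where n: "(1/2)^n * c' < e / 2" using small[of "e/2" c'] e by auto
        have "limsup (\<lambda>i. h (X i)) \<le> limsup (\<lambda>i. \<Phi> n (X i) + ennreal ((1/2)^n * c'))"
          using h'[of n] by (intro Limsup_mono) (auto elim: eventually_mono)
        also have "\<dots> = \<phi> n y + ennreal ((1/2)^n * c')" using L by (intro lim_imp_Limsup) auto
        also have "\<dots> \<le> (f y + ennreal ((1/2)^n * c')) + ennreal ((1/2)^n * c')"
          by (intro add_right_mono f')
        also have "\<dots> = f y + ennreal ((1/2)^n * c' + (1/2)^n * c')"
          using c' by (subst ennreal_plus) (auto simp: add.assoc)
        also have "\<dots> \<le> f y + ennreal e" using n by (intro add_left_mono ennreal_leI) linarith
        finally show ?thesis .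
      qed
      have low: "f y \<le> liminf (\<lambda>i. h (X i)) + ennreal e" if e: "0 < e" for e
      proof -
        obtain n where n: "(1/2)^n * c' < e / 2" using small[of "e/2" c'] e by auto
        have "f y \<le> \<phi> n y + ennreal ((1/2)^n * c')" by (rule f')
        also have "\<dots> = liminf (\<lambda>i. \<Phi> n (X i) + ennreal ((1/2)^n * c'))"
          using L by (intro lim_imp_Liminf[symmetric]) auto
        also have "\<dots> \<le> liminf (\<lambda>i. h (X i) + ennreal e)"
        proof (rule Liminf_mono)
          show "\<forall>\<^sub>F i in sequentially. \<Phi> n (X i) + ennreal ((1/2)^n * c') \<le> h (X i) + ennreal e"
            using h'[of n]
          proof eventually_elim
            case (elim i)
            then have "\<Phi> n (X i) + ennreal ((1/2)^n * c') \<le> (h (X i) + ennreal ((1/2)^n * c')) + ennreal ((1/2)^n * c')"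
              by (intro add_right_mono) simp
            also have "\<dots> = h (X i) + ennreal ((1/2)^n * c' + (1/2)^n * c')"
              using c' by (subst ennreal_plus) (auto simp: add.assoc)
            also have "\<dots> \<le> h (X i) + ennreal e" using n by (intro add_left_mono ennreal_leI) linarith
            finally show ?case .
          qed
        qed
        also have "\<dots> = liminf (\<lambda>i. h (X i)) + ennreal e" by (rule Liminf_add_const) auto
        finally show ?thesis .
      qed
      have "limsup (\<lambda>i. h (X i)) \<le> f y" "f y \<le> liminf (\<lambda>i. h (X i))"
        by (rule ennreal_le_epsilon, rule up, assumption) (rule ennreal_le_epsilon, rule low, assumption)
      then show ?thesis using Liminf_le_Limsup[of sequentially "\<lambda>i. h (X i)"]
        by (intro Liminf_eq_Limsup antisym[of "liminf _"] antisym[of "limsup _"]) (auto intro: order_trans)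
    qed
    have "((\<lambda>x. enn2ereal (h x)) \<longlongrightarrow> enn2ereal (f y)) (at y within A)"
      unfolding tendsto_at_iff_sequentially comp_def
    proof (intro allI impI)
      fix X assume "\<forall>i. X i \<in> A - {y}" "X \<longlonglongrightarrow> y"
      then have "(\<lambda>i. h (X i)) \<longlonglongrightarrow> f y" by (intro hlim) auto
      then show "(\<lambda>i. enn2ereal (h (X i))) \<longlonglongrightarrow> enn2ereal (f y)"
        by (rule continuous_on_tendsto_compose[OF continuous_on_enn2ereal]) auto
    qed
    moreover have "\<bar>enn2ereal (f y)\<bar> \<noteq> \<infinity>" using ffin by (cases "f y") auto
    ultimately show ?thesis by simp
  qed
  have c2: "((\<lambda>x. enn2ereal (h x) / (1 + enn2ereal (k x))) \<longlongrightarrow> 0) (at y within A)"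
    if A: "A \<subseteq> {x \<in> V. k x < \<infinity>}" and k: "((\<lambda>x. enn2ereal (k x)) \<longlongrightarrow> \<infinity>) (at y within A)" for A y
  proof (rule order_tendstoI)
    fix a :: ereal assume a: "a < 0"
    have "a < enn2ereal (h x) / (1 + enn2ereal (k x))" for x
      by (rule less_le_trans[OF a]) (intro zero_le_divide_ereal, simp, simp add: add_nonneg_pos)
    then show "\<forall>\<^sub>F x in at y within A. a < enn2ereal (h x) / (1 + enn2ereal (k x))" by simp
  next
    fix a :: ereal assume "0 < a"
    then obtain e where e: "0 < e" "ereal e < a" using ereal_dense2[of 0 a] by (auto simp: zero_ereal_def)
    obtain n where n: "(1/2)^n * 1 < e / 2" using small[of "e/2" 1] e by auto
    define c where "c = max (C n) 0"
    \<comment> \<open>Beyond this value of \<open>k\<close> the bound \<open>c\<close> on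
      \<open>\<Phi> n\<close> is below half of \<open>e * k\<close>; the other half absorbs
      \<open>2^-n * k\<close>.\<close>
    have "\<forall>\<^sub>F x in at y within A. ereal (2 * c / e) < enn2ereal (k x)"
      using k by (intro order_tendstoD(1)) auto
    moreover have "\<forall>\<^sub>F x in at y within A. x \<in> A" by (simp add: eventually_at_filter)
    ultimately show "\<forall>\<^sub>F x in at y within A. enn2ereal (h x) / (1 + enn2ereal (k x)) < a"
    proof eventually_elim
      case (elim x)
      then have x: "x \<in> V" "k x < \<infinity>" using A by auto
      obtain b where b: "k x = ennreal b" "0 \<le> b" using x(2) by (cases "k x") auto
      obtain d where d: "h x = ennreal d" "0 \<le> d" using hfin[OF x] by (cases "h x") auto
      have c0: "0 \<le> c + (1/2)^n * b" "0 \<le> c" using b by (auto simp: c_def)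
      have "ennreal d \<le> \<Phi> n x + ennreal ((1/2)^n) * k x" using h(1)[OF x(1), of n] by (simp only: d(1))
      also have "\<dots> \<le> ennreal c + ennreal ((1/2)^n) * k x"
        using bdd(1)[OF x(1), of n] by (intro add_right_mono) (simp add: c_def ennreal_max_0)
      also have "\<dots> = ennreal (c + (1/2)^n * b)" using b c0 by (simp add: ennreal_mult)
      finally have "d \<le> c + (1/2)^n * b" using c0 by (subst (asm) ennreal_le_iff)
      moreover have "2 * c / e < b" using elim(1) b by (simp add: enn2ereal_ennreal)
      then have "c < e / 2 * b" using e(1) by (simp add: field_simps)
      moreover have "(1/2)^n * b \<le> e / 2 * b" using n b by (intro mult_right_mono) auto
      ultimately have "d < e * (1 + b)" using e(1) by (simp add: algebra_simps)
      then have "d / (1 + b) < e" using b by (simp add: field_simps)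
      moreover have "enn2ereal (h x) / (1 + enn2ereal (k x)) = ereal (d / (1 + b))"
        using b d by (simp add: enn2ereal_ennreal one_ereal_def)
      ultimately show ?case using e(2) by (metis less_ereal.simps(1) less_trans)
    qed
  qed
  show ?thesis
    unfolding controlled_convergence_def
  proof (intro conjI allI impI ballI)
    fix x assume x: "x \<in> {x \<in> V. k x < \<infinity>}"
    then show "\<bar>enn2ereal (h x)\<bar> \<noteq> \<infinity>" "\<bar>enn2ereal (k x)\<bar> \<noteq> \<infinity>"
      using hfin[of x] by (cases "h x"; cases "k x"; auto)+
  qed (use c1 c2 in auto)
qed

section \<open>The law of the exit point\<close>

context brownian_motion
begin

text \<open>A measure on the whole Polish space, so that approximation by regularity applies; its
  restriction to the frontier is the harmonic image. The rational versions give joint measurability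
  in starting point and path.\<close>

definition exit_law :: "'e set \<Rightarrow> 'e measure \<Rightarrow> 'e measure" where
  "exit_law V lam = distr
    (density (lam \<Otimes>\<^sub>M R) (\<lambda>p. indicator {..<\<infinity>} (rational_exit_time V (rational_path (fst p) (snd p)))))
    borel (\<lambda>p. rational_exit_point V (rational_path (fst p) (snd p)))"

lemma sets_exit_law [simp]: "sets (exit_law V lam) = sets borel"
  by (simp add: exit_law_def)

lemma space_exit_law [simp]: "space (exit_law V lam) = UNIV"
  by (simp add: exit_law_def)

lemma nn_integral_exit_law:
  assumes V: "open V" and lam: "sets lam = sets (restrict_space borel V)"
    and g: "g \<in> borel_measurable borel"
  shows "(\<integral>\<^sup>+y. g y \<partial>exit_law V lam) = (\<integral>\<^sup>+x. exit_kernel V g x \<partial>lam)"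
proof -
  have "id \<in> lam \<rightarrow>\<^sub>M borel"
    using measurable_restrict_space1[OF measurable_id, of borel V] lam by (simp cong: measurable_cong_sets)
  then have "(\<lambda>p. (fst p, snd p)) \<in> lam \<Otimes>\<^sub>M R \<rightarrow>\<^sub>M borel \<Otimes>\<^sub>M \<F>"
    by (intro measurable_Pair measurable_compose[OF measurable_fst, of id, simplified] )
       (auto simp: id_def cong: measurable_cong_sets intro: measurable_compose[OF measurable_fst])
  from measurable_compose[OF this rational_path_measurable]
  have path: "(\<lambda>p. rational_path (fst p) (snd p)) \<in> lam \<Otimes>\<^sub>M R \<rightarrow>\<^sub>M path_space rat_times" by simp
  note [measurable] = measurable_compose[OF path rational_exit_time_measurable[of V]]
    measurable_compose[OF path rational_exit_point_measurable[of V]]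
    measurable_compose[OF path rational_exit_value_measurable[OF g, of V]]
  note [measurable] = g
  have "(\<integral>\<^sup>+y. g y \<partial>exit_law V lam)
      = (\<integral>\<^sup>+p. indicator {..<\<infinity>} (rational_exit_time V (rational_path (fst p) (snd p)))
          * g (rational_exit_point V (rational_path (fst p) (snd p))) \<partial>(lam \<Otimes>\<^sub>M R))"
    unfolding exit_law_def by (subst nn_integral_distr) (auto simp: nn_integral_density)
  also have "\<dots> = (\<integral>\<^sup>+p. rational_exit_value V g (rational_path (fst p) (snd p)) \<partial>(lam \<Otimes>\<^sub>M R))"
    by (intro nn_integral_cong) (simp add: rational_exit_value_def indicator_def)
  also have "\<dots> = (\<integral>\<^sup>+x. \<integral>\<^sup>+\<omega>. rational_exit_value V g (rational_path x \<omega>) \<partial>R \<partial>lam)"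
    by (subst P.nn_integral_fst[symmetric]) simp_all
  finally show ?thesis by (simp add: exit_kernel_eq[OF V])
qed

lemma finite_exit_law:
  assumes "open V" "sets lam = sets (restrict_space borel V)" "finite_measure lam"
  shows "finite_measure (exit_law V lam)"
proof (rule finite_measureI)
  interpret finite_measure lam by fact
  have "emeasure (exit_law V lam) (space (exit_law V lam)) = (\<integral>\<^sup>+y. 1 \<partial>exit_law V lam)" by simp
  also have "\<dots> = (\<integral>\<^sup>+x. exit_kernel V (\<lambda>_. 1) x \<partial>lam)" by (rule nn_integral_exit_law) (use assms in auto)
  also have "\<dots> \<le> (\<integral>\<^sup>+x. 1 \<partial>lam)"
    using exit_kernel_bounded[of "\<lambda>_. 1" 1 V] by (intro nn_integral_mono) simp
  also have "\<dots> < \<infinity>" by (simp flip: less_top)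
  finally show "emeasure (exit_law V lam) (space (exit_law V lam)) \<noteq> \<infinity>" by simp
qed

text \<open>\<open>measure_of\<close> yields the zero measure unless its set function is countably
  additive, so the harmonic image is identified with the restriction of a genuine measure.\<close>

lemma harmonic_image_eq:
  assumes V: "open V" and lam: "sets lam = sets (restrict_space borel V)"
  shows "harmonic_image P W V lam = restrict_space (exit_law V lam) (frontier V)"
proof -
  let ?S = "sets (restrict_space borel (frontier V))"
  have S: "?S = (\<inter>) (frontier V) ` sets borel" by (simp add: sets_restrict_space)
  have sp: "space lam = V" using sets_eq_imp_space_eq[OF lam] by (simp add: space_restrict_space)
  have fr: "frontier V \<in> sets borel" by (simp add: frontier_closed borel_closed)
  have "sigma_sets (frontier V) ?S = ?S"
    using sets.sigma_sets_eq[of "restrict_space borel (frontier V)"] by (simp add: space_restrict_space)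
  moreover have "(\<integral>\<^sup>+x. harmonic_kernel P W V (indicator A) x \<partial>lam) = emeasure (exit_law V lam) A" if "A \<in> ?S" for A
  proof -
    have A: "A \<in> sets borel" using that fr by (auto simp: sets_restrict_space)
    have "(\<integral>\<^sup>+x. harmonic_kernel P W V (indicator A) x \<partial>lam) = (\<integral>\<^sup>+x. exit_kernel V (indicator A) x \<partial>lam)"
      using A sp by (intro nn_integral_cong harmonic_kernel_eq_exit_kernel V borel_measurable_indicator) auto
    also have "\<dots> = (\<integral>\<^sup>+y. indicator A y \<partial>exit_law V lam)"
      using A by (intro nn_integral_exit_law[OF V lam, symmetric] borel_measurable_indicator)
    also have "\<dots> = emeasure (exit_law V lam) A" using A by simp
    finally show ?thesis .
  qed
  ultimately have "harmonic_image P W V lam = measure_of (frontier V) ?S (emeasure (exit_law V lam))"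
    unfolding harmonic_image_def using sets.space_closed[of "restrict_space borel (frontier V)"]
    by (intro measure_of_eq) (auto simp: space_restrict_space)
  also have "\<dots> = restrict_space (exit_law V lam) (frontier V)"
    unfolding S restrict_space_def[of "exit_law V lam"] by simp
  finally show ?thesis .
qed

end

theorem theorem5p3:
  fixes \<iota> :: "'h::{real_inner, polish_space} \<Rightarrow> 'e::{banach, polish_space}"
    and \<mu> :: "'e measure"
    and \<F> :: "'w measure" and F :: "real \<Rightarrow> 'w measure"
    and W :: "real \<Rightarrow> 'w \<Rightarrow> 'e" and \<theta> :: "real \<Rightarrow> 'w \<Rightarrow> 'w"
    and P :: "'e \<Rightarrow> 'w measure"
    and V :: "'e set" and lam :: "'e measure" and f :: "'e \<Rightarrow> ennreal"
  assumes BM: "brownian_motion \<iota> \<mu> \<F> F W \<theta> P"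
    and V: "strongly_regular V"
    and sets_lam: "sets lam = sets (restrict_space borel V)"
    and finite_lam: "finite_measure lam"
    and f: "f \<in> L1_plus (harmonic_image P W V lam)"
  shows "\<exists>g M. g \<in> borel_measurable (restrict_space borel (frontier V))
    \<and> M \<in> null_sets lam
    \<and> closedin (fine_topology V (killed_semigroup P W V)) M
    \<and> killed_polar P W V lam M
    \<and> harmonic_kernel P W V g \<in> L1_plus lam
    \<and> controlled_convergence V
        (\<lambda>x. enn2ereal (harmonic_kernel P W V f x)) (\<lambda>y. enn2ereal (f y))
        (\<lambda>x. enn2ereal (harmonic_kernel P W V g x)) (V - M)"
proof -
  interpret brownian_motion \<iota> \<mu> \<F> F W \<theta> P by (rule BM)
  have opn: "open V" using V by (simp add: strongly_regular_def)
  have sp: "space lam = V" using sets_eq_imp_space_eq[OF sets_lam] by (simp add: space_restrict_space)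
  have fr: "frontier V \<in> sets borel" by (simp add: frontier_closed borel_closed)
  let ?\<nu> = "exit_law V lam"
  \<comment> \<open>\<open>f\<close> is Borel on the frontier only; extended by zero it is Borel on
    the whole space and has the same harmonic kernel on \<open>V\<close>.\<close>
  define f' where "f' y = f y * indicator (frontier V) y" for y
  have f_im: "f \<in> borel_measurable (restrict_space ?\<nu> (frontier V))"
    "(\<integral>\<^sup>+y. f y \<partial>restrict_space ?\<nu> (frontier V)) < \<infinity>"
    using f unfolding L1_plus_def harmonic_image_eq[OF opn sets_lam] by auto
  have f': "f' \<in> borel_measurable borel"
  proof -
    have "f \<in> borel_measurable (restrict_space borel (frontier V))"
      using f_im(1) by (simp cong: measurable_cong_sets sets_restrict_space_cong)
    then show ?thesis unfolding f'_def using fr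
      by (subst (asm) borel_measurable_restrict_space_iff_ennreal) auto
  qed
  have "(\<integral>\<^sup>+y. f' y \<partial>?\<nu>) < \<infinity>"
    using f_im(2) fr unfolding f'_def by (subst (asm) nn_integral_restrict_space) auto
  from continuous_approximation_controlled_by_lsc[OF sets_exit_law finite_exit_law[OF opn sets_lam finite_lam] f' this]
  obtain g \<phi> where g: "seq_lsc g" "g \<in> borel_measurable borel" "(\<integral>\<^sup>+y. g y \<partial>?\<nu>) < \<infinity>"
    and \<phi>: "\<And>n::nat. bounded_continuous (\<phi> n)"
    and approx: "\<And>n x. f' x \<le> \<phi> n x + ennreal ((1/2) ^ n) * g x" "\<And>n x. \<phi> n x \<le> f' x + ennreal ((1/2) ^ n) * g x"
    by blast
  have f'_fr: "f' y = f y" if "y \<in> frontier V" for y using that by (simp add: f'_def)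
  have Hf: "harmonic_kernel P W V f x = exit_kernel V f' x" if "x \<in> V" for x
    by (rule harmonic_kernel_eq_exit_kernel[OF opn that f']) (simp add: f'_fr)
  let ?k = "harmonic_kernel P W V g"
  have Hg: "?k x = exit_kernel V g x" if "x \<in> V" for x
    by (rule harmonic_kernel_eq_exit_kernel[OF opn that g(2)]) simp
  define M where "M = {x \<in> V. ?k x = \<infinity>}"
  have kM: "{x \<in> V. ?k x < \<infinity>} = V - M" by (auto simp: M_def simp flip: less_top)
  have k_restrict: "exit_kernel V g \<in> borel_measurable (restrict_space borel V)"
    using exit_kernel_measurable[OF opn g(2)] by (rule measurable_restrict_space1)
  then have "exit_kernel V g \<in> borel_measurable lam" using sets_lam by (simp cong: measurable_cong_sets)
  then have k_meas: "?k \<in> borel_measurable lam"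
    by (rule measurable_cong[THEN iffD1, rotated]) (simp add: sp Hg)
  have k_int: "(\<integral>\<^sup>+x. ?k x \<partial>lam) < \<infinity>"
  proof -
    have "(\<integral>\<^sup>+x. ?k x \<partial>lam) = (\<integral>\<^sup>+x. exit_kernel V g x \<partial>lam)"
      by (intro nn_integral_cong) (simp add: sp Hg)
    then show ?thesis using g(3) nn_integral_exit_law[OF opn sets_lam g(2)] by simp
  qed
  have k_AE: "AE x in lam. ?k x \<noteq> \<infinity>" using k_int by (intro nn_integral_PInf_AE[OF k_meas]) auto
  have M_eq: "M = {x \<in> space lam. ?k x = \<infinity>}" by (simp add: M_def sp)
  have M_sets: "M \<in> sets lam" unfolding M_eq using k_meas by measurable
  have M_borel: "M \<in> sets borel" using M_sets opn sets_lam by (auto simp: sets_restrict_space)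
  have null: "M \<in> null_sets lam"
    using k_AE M_sets unfolding M_eq by (subst (asm) AE_iff_null) (auto simp flip: less_top)
  have exc: "excessive V (killed_semigroup P W V) 0 ?k"
    by (rule excessive_exit_kernel[OF opn g(2) Hg])
  have "closedin (fine_topology V (killed_semigroup P W V)) M"
  proof -
    \<comment> \<open>\<open>G = UNIV\<close> shows that \<open>V\<close> is the whole space of the
      topology, and \<open>G = {..<\<infinity>}\<close> that \<open>V - M\<close> is finely
      open.\<close>
    let ?\<B> = "{{x \<in> V. u x \<in> G} | u G. excessive V (killed_semigroup P W V) 0 u \<and> open G}"
    have "{x \<in> V. ?k x \<in> UNIV} \<in> ?\<B>" "{x \<in> V. ?k x \<in> {..<\<infinity>}} \<in> ?\<B>"
      using exc by (blast intro: open_UNIV, blast intro: open_lessThan)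
    then have "V \<in> ?\<B>" "V - M \<in> ?\<B>" using kM by simp_all
    moreover have "\<Union>?\<B> \<subseteq> V" by blast
    ultimately have "topspace (fine_topology V (killed_semigroup P W V)) = V"
      "openin (fine_topology V (killed_semigroup P W V)) (V - M)"
      unfolding fine_topology_def topology_generated_by_topspace
      by (blast, intro topology_generated_by_Basis)
    then show ?thesis by (auto simp: closedin_def M_def)
  qed
  moreover have "killed_polar P W V lam M"
    unfolding killed_polar_def
  proof (intro conjI M_borel)
    show "M \<subseteq> V" by (auto simp: M_def)
    show "AE x in lam. AE \<omega> in P x. \<not> (\<exists>t>0. ereal t < hitting_time W (- V) \<omega> \<and> W t \<omega> \<in> M)"
      using k_AE AE_space[of lam]
    proof eventually_elim
      case (elim x)
      \<comment> \<open>Finiteness of \<open>k\<close> at the starting point, which the maximal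
        inequality requires, holds for \<open>lam\<close>-almost every \<open>x\<close> by
        integrability.\<close>
      then have x: "x \<in> V" "exit_kernel V g x < \<infinity>" using Hg[of x] by (auto simp: sp simp flip: less_top)
      from exit_kernel_finite_along_paths[OF V g(1,2) x] show ?case
        by eventually_elim (auto simp: M_def Hg)
    qed
  qed
  moreover have "g \<in> borel_measurable (restrict_space borel (frontier V))"
    using g(2) by (rule measurable_restrict_space1)
  moreover have "controlled_convergence V (\<lambda>x. enn2ereal (harmonic_kernel P W V f x)) (\<lambda>y. enn2ereal (f y))
      (\<lambda>x. enn2ereal (?k x)) (V - M)"
  proof -
    obtain C where C: "\<And>n x. \<phi> n x \<le> ennreal (C n)" using \<phi> unfolding bounded_continuous_def by metis
    note lin = exit_kernel_linear[OF opn _ g(2)]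
    show ?thesis unfolding kM[symmetric]
    proof (rule controlled_convergence_criterion[OF opn, where \<Phi>="\<lambda>n. exit_kernel V (\<phi> n)" and \<phi>=\<phi> and g=g and C=C])
      fix n x assume x: "x \<in> V"
      show "harmonic_kernel P W V f x \<le> exit_kernel V (\<phi> n) x + ennreal ((1/2)^n) * ?k x"
        unfolding Hf[OF x] Hg[OF x] lin[OF bounded_continuous_borel[OF \<phi>], symmetric]
        by (rule exit_kernel_mono) (rule approx)
      show "exit_kernel V (\<phi> n) x \<le> harmonic_kernel P W V f x + ennreal ((1/2)^n) * ?k x"
        unfolding Hf[OF x] Hg[OF x] lin[OF f', symmetric]
        by (rule exit_kernel_mono) (rule approx)
      show "exit_kernel V (\<phi> n) x \<le> ennreal (C n)" by (rule exit_kernel_bounded[OF C])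
    next
      fix n y assume y: "y \<in> frontier V"
      show "f y \<le> \<phi> n y + ennreal ((1/2)^n) * g y" "\<phi> n y \<le> f y + ennreal ((1/2)^n) * g y"
        using approx(1)[of y n] approx(2)[of n y] f'_fr[OF y] by simp_all
    next
      fix n and y and X :: "nat \<Rightarrow> 'e" assume "y \<in> frontier V" "X \<longlonglongrightarrow> y"
      then show "(\<lambda>i. exit_kernel V (\<phi> n) (X i)) \<longlonglongrightarrow> \<phi> n y" by (rule exit_kernel_tendsto[OF V _ _ \<phi>])
    next
      fix y and X :: "nat \<Rightarrow> 'e" assume y: "y \<in> frontier V" and X: "\<And>i. X i \<in> V" "X \<longlonglongrightarrow> y"
      have "y \<in> closure V" using y by (simp add: frontier_def)
      from exit_kernel_lsc[OF V this X(2) g(1,2)]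
      show "g y \<le> liminf (\<lambda>i. ?k (X i))" using X(1) by (simp add: Hg exit_kernel_frontier[OF opn y])
    qed (rule C)
  qed
  ultimately show ?thesis using null k_meas k_int unfolding L1_plus_def by blast
qed

end
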